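(* The set of pairs $(U_1,U_2)\in\Omega$ for which the metric $ds^2=(U_1(q_1)-U_2(q_2))(dq_1^2+dq_2^2)$ on the torus $\mathbb R^2/\mathbb Z^2$ is nondegenerate is dense in $\Omega$, where $\Omega$ carries the topology induced by the Whitney $C^\infty$-topology of $C^\infty(\mathbb R/\mathbb Z)\times C^\infty(\mathbb R/\mathbb Z)$.
   Context: **The set $\Omega$.** $\Omega$ is the set of pairs $(U_1,U_2)$ such that for $i=1,2$: $U_i\in C^\infty(\mathbb R)$ is real valued; $U_i(q+1)=U_i(q)$ for all $q$; $U_i$ has exactly one minimum and one maximum in $[0,1)$, both nondegenerate, and $U_i''\ne0$ at every critical point of $U_i$ (so these two points are the only critical points in $[0,1)$); and $U_1(q_1)>U_2(q_2)$ for all $q_1,q_2\in\mathbb R$. On the compact manifold $\mathbb R/\mathbb Z$ the Whitney $C^\infty$-topology is the topology of uniform convergence of all derivatives. **Notation.** For $(U_1,U_2)\in\Omega$ let $c_1=\max U_1=U_1(M_1)$, $c_2=\min U_1=U_1(m_1)$, $c_3=\max U_2=U_2(M_2)$, $c_4=\min U_2=U_2(m_2)$, so $c_4<c_3<c_2<c_1$. For $c\in[c_4,c_1]$ let $$F_1(c)=\int_{\{q\in[0,1]:U_1(q)\ge c\}}(U_1(q)-c)^{1/2}dq,\qquad F_2(c)=\int_{\{q\in[0,1]:U_2(q)\le c\}}(c-U_2(q))^{1/2}dq .$$ It is known that $F_1$ is continuous and strictly decreasing, $C^\infty$ on $[c_4,c_2)\cup(c_2,c_1]$; $F_2$ is continuous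 and strictly increasing, $C^\infty$ on $[c_4,c_3)\cup(c_3,c_1]$; their derivatives do not vanish (one-sided derivatives at $c_1,c_4$). The curvature of the plane curve $\gamma=(F_1(c),F_2(c))$ is $$\kappa(c)=\frac{F_2''F_1'-F_1''F_2'}{((F_1')^2+(F_2')^2)^{3/2}}(c),\qquad c\neq c_2,c_3.$$ **Typical numbers.** A real number $\alpha$ is typical if there exist $\tau>0$ and $\delta(\alpha)>0$ such that $|k_1+\alpha k_2|\ge\frac{\delta(\alpha)}{|k_2|\log(1+|k_2|)^\tau}$ for all $k_1,k_2\in\mathbb Z$ with $k_2\ne0$. **Nondegenerate metrics.** The metric $ds^2=(U_1(q_1)-U_2(q_2))(dq_1^2+dq_2^2)$ on $\mathbb R^2/\mathbb Z^2$ is nondegenerate if $(U_1,U_2)\in\Omega$ and: 1. $\kappa$ has finitely many zeros on $[c_4,c_3)\cup(c_2,c_1]$, each of first order; 2. if $\kappa(\tilde c)=0$, then $F_2'(\tilde c)/F_1'(\tilde c)$ is typical; 3. $F_2'(c_i)/F_1'(c_i)$ is typical for $i=1,4$; 4. $F_2(c_i)/F_1(c_i)$ is typical for $i=2,3$. *)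

theory Defs
  imports "HOL-Analysis.Analysis"
begin

section \<open>Smooth functions on the circle and the Whitney topology\<close>

text \<open>Functions on \<open>\<real>/\<int>\<close> are represented by 1-periodic functions on the real line.\<close>

definition smooth_periodic :: "(real \<Rightarrow> real) set" where
  "smooth_periodic =
     {U. (\<forall>k. (deriv ^^ k) U differentiable_on UNIV) \<and> (\<forall>q. U (q + 1) = U q)}"

definition C_ball :: "nat \<Rightarrow> (real \<Rightarrow> real) \<Rightarrow> real \<Rightarrow> (real \<Rightarrow> real) set" where
  "C_ball k U e = {V \<in> smooth_periodic. \<forall>q. \<bar>(deriv ^^ k) V q - (deriv ^^ k) U q\<bar> < e}"

text \<open>On the compact circle the Whitney topology is the topology of uniform convergence of all
  derivatives, i.e. the one generated by the balls of the seminorms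
  \<open>U \<mapsto> sup \<bar>U\<^sup>(\<^sup>k\<^sup>)\<bar>\<close>. By compactness, the pointwise strict inequality in
  \<open>C_ball\<close> amounts to the strict inequality for the supremum.\<close>

definition whitney_topology :: "(real \<Rightarrow> real) topology" where
  "whitney_topology =
     topology_generated_by {C_ball k U e | k U e. U \<in> smooth_periodic \<and> 0 < e}"

lemma topspace_whitney_topology: "topspace whitney_topology = smooth_periodic"
proof -
  have "U \<in> C_ball 0 U 1" if "U \<in> smooth_periodic" for U
    using that by (simp add: C_ball_def)
  then have "smooth_periodic \<subseteq> \<Union>{C_ball k U e | k U e. U \<in> smooth_periodic \<and> 0 < e}"
    using zero_less_one by blast
  moreover have "\<Union>{C_ball k U e | k U e. U \<in> smooth_periodic \<and> 0 < e} \<subseteq> smooth_periodic"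
    by (auto simp: C_ball_def)
  ultimately show ?thesis
    unfolding whitney_topology_def topology_generated_by_topspace by (rule equalityI[rotated])
qed


section \<open>The set \<open>\<Omega>\<close>\<close>

definition is_local_min :: "(real \<Rightarrow> real) \<Rightarrow> real \<Rightarrow> bool" where
  "is_local_min U q \<longleftrightarrow> (\<forall>\<^sub>F x in nhds q. U q \<le> U x)"

definition is_local_max :: "(real \<Rightarrow> real) \<Rightarrow> real \<Rightarrow> bool" where
  "is_local_max U q \<longleftrightarrow> (\<forall>\<^sub>F x in nhds q. U x \<le> U q)"

text \<open>The last conjunct includes the nondegeneracy of the two extrema, which are critical
  points.\<close>

definition admissible :: "(real \<Rightarrow> real) \<Rightarrow> bool" where
  "admissible U \<longleftrightarrow>
     U \<in> smooth_periodic \<and>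
     (\<exists>!m. m \<in> {0..<1} \<and> is_local_min U m) \<and>
     (\<exists>!M. M \<in> {0..<1} \<and> is_local_max U M) \<and>
     (\<forall>q. deriv U q = 0 \<longrightarrow> deriv (deriv U) q \<noteq> 0)"

definition Omega :: "((real \<Rightarrow> real) \<times> (real \<Rightarrow> real)) set" where
  "Omega = {(U1, U2). admissible U1 \<and> admissible U2 \<and> (\<forall>q1 q2. U1 q1 > U2 q2)}"

lemma Omega_subset_topspace: "Omega \<subseteq> topspace (prod_topology whitney_topology whitney_topology)"
  by (auto simp: Omega_def admissible_def topspace_whitney_topology)


section \<open>The curve \<open>\<gamma>\<close> and its curvature\<close>

text \<open>These are a genuine maximum and minimum, by \<open>extremal_values_attained\<close>.\<close>

definition max_val :: "(real \<Rightarrow> real) \<Rightarrow> real" where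
  "max_val U = (SUP q. U q)"

definition min_val :: "(real \<Rightarrow> real) \<Rightarrow> real" where
  "min_val U = (INF q. U q)"

lemma extremal_values_attained:
  assumes "U \<in> smooth_periodic"
  shows "\<exists>M. U M = max_val U \<and> (\<forall>q. U q \<le> U M)" and "\<exists>m. U m = min_val U \<and> (\<forall>q. U m \<le> U q)"
proof -
  have per: "U (q + 1) = U q" for q
    using assms by (simp add: smooth_periodic_def)
  have per_nat: "U (q + real n) = U q" for q n
    by (induction n) (use per in \<open>auto simp: add.assoc[symmetric] add.commute[of 1]\<close>)
  have per_int: "U (q + of_int z) = U q" for q z
  proof (cases z)
    case (nonneg n)
    then show ?thesis using per_nat[of q n] by simp
  next
    case (neg n)
    then show ?thesis using per_nat[of "q + of_int z" "Suc n"] by simp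
  qed
  have red: "\<exists>p \<in> {0..1}. U p = U q" for q
  proof
    show "U (frac q) = U q"
      using per_int[of "frac q" "\<lfloor>q\<rfloor>"] by (simp add: frac_def)
    show "frac q \<in> {0..1}"
      using frac_lt_1[of q] by simp
  qed
  have "(deriv ^^ 0) U differentiable_on UNIV"
    using assms unfolding smooth_periodic_def by blast
  then have cont: "continuous_on {0..1} U"
    using differentiable_imp_continuous_on continuous_on_subset by (metis funpow_0 subset_UNIV)
  obtain M where M: "\<And>p. p \<in> {0..1} \<Longrightarrow> U p \<le> U M"
    using continuous_attains_sup[OF _ _ cont] by (metis atLeastatMost_empty_iff compact_Icc not_one_le_zero linear)
  then have "U q \<le> U M" for q
    using red by metis
  then show "\<exists>M. U M = max_val U \<and> (\<forall>q. U q \<le> U M)"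
    unfolding max_val_def by (intro exI[of _ M] conjI allI sym[OF cSup_eq_maximum]) auto
  obtain m where m: "\<And>p. p \<in> {0..1} \<Longrightarrow> U m \<le> U p"
    using continuous_attains_inf[OF _ _ cont] by (metis atLeastatMost_empty_iff compact_Icc not_one_le_zero linear)
  then have "U m \<le> U q" for q
    using red by metis
  then show "\<exists>m. U m = min_val U \<and> (\<forall>q. U m \<le> U q)"
    unfolding min_val_def by (intro exI[of _ m] conjI allI sym[OF cInf_eq_minimum]) auto
qed

definition F1 :: "(real \<Rightarrow> real) \<Rightarrow> real \<Rightarrow> real" where
  "F1 U c = integral {q \<in> {0..1}. U q \<ge> c} (\<lambda>q. sqrt (U q - c))"

definition F2 :: "(real \<Rightarrow> real) \<Rightarrow> real \<Rightarrow> real" where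
  "F2 U c = integral {q \<in> {0..1}. U q \<le> c} (\<lambda>q. sqrt (c - U q))"

text \<open>With \<open>c\<^sub>1 = max U1\<close>, \<open>c\<^sub>2 = min U1\<close>, \<open>c\<^sub>3 = max U2\<close>, \<open>c\<^sub>4 = min U2\<close>, the
  curve is parametrised by \<open>[c\<^sub>4, c\<^sub>1]\<close>.\<close>

definition param_interval :: "(real \<Rightarrow> real) \<Rightarrow> (real \<Rightarrow> real) \<Rightarrow> real set" where
  "param_interval U1 U2 = {min_val U2..max_val U1}"

text \<open>Derivatives are taken within \<open>[c\<^sub>4, c\<^sub>1]\<close>, hence one-sided at the end points.
  The formulas defining \<open>F1\<close> and \<open>F2\<close> make sense beyond \<open>[c\<^sub>4, c\<^sub>1]\<close>, but
  \<open>F1\<close> is 0 above \<open>c\<^sub>1\<close> and \<open>F2\<close> is 0 below \<open>c\<^sub>4\<close>, so \<open>F1\<close> is not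
  differentiable at \<open>c\<^sub>1\<close>, nor \<open>F2\<close> at \<open>c\<^sub>4\<close>.\<close>

definition deriv_within :: "real set \<Rightarrow> (real \<Rightarrow> real) \<Rightarrow> real \<Rightarrow> real" where
  "deriv_within I F c = vector_derivative F (at c within I)"

definition slope :: "(real \<Rightarrow> real) \<Rightarrow> (real \<Rightarrow> real) \<Rightarrow> real \<Rightarrow> real" where
  "slope U1 U2 c = (let I = param_interval U1 U2 in
     deriv_within I (F2 U2) c / deriv_within I (F1 U1) c)"

text \<open>Meaningful for \<open>c\<close> in \<open>[c\<^sub>4, c\<^sub>1]\<close> different from \<open>c\<^sub>2\<close> and \<open>c\<^sub>3\<close>.\<close>

definition curvature :: "(real \<Rightarrow> real) \<Rightarrow> (real \<Rightarrow> real) \<Rightarrow> real \<Rightarrow> real" where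
  "curvature U1 U2 c =
     (let D = deriv_within (param_interval U1 U2);
          F1' = D (F1 U1); F2' = D (F2 U2); F1'' = D F1'; F2'' = D F2'
      in (F2'' c * F1' c - F1'' c * F2' c) / ((F1' c)\<^sup>2 + (F2' c)\<^sup>2) powr (3/2))"


section \<open>Nondegenerate metrics\<close>

text \<open>The exponent \<open>\<tau>\<close> applies to the value of the logarithm.\<close>

definition typical :: "real \<Rightarrow> bool" where
  "typical \<alpha> \<longleftrightarrow> (\<exists>\<tau>>0. \<exists>\<delta>>0. \<forall>k1 k2 :: int. k2 \<noteq> 0 \<longrightarrow>
     \<bar>of_int k1 + \<alpha> * of_int k2\<bar> \<ge>
       \<delta> / (\<bar>of_int k2\<bar> * (ln (1 + \<bar>of_int k2\<bar>)) powr \<tau>))"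

definition first_order_zero :: "real set \<Rightarrow> (real \<Rightarrow> real) \<Rightarrow> real \<Rightarrow> bool" where
  "first_order_zero I f c \<longleftrightarrow>
     f c = 0 \<and> (\<exists>D. D \<noteq> 0 \<and> (f has_real_derivative D) (at c within I))"

text \<open>Nondegeneracy of the metric \<open>(U1(q\<^sub>1) - U2(q\<^sub>2)) (dq\<^sub>1\<^sup>2 + dq\<^sub>2\<^sup>2)\<close>.\<close>

definition nondegenerate_metric :: "(real \<Rightarrow> real) \<Rightarrow> (real \<Rightarrow> real) \<Rightarrow> bool" where
  "nondegenerate_metric U1 U2 \<longleftrightarrow>
     (let I = param_interval U1 U2; \<kappa> = curvature U1 U2;
          c1 = max_val U1; c2 = min_val U1; c3 = max_val U2; c4 = min_val U2;
          Z = {c \<in> {c4..<c3} \<union> {c2<..c1}. \<kappa> c = 0}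
      in (U1, U2) \<in> Omega \<and>
         finite Z \<and> (\<forall>c\<in>Z. first_order_zero I \<kappa> c) \<and>
         (\<forall>c \<in> I - {c2, c3}. \<kappa> c = 0 \<longrightarrow> typical (slope U1 U2 c)) \<and>
         (\<forall>c \<in> {c1, c4}. typical (slope U1 U2 c)) \<and>
         (\<forall>c \<in> {c2, c3}. typical (F2 U2 c / F1 U1 c)))"

end

theory Submission
  imports Defs
begin

text \<open>Both potentials are perturbed by diffeomorphisms of the circle close to the identity:
  \<open>U2\<close> is replaced by \<open>W v\<close>, its composition with the inverse of \<open>q \<mapsto> q + v \<beta>(q)\<close>,
  so that after a change of variables the action \<open>F2 (W v)\<close> is affine in the parameter \<open>v\<close>;
  \<open>U1\<close> is treated in the same way, with parameter \<open>u\<close>, through \<open>F1 U1 c = F2 (- U1) (- c)\<close>.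
  Here \<open>\<beta>\<close> is the Morse coordinate of the well, cut off near the maximum. Hence below
  the cut-off the first derivative of the action is moved by the constant \<open>v \<pi> / 2\<close> and the
  second one is not moved at all.

  For each of the conditions the pairs \<open>(u, v)\<close> violating it form a null set in the plane. The
  conditions at the four critical values are affine in \<open>v\<close>, and non-typical numbers are
  negligible. A zero \<open>c\<close> of the curvature with slope \<open>y\<close> determines \<open>(u, v)\<close> as a
  differentiable function of \<open>(y, c)\<close>, so the non-typical slopes give the image of a null set. A
  degenerate zero makes \<open>(u, v)\<close> a critical value of a map of the form
  \<open>(u, c) \<mapsto> (u, f(u, c))\<close>, so Sard's theorem applies. There are only finitely many zeros because
  the second derivative of the action dominates the first one near the separatrix; between
  \<open>c\<^sub>3\<close> and \<open>c\<^sub>2\<close> the curvature is positive for all potentials.\<close>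

section \<open>Smooth functions\<close>

text \<open>Reparametrising the circle keeps the range of a potential, so all perturbed curves are
  defined over the same interval, and a change of variables leaves the parameter only in the
  Jacobian. The perturbation is flat in the Morse coordinate so that on the branch below
  \<open>c\<^sub>3\<close> the equation of zero curvature can be solved for \<open>v\<close> in
  closed form, \<open>u\<close> entering only through \<open>F1\<close>. At these \<open>c\<close>
  the well of \<open>- U1\<close> lies entirely below the level \<open>- c\<close>, and there the
  variation of the action has derivatives of definite sign, which makes \<open>u\<close> recoverable
  from the slope. The obstacle is the separatrix: the Morse coordinate ends there, and the cut-off
  must begin earlier. Zeros in the remaining gap are excluded by comparing second with first
  derivatives: below \<open>c\<^sub>3\<close> the ratio for \<open>F1\<close> is at most
  \<open>K = 1 / (2 (min U1 - max U2))\<close> in absolute value, while for \<open>F2\<close> it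
  exceeds any given \<open>K\<close> close enough to the separatrix. Hence the cut-off is placed
  after \<open>K\<close> is known, and the range of \<open>v\<close> after that. The branch above
  \<open>c\<^sub>2\<close> is the same statement with the two potentials exchanged and
  \<open>c\<close> replaced by \<open>- c\<close>.\<close>

primrec Ck :: "nat \<Rightarrow> real set \<Rightarrow> (real \<Rightarrow> real) \<Rightarrow> bool" where
  "Ck 0 S f \<longleftrightarrow> continuous_on S f"
| "Ck (Suc n) S f \<longleftrightarrow> (\<exists>f'. (\<forall>x\<in>S. (f has_real_derivative f' x) (at x)) \<and> Ck n S f')"

text \<open>\<open>Ck\<close> asks for some derivative at each level instead of iterating
  \<open>deriv\<close>, so that sums, products and compositions need no closed formula for higher
  derivatives. Derivatives are two-sided at every point of \<open>S\<close>; for open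
  \<open>S\<close> the iterates of \<open>deriv\<close> are recovered.\<close>

definition smooth_on :: "real set \<Rightarrow> (real \<Rightarrow> real) \<Rightarrow> bool" where
  "smooth_on S f \<longleftrightarrow> (\<forall>n. Ck n S f)"

lemma Ck_SucI:
  "(\<And>x. x \<in> S \<Longrightarrow> (f has_real_derivative f' x) (at x)) \<Longrightarrow> Ck n S f' \<Longrightarrow> Ck (Suc n) S f"
  by auto

lemma Ck_continuous: "Ck n S f \<Longrightarrow> continuous_on S f"
  by (cases n) (auto intro!: continuous_at_imp_continuous_on intro: DERIV_isCont)

lemma Ck_Suc_imp: "Ck (Suc n) S f \<Longrightarrow> Ck n S f"
proof (induction n arbitrary: f)
  case 0
  then show ?case using Ck_continuous by fastforce
next
  case (Suc n)
  then obtain f' where "\<forall>x\<in>S. (f has_real_derivative f' x) (at x)" "Ck (Suc n) S f'"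
    by auto
  then show ?case using Suc.IH[of f'] by auto
qed

lemma Ck_cong:
  assumes "open S" "\<And>x. x \<in> S \<Longrightarrow> f x = g x" "Ck n S f"
  shows "Ck n S g"
proof (cases n)
  case 0
  then show ?thesis using assms continuous_on_cong by fastforce
next
  case (Suc m)
  then obtain f' where f': "\<forall>x\<in>S. (f has_real_derivative f' x) (at x)" "Ck m S f'"
    using assms by auto
  have "(g has_real_derivative f' x) (at x)" if "x \<in> S" for x
    using has_field_derivative_transform_within_open[of f "f' x" x S g] f' that assms by auto
  then show ?thesis using f' Suc by (auto simp del: Ck.simps(1))
qed

lemma Ck_subset: "Ck n T f \<Longrightarrow> S \<subseteq> T \<Longrightarrow> Ck n S f"
  by (induction n arbitrary: f) (auto intro: continuous_on_subset)

lemma Ck_const: "Ck n S (\<lambda>x. c)"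
  by (induction n arbitrary: c) (auto intro!: exI[of _ "\<lambda>x. 0"] simp del: Ck.simps(1) simp: Ck.simps(1)[of S "\<lambda>x. c" for S c])

lemma Ck_id: "Ck n S (\<lambda>x. x)"
  by (cases n) (auto intro!: Ck_const exI[of _ "\<lambda>x. 1"])

lemma Ck_add: "Ck n S f \<Longrightarrow> Ck n S g \<Longrightarrow> Ck n S (\<lambda>x. f x + g x)"
proof (induction n arbitrary: f g)
  case 0
  then show ?case by (auto intro: continuous_intros)
next
  case (Suc n)
  then obtain f' g' where d: "\<forall>x\<in>S. (f has_real_derivative f' x) (at x)" "Ck n S f'"
    "\<forall>x\<in>S. (g has_real_derivative g' x) (at x)" "Ck n S g'" by auto
  show ?case
    by (rule Ck_SucI[where f'="\<lambda>x. f' x + g' x"]) (use d Suc.IH in \<open>auto intro!: derivative_intros\<close>)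
qed

lemma Ck_mult: "Ck n S f \<Longrightarrow> Ck n S g \<Longrightarrow> Ck n S (\<lambda>x. f x * g x)"
proof (induction n arbitrary: f g)
  case 0
  then show ?case by (auto intro: continuous_intros)
next
  case (Suc n)
  then obtain f' g' where d: "\<forall>x\<in>S. (f has_real_derivative f' x) (at x)" "Ck n S f'"
    "\<forall>x\<in>S. (g has_real_derivative g' x) (at x)" "Ck n S g'" by auto
  have "Ck n S f" "Ck n S g" using Suc.prems Ck_Suc_imp by blast+
  then have "Ck n S (\<lambda>x. f' x * g x + f x * g' x)"
    using Suc.IH d by (auto intro!: Ck_add)
  then show ?case
    by (rule Ck_SucI[rotated]) (use d in \<open>auto intro!: derivative_eq_intros\<close>)
qed

lemma Ck_compose:
  "Ck n T g \<Longrightarrow> Ck n S f \<Longrightarrow> f ` S \<subseteq> T \<Longrightarrow> Ck n S (\<lambda>x. g (f x))"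
proof (induction n arbitrary: g)
  case 0
  then show ?case by (auto intro: continuous_on_compose2)
next
  case (Suc n)
  then obtain f' g' where d: "\<forall>x\<in>S. (f has_real_derivative f' x) (at x)" "Ck n S f'"
    "\<forall>x\<in>T. (g has_real_derivative g' x) (at x)" "Ck n T g'" by auto
  have "Ck n S f" using Suc.prems Ck_Suc_imp by blast
  then have "Ck n S (\<lambda>x. g' (f x) * f' x)"
    using Suc.IH[of g'] d Suc.prems by (auto intro!: Ck_mult)
  then show ?case
  proof (rule Ck_SucI[rotated])
    fix x assume "x \<in> S"
    then have "(f has_real_derivative f' x) (at x)" "(g has_real_derivative g' (f x)) (at (f x))"
      using d Suc.prems by auto
    then show "((\<lambda>x. g (f x)) has_real_derivative g' (f x) * f' x) (at x)"
      by (rule DERIV_chain2[rotated])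
  qed
qed

lemma smooth_onD: "smooth_on S f \<Longrightarrow> Ck n S f"
  by (simp add: smooth_on_def)

lemma smooth_on_const [simp]: "smooth_on S (\<lambda>x. c)"
  and smooth_on_id [simp]: "smooth_on S (\<lambda>x. x)"
  by (simp_all add: smooth_on_def Ck_const Ck_id)

lemma smooth_on_add: "smooth_on S f \<Longrightarrow> smooth_on S g \<Longrightarrow> smooth_on S (\<lambda>x. f x + g x)"
  and smooth_on_mult: "smooth_on S f \<Longrightarrow> smooth_on S g \<Longrightarrow> smooth_on S (\<lambda>x. f x * g x)"
  by (simp_all add: smooth_on_def Ck_add Ck_mult)

lemma smooth_on_minus: "smooth_on S f \<Longrightarrow> smooth_on S (\<lambda>x. - f x)"
  using smooth_on_mult[of S "\<lambda>x. -1" f] by simp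

lemma smooth_on_diff: "smooth_on S f \<Longrightarrow> smooth_on S g \<Longrightarrow> smooth_on S (\<lambda>x. f x - g x)"
  using smooth_on_add[of S f "\<lambda>x. - g x"] smooth_on_minus by simp

lemma smooth_on_compose:
  "smooth_on T g \<Longrightarrow> smooth_on S f \<Longrightarrow> (\<And>x. x \<in> S \<Longrightarrow> f x \<in> T) \<Longrightarrow> smooth_on S (\<lambda>x. g (f x))"
  unfolding smooth_on_def by (blast intro: Ck_compose)

lemma smooth_on_subset: "smooth_on T f \<Longrightarrow> S \<subseteq> T \<Longrightarrow> smooth_on S f"
  unfolding smooth_on_def by (blast intro: Ck_subset)

lemma smooth_on_cong:
  "open S \<Longrightarrow> (\<And>x. x \<in> S \<Longrightarrow> f x = g x) \<Longrightarrow> smooth_on S f \<Longrightarrow> smooth_on S g"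
  unfolding smooth_on_def using Ck_cong by blast

lemma smooth_on_continuous: "smooth_on S f \<Longrightarrow> continuous_on S f"
  using Ck_continuous smooth_onD by blast

lemma smooth_on_DERIV:
  assumes "smooth_on S f" "x \<in> S"
  shows "(f has_real_derivative deriv f x) (at x)"
  using smooth_onD[OF assms(1), of 1] assms(2) DERIV_imp_deriv by (force simp: One_nat_def)

lemma smooth_on_deriv:
  assumes "smooth_on S f" "open S"
  shows "smooth_on S (deriv f)"
  unfolding smooth_on_def
proof
  fix n
  obtain f' where d: "\<forall>x\<in>S. (f has_real_derivative f' x) (at x)" "Ck n S f'"
    using smooth_onD[OF assms(1), of "Suc n"] by auto
  then show "Ck n S (deriv f)"
    by (intro Ck_cong[OF assms(2) _ d(2)]) (metis DERIV_imp_deriv)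
qed

lemma smooth_on_funpow_deriv: "open S \<Longrightarrow> smooth_on S f \<Longrightarrow> smooth_on S ((deriv ^^ k) f)"
  by (induction k) (auto intro: smooth_on_deriv)

lemma smooth_on_if_funpow_differentiable:
  assumes "\<And>k. (deriv ^^ k) f differentiable_on UNIV"
  shows "smooth_on UNIV f"
proof -
  have d: "((deriv ^^ k) f has_real_derivative (deriv ^^ Suc k) f x) (at x)" for k x
  proof -
    have "(deriv ^^ k) f differentiable (at x)"
      using assms by (auto simp: differentiable_on_def)
    then show ?thesis
      by (simp add: DERIV_deriv_iff_real_differentiable)
  qed
  have "Ck n UNIV ((deriv ^^ k) f)" for n k
  proof (induction n arbitrary: k)
    case 0
    show ?case using assms by (simp add: differentiable_imp_continuous_on)
  next
    case (Suc n)
    show ?case by (rule Ck_SucI[OF d Suc])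
  qed
  from this[of _ 0] show ?thesis by (simp add: smooth_on_def)
qed

lemma smooth_on_inverse_fun: "smooth_on (- {0}) (inverse :: real \<Rightarrow> real)"
  unfolding smooth_on_def
proof
  fix n show "Ck n (- {0}) (inverse :: real \<Rightarrow> real)"
  proof (induction n)
    case 0
    show ?case by (auto intro: continuous_intros)
  next
    case (Suc n)
    have "Ck n (- {0}) (\<lambda>x. -1 * (inverse x * inverse x))"
      by (intro Ck_mult Ck_const Suc[unfolded eta_contract_eq])
    then show ?case
      by (rule Ck_SucI[rotated]) (auto intro!: derivative_eq_intros simp: power2_eq_square)
  qed
qed

lemma smooth_on_inverse:
  "smooth_on S f \<Longrightarrow> (\<And>x. x \<in> S \<Longrightarrow> f x \<noteq> 0) \<Longrightarrow> smooth_on S (\<lambda>x. inverse (f x))"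
  by (rule smooth_on_compose[OF smooth_on_inverse_fun]) auto

lemma smooth_on_divide:
  "smooth_on S f \<Longrightarrow> smooth_on S g \<Longrightarrow> (\<And>x. x \<in> S \<Longrightarrow> g x \<noteq> 0) \<Longrightarrow> smooth_on S (\<lambda>x. f x / g x)"
  unfolding divide_inverse by (intro smooth_on_mult smooth_on_inverse)

text \<open>Bootstrapping: the derivative \<open>inverse (f' (g y))\<close> has as many derivatives
  as \<open>g\<close>, so each order of differentiability yields the next one.\<close>

lemma smooth_on_inverse_function:
  assumes "\<And>y. y \<in> T \<Longrightarrow> (g has_real_derivative inverse (f' (g y))) (at y)"
    and "\<And>y. y \<in> T \<Longrightarrow> g y \<in> S" "smooth_on S f'" "\<And>x. x \<in> S \<Longrightarrow> f' x \<noteq> 0"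
  shows "smooth_on T g"
  unfolding smooth_on_def
proof
  fix n show "Ck n T g"
  proof (induction n)
    case 0
    show ?case using assms(1) by (auto intro!: continuous_at_imp_continuous_on intro: DERIV_isCont)
  next
    case (Suc n)
    have "Ck n T (\<lambda>y. f' (g y))"
      by (rule Ck_compose[OF smooth_onD[OF assms(3)] Suc]) (use assms in auto)
    then have "Ck n T (\<lambda>y. inverse (f' (g y)))"
      by (rule Ck_compose[OF smooth_onD[OF smooth_on_inverse_fun]]) (use assms in auto)
    with assms(1) show ?case by (rule Ck_SucI)
  qed
qed

lemma smooth_on_sqrt: "smooth_on S f \<Longrightarrow> (\<And>x. x \<in> S \<Longrightarrow> f x > 0) \<Longrightarrow> smooth_on S (\<lambda>x. sqrt (f x))"
proof (rule smooth_on_compose[of "{0<..}" sqrt])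
  show "smooth_on {0<..} sqrt"
    by (rule smooth_on_inverse_function[where f'="\<lambda>x. 2 * x" and S="{0<..}"])
      (auto intro!: derivative_eq_intros smooth_on_mult)
qed auto

text \<open>Quotients in Hadamard's formula have this form. Differentiating under the integral
  replaces \<open>f\<close> by its derivative and the weight \<open>a s\<close> by
  \<open>s * a s\<close>, which is why the induction runs over all \<open>f\<close> and
  \<open>a\<close>. Convexity keeps the segment from \<open>m\<close> to \<open>x\<close> inside
  \<open>S\<close>.\<close>

lemma smooth_on_integral:
  fixes f a :: "real \<Rightarrow> real"
  assumes f: "smooth_on S f" and S: "open S" "convex S" "m \<in> S"
    and a: "continuous_on {0..1} a"
  shows "smooth_on S (\<lambda>x. integral {0..1} (\<lambda>s. a s * f (m + s * (x - m))))"
  unfolding smooth_on_def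
proof
  have mem: "m + s * (x - m) \<in> S" if "x \<in> S" "s \<in> {0..1}" for x s
    using convexD_alt[OF S(2,3) that(1), of s] that(2) by (simp add: algebra_simps)
  have D: "((\<lambda>x. integral {0..1} (\<lambda>s. a s * f (m + s * (x - m)))) has_real_derivative
      integral {0..1} (\<lambda>s. s * a s * deriv f (m + s * (x - m)))) (at x)"
    if f: "smooth_on S f" and a: "continuous_on {0..1} a" and x: "x \<in> S" for f a x
  proof -
    have cont: "continuous_on S (deriv f)" "continuous_on S f"
      using f S smooth_on_deriv smooth_on_continuous by blast+
    have "((\<lambda>x. integral (cbox 0 1) (\<lambda>s. a s * f (m + s * (x - m)))) has_real_derivative
      integral (cbox 0 1) (\<lambda>s. s * a s * deriv f (m + s * (x - m)))) (at x within S)"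
    proof (rule leibniz_rule_field_derivative[OF _ _ _ x S(2)])
      fix y t assume yt: "y \<in> S" "t \<in> cbox 0 (1::real)"
      then have "(f has_real_derivative deriv f (m + t * (y - m))) (at (m + t * (y - m)))"
        using mem smooth_on_DERIV[OF f] by auto
      moreover have "((\<lambda>y. m + t * (y - m)) has_real_derivative t) (at y)"
        by (auto intro!: derivative_eq_intros)
      ultimately have "((\<lambda>y. f (m + t * (y - m))) has_real_derivative deriv f (m + t * (y - m)) * t) (at y)"
        by (rule DERIV_chain2)
      then have "((\<lambda>y. a t * f (m + t * (y - m))) has_real_derivative a t * (deriv f (m + t * (y - m)) * t)) (at y)"
        by (rule DERIV_cmult)
      then show "((\<lambda>y. a t * f (m + t * (y - m))) has_real_derivative
          t * a t * deriv f (m + t * (y - m))) (at y within S)"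
        by (simp add: has_field_derivative_at_within mult_ac)
    next
      fix y assume "y \<in> S"
      then have "continuous_on (cbox 0 1) (\<lambda>s. f (m + s * (y - m)))"
        using mem by (intro continuous_on_compose2[OF cont(2)]) (auto intro!: continuous_intros)
      then show "(\<lambda>s. a s * f (m + s * (y - m))) integrable_on cbox 0 1"
        using a by (intro integrable_continuous continuous_intros) (simp_all add: cbox_interval)
    next
      have "continuous_on (S \<times> cbox 0 1) (\<lambda>p. deriv f (m + snd p * (fst p - m)))"
        using mem by (intro continuous_on_compose2[OF cont(1)]) (auto intro!: continuous_intros)
      moreover have "continuous_on (S \<times> cbox 0 1) (\<lambda>p. a (snd p))"
        by (intro continuous_on_compose2[OF a]) (auto intro!: continuous_intros)
      ultimately have "continuous_on (S \<times> cbox 0 1) (\<lambda>p. snd p * a (snd p) * deriv f (m + snd p * (fst p - m)))"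
        by (intro continuous_intros)
      then show "continuous_on (S \<times> cbox 0 1) (\<lambda>(x, s). s * a s * deriv f (m + s * (x - m)))"
        by (simp add: case_prod_unfold)
    qed
    then show ?thesis using at_within_open[OF x S(1)] by (simp add: cbox_interval)
  qed
  fix n
  show "Ck n S (\<lambda>x. integral {0..1} (\<lambda>s. a s * f (m + s * (x - m))))"
    using f a
  proof (induction n arbitrary: f a)
    case 0
    show ?case
      unfolding Ck.simps by (intro continuous_at_imp_continuous_on ballI DERIV_isCont[OF D[OF 0]])
  next
    case (Suc n)
    show ?case
      by (rule Ck_SucI[OF D[OF Suc.prems]], assumption, rule Suc.IH)
        (use Suc.prems S in \<open>auto intro!: smooth_on_deriv continuous_intros\<close>)
  qed
qed

text \<open>By the mean value theorem the difference quotient at 0 is a value of \<open>f'\<close>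
  at an intermediate point. It supplies the derivative at 0 of functions of \<open>sqrt w\<close>,
  where the chain rule does not apply.\<close>

lemma has_derivative_right_if_derivative_tendsto:
  fixes f f' :: "real \<Rightarrow> real"
  assumes "0 < d" and cont: "continuous_on {0..<d} f"
    and D: "\<And>x. 0 < x \<Longrightarrow> x < d \<Longrightarrow> (f has_real_derivative f' x) (at x)"
    and L: "(f' \<longlongrightarrow> L) (at_right 0)"
  shows "(f has_real_derivative L) (at 0 within {0..})"
  unfolding has_field_derivative_iff
proof (rule tendstoI)
  fix e :: real assume "e > 0"
  then obtain b where b: "b > 0" "\<And>x. 0 < x \<Longrightarrow> x < b \<Longrightarrow> dist (f' x) L < e"
    using tendstoD[OF L] unfolding eventually_at_right_field by auto
  have "dist ((f x - f 0) / (x - 0)) L < e" if x: "x \<in> {0..}" "x \<noteq> 0" "dist x 0 < min b d" for x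
  proof -
    have x: "0 < x" "x < b" "x < d" using x by auto
    have "continuous_on {0..x} f" using cont x by (auto intro: continuous_on_subset)
    then obtain y where y: "0 < y" "y < x" "f x - f 0 = f' y * (x - 0)"
    proof (rule mvt[OF x(1), of f "\<lambda>y h. f' y * h"])
      fix y assume "0 < y" "y < x"
      then show "(f has_derivative (\<lambda>h. f' y * h)) (at y)"
        using D[of y] x(3) by (simp add: has_field_derivative_def)
    qed blast
    then show ?thesis using b(2)[of y] x by simp
  qed
  then show "\<forall>\<^sub>F x in at 0 within {0..}. dist ((f x - f 0) / (x - 0)) L < e"
    unfolding eventually_at using \<open>0 < d\<close> \<open>0 < b\<close> by (intro exI[of _ "min b d"]) auto
qed

lemma deriv_0_if_even:
  assumes f: "smooth_on {-R<..<R} f" and even: "\<And>x. f (- x) = f x" and R: "R > 0"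
  shows "deriv f 0 = 0"
proof -
  have d: "(f has_real_derivative deriv f 0) (at 0)" using smooth_on_DERIV[OF f, of 0] R by simp
  then have "((\<lambda>x. f (- x)) has_real_derivative deriv f 0 * - 1) (at 0)"
    by (intro DERIV_chain2[where g=uminus and f=f]) (auto intro!: derivative_eq_intros)
  then have "(f has_real_derivative deriv f 0 * - 1) (at 0)" by (simp only: even)
  from DERIV_unique[OF d this] show ?thesis by simp
qed

text \<open>Whitney's theorem on even functions: an even smooth function of \<open>x\<close> is a smooth
  function of \<open>x\<^sup>2\<close>. The derivative in \<open>x\<^sup>2\<close> is again even and smooth,
  by Hadamard's formula.\<close>

lemma even_smooth_derivative_sqrt:
  assumes f: "smooth_on {-R<..<R} f" and even: "\<And>x. f (- x) = f x" and R: "R > 0"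
  obtains h where "smooth_on {-R<..<R} h" "\<And>x. h (- x) = h x"
    "\<And>w. 0 \<le> w \<Longrightarrow> w < R\<^sup>2 \<Longrightarrow> ((\<lambda>w. f (sqrt w)) has_real_derivative h (sqrt w)) (at w within {0..})"
    "\<And>x. x \<in> {-R<..<R} \<Longrightarrow> deriv f x = 2 * x * h x"
proof
  let ?S = "{-R<..<R}"
  have S: "open ?S" "convex ?S" "0 \<in> ?S" using R by auto
  note f1 = smooth_on_deriv[OF f S(1)] and f2 = smooth_on_deriv[OF smooth_on_deriv[OF f S(1)] S(1)]
  \<comment> \<open>Since \<open>deriv f 0 = 0\<close>, the derivative of \<open>f\<close> is
    \<open>x\<close> times the integral of \<open>deriv (deriv f) (s * x)\<close> over
    \<open>s\<close>. The factor 1/2 is there because the derivative in \<open>x\<^sup>2\<close> is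
    \<open>deriv f x / (2 * x)\<close>.\<close>
  define h0 where "h0 x = integral {0..1} (\<lambda>s. 1/2 * deriv (deriv f) (0 + s * (x - 0)))" for x
  have h0_eq: "h0 x = 1/2 * integral {0..1} (\<lambda>s. deriv (deriv f) (s * x))" for x
    unfolding h0_def diff_zero add_0_left by (rule integral_mult_right)
  \<comment> \<open>Outside the interval, where \<open>f\<close> need not be differentiable,
    \<open>h0\<close> need not be even. Averaging makes evenness hold at every \<open>x\<close>, as
    an iteration of this lemma demands.\<close>
  define h where "h x = (h0 x + h0 (- x)) / 2" for x
  have h0: "smooth_on ?S h0"
    unfolding h0_def by (rule smooth_on_integral[OF f2 S]) (auto intro: continuous_intros)
  have "smooth_on ?S (\<lambda>x. h0 (- x))"
    by (rule smooth_on_compose[OF h0]) (auto intro!: smooth_on_minus)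
  then have "smooth_on ?S (\<lambda>x. (h0 x + h0 (- x)) * (1/2))"
    by (intro smooth_on_mult smooth_on_add h0) auto
  then show h: "smooth_on ?S h" by (simp add: h_def[abs_def])
  show "h (- x) = h x" for x by (simp add: h_def)
  have h0eq: "deriv f x = 2 * x * h0 x" if x: "x \<in> ?S" for x
  proof -
    have mem: "s * x \<in> ?S" if "s \<in> {0..1}" for s
      using convexD_alt[OF S(2,3) x, of s] that by (simp add: algebra_simps)
    have "((\<lambda>s. x * deriv (deriv f) (s * x)) has_integral deriv f (1 * x) - deriv f (0 * x)) {0..1}"
    proof (rule fundamental_theorem_of_calculus)
      fix s :: real assume s: "s \<in> {0..1}"
      have "((\<lambda>s. deriv f (s * x)) has_real_derivative deriv (deriv f) (s * x) * x) (at s)"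
        by (rule DERIV_chain2[where g="\<lambda>s. s * x", OF smooth_on_DERIV[OF f1 mem[OF s]]]) (auto intro!: derivative_eq_intros)
      then show "((\<lambda>s. deriv f (s * x)) has_vector_derivative x * deriv (deriv f) (s * x)) (at s within {0..1})"
        by (simp add: mult.commute has_real_derivative_iff_has_vector_derivative[symmetric]
            has_field_derivative_at_within)
    qed simp
    then have "integral {0..1} (\<lambda>s. x * deriv (deriv f) (s * x)) = deriv f (1 * x) - deriv f (0 * x)"
      by (rule integral_unique)
    then have "x * integral {0..1} (\<lambda>s. deriv (deriv f) (s * x)) = deriv f x - deriv f 0"
      by (simp only: integral_mult_right mult_1 mult_zero_left)
    then show ?thesis using deriv_0_if_even[OF assms] by (simp only: h0_eq)
  qed
  have odd: "deriv f (- x) = - deriv f x" if "x \<in> ?S" for x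
  proof -
    have "- x \<in> ?S" using that by auto
    then have "((\<lambda>x. f (- x)) has_real_derivative deriv f (- x) * - 1) (at x)"
      by (intro DERIV_chain2[where g=uminus and f=f] smooth_on_DERIV[OF f]) (auto intro!: derivative_eq_intros)
    then have "(f has_real_derivative deriv f (- x) * - 1) (at x)" by (simp only: even)
    from DERIV_unique[OF smooth_on_DERIV[OF f that] this] show ?thesis by simp
  qed
  show heq: "deriv f x = 2 * x * h x" if x: "x \<in> ?S" for x
  proof -
    have "- x \<in> ?S" using x by auto
    from h0eq[OF this] odd[OF x] have "deriv f x = 2 * x * h0 (- x)" by linarith
    with h0eq[OF x] have "2 * deriv f x = 2 * x * (h0 x + h0 (- x))" by (simp only: distrib_left)
    then show ?thesis by (simp add: h_def)
  qed
  fix w assume w: "0 \<le> w" "w < R\<^sup>2"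
  have mem: "sqrt v \<in> ?S" if "v \<in> {0..<R\<^sup>2}" for v
  proof -
    have "sqrt v < R" using that R by (intro real_less_lsqrt) auto
    moreover have "0 \<le> sqrt v" using that by simp
    ultimately show ?thesis using R unfolding greaterThanLessThan_iff by linarith
  qed
  have pos: "((\<lambda>w. f (sqrt w)) has_real_derivative h (sqrt w)) (at w)" if w: "0 < w" "w < R\<^sup>2" for w
  proof -
    have sq: "sqrt w \<in> ?S" using mem w by simp
    have "((\<lambda>w. f (sqrt w)) has_real_derivative deriv f (sqrt w) * (inverse (sqrt w) / 2)) (at w)"
      by (rule DERIV_chain2[where g=sqrt, OF smooth_on_DERIV[OF f sq] DERIV_real_sqrt[OF w(1)]])
    moreover have "deriv f (sqrt w) * (inverse (sqrt w) / 2) = h (sqrt w)"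
      unfolding heq[OF sq] using w by (simp add: field_simps)
    ultimately show ?thesis by (simp only:)
  qed
  show "((\<lambda>w. f (sqrt w)) has_real_derivative h (sqrt w)) (at w within {0..})"
  proof (cases "w = 0")
    case False
    with w have "0 < w" by simp
    then show ?thesis by (rule has_field_derivative_at_within[OF pos[OF _ w(2)]])
  next
    case True
    have lim: "((\<lambda>w. h (sqrt w)) \<longlongrightarrow> h (sqrt 0)) (at_right 0)"
    proof (rule isCont_tendsto_compose[where g=h])
      show "isCont h (sqrt 0)"
        using smooth_on_continuous[OF h] S unfolding continuous_on_eq_continuous_at[OF S(1)] by simp
      show "(sqrt \<longlongrightarrow> sqrt 0) (at_right 0)" by (intro tendsto_intros)
    qed
    have cont: "continuous_on {0..<R\<^sup>2} (\<lambda>w. f (sqrt w))"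
      by (rule continuous_on_compose2[OF smooth_on_continuous[OF f] _ image_subsetI[OF mem]])
        (intro continuous_intros)
    show ?thesis
      unfolding True by (rule has_derivative_right_if_derivative_tendsto[OF _ cont pos lim]) (use R in simp)
  qed
qed

subsection \<open>A smooth cut-off function\<close>

text \<open>The building blocks of the derivatives of \<open>exp (- 1 / x)\<close>, continued by 0
  to the left. Their span is closed under differentiation, so smoothness reduces to a single
  derivative formula.\<close>

definition flat :: "nat \<Rightarrow> real \<Rightarrow> real" where
  "flat k x = (if x \<le> 0 then 0 else exp (- inverse x) * inverse x ^ k)"

lemma flat_tendsto_0: "(flat k \<longlongrightarrow> 0) (at 0)"
proof -
  have "((\<lambda>x. inverse x ^ k / exp (inverse x)) \<longlongrightarrow> 0) (at_right (0::real))"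
    by (rule filterlim_compose[OF tendsto_power_div_exp_0 filterlim_inverse_at_top_right])
  then have "(flat k \<longlongrightarrow> 0) (at_right 0)"
    by (rule Lim_transform_eventually)
      (auto simp: flat_def eventually_at_right_field exp_minus field_simps intro!: exI[of _ 1])
  moreover have "(flat k \<longlongrightarrow> 0) (at_left 0)"
    by (rule Lim_transform_eventually[OF tendsto_const])
      (auto simp: flat_def eventually_at_left_field intro!: exI[of _ "-1"])
  ultimately show ?thesis by (simp add: filterlim_split_at)
qed

lemma flat_DERIV: "(flat k has_real_derivative flat (k + 2) x - k * flat (k + 1) x) (at x)"
proof -
  consider "x < 0" | "x = 0" | "x > 0" by linarith
  then show ?thesis
  proof cases
    case 1
    have "((\<lambda>x. 0) has_real_derivative 0) (at x)" by simp
    then have "(flat k has_real_derivative 0) (at x)"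
      by (rule has_field_derivative_transform_within_open[of _ _ _ "{..<0}"]) (use 1 in \<open>auto simp: flat_def\<close>)
    then show ?thesis using 1 by (simp add: flat_def)
  next
    case 2
    \<comment> \<open>The difference quotient of \<open>flat k\<close> at 0 is
      \<open>flat (Suc k)\<close>, which tends to 0.\<close>
    have "((\<lambda>y. (flat k y - flat k 0) / (y - 0)) \<longlongrightarrow> 0) (at 0)"
      by (rule Lim_transform_eventually[OF flat_tendsto_0[of "Suc k"]])
        (auto simp: flat_def eventually_at_filter field_simps)
    then show ?thesis using 2 by (simp add: has_field_derivative_iff flat_def)
  next
    case 3
    have "x \<noteq> 0" using 3 by simp
    note inv = DERIV_inverse[OF this]
    have "((\<lambda>x. inverse x ^ k) has_real_derivative - real k * inverse x ^ (k + 1)) (at x)"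
    proof (cases k)
      case (Suc m)
      have eq: "real k * (- (inverse x ^ Suc (Suc 0)) * inverse x ^ (k - Suc 0)) = - real k * inverse x ^ (k + 1)"
        unfolding Suc by (simp add: algebra_simps)
      show ?thesis using DERIV_power[OF inv, of k] unfolding eq .
    qed simp
    moreover have "((\<lambda>x. exp (- inverse x)) has_real_derivative exp (- inverse x) * inverse x ^ 2) (at x)"
      using DERIV_chain2[OF DERIV_exp DERIV_minus[OF inv]] by (simp add: power2_eq_square)
    ultimately have "((\<lambda>x. exp (- inverse x) * inverse x ^ k) has_real_derivative
        exp (- inverse x) * inverse x ^ 2 * inverse x ^ k + - real k * inverse x ^ (k + 1) * exp (- inverse x)) (at x)"
      by (intro DERIV_mult)
    moreover have "exp (- inverse x) * inverse x ^ 2 * inverse x ^ k + - real k * inverse x ^ (k + 1) * exp (- inverse x)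
        = flat (k + 2) x - k * flat (k + 1) x"
      using 3 by (simp add: flat_def power_add power2_eq_square mult_ac)
    ultimately have "((\<lambda>x. exp (- inverse x) * inverse x ^ k) has_real_derivative flat (k + 2) x - k * flat (k + 1) x) (at x)"
      by (simp only:)
    then show ?thesis
      by (rule has_field_derivative_transform_within_open[of _ _ _ "{0<..}"]) (use 3 in \<open>auto simp: flat_def\<close>)
  qed
qed

lemma smooth_on_flat: "smooth_on UNIV (flat k)"
  unfolding smooth_on_def
proof
  fix n show "Ck n UNIV (flat k)"
  proof (induction n arbitrary: k)
    case 0
    show ?case by (auto intro!: continuous_at_imp_continuous_on DERIV_isCont[OF flat_DERIV])
  next
    case (Suc n)
    have "Ck n UNIV (\<lambda>x. flat (k + 2) x + - real k * flat (k + 1) x)"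
      by (rule Ck_add[OF Suc Ck_mult[OF Ck_const Suc]])
    then have "Ck n UNIV (\<lambda>x. flat (k + 2) x - real k * flat (k + 1) x)" by simp
    with flat_DERIV show ?case by (rule Ck_SucI)
  qed
qed

lemma smooth_cutoff:
  fixes a b :: real
  assumes "a < b"
  obtains \<phi> where "smooth_on UNIV \<phi>" "\<And>w. w \<le> a \<Longrightarrow> \<phi> w = 1" "\<And>w. b \<le> w \<Longrightarrow> \<phi> w = 0" "\<And>w. 0 \<le> \<phi> w"
proof
  let ?F = "\<lambda>w. flat 0 (b - w)" and ?G = "\<lambda>w. flat 0 (w - a)"
  let ?\<phi> = "\<lambda>w. ?F w / (?F w + ?G w)"
  have nn: "flat 0 x \<ge> 0" "flat 0 x = 0 \<longleftrightarrow> x \<le> 0" for x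
    by (auto simp: flat_def)
  have pos: "?F w + ?G w \<noteq> 0" for w
    using nn[of "b - w"] nn[of "w - a"] assms by (cases "w < b") auto
  have F: "smooth_on UNIV ?F" and G: "smooth_on UNIV ?G"
    by (auto intro!: smooth_on_compose[OF smooth_on_flat] smooth_on_diff)
  show "smooth_on UNIV ?\<phi>"
    by (intro smooth_on_divide smooth_on_add F G) (rule pos)
  fix w
  show "w \<le> a \<Longrightarrow> ?\<phi> w = 1"
    using nn(2)[of "w - a"] nn(2)[of "b - w"] assms by simp
  show "b \<le> w \<Longrightarrow> ?\<phi> w = 0"
    using nn(2)[of "b - w"] by simp
  show "0 \<le> ?\<phi> w" using nn(1) by (intro divide_nonneg_nonneg add_nonneg_nonneg)
qed

subsection \<open>Periodic functions\<close>

lemma periodic_int: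
  fixes f :: "real \<Rightarrow> 'a"
  assumes "\<And>q. f (q + 1) = f q"
  shows "f (q + of_int z) = f q"
proof (induction z rule: int_induct[of _ 0])
  case (step1 i)
  have "f (q + of_int (i + 1)) = f (q + of_int i + 1)" by (simp add: add.assoc)
  then show ?case using step1 assms by simp
next
  case (step2 i)
  have "f (q + of_int (i - 1)) = f (q + of_int (i - 1) + 1)" by (simp only: assms)
  also have "\<dots> = f (q + of_int i)" by simp
  finally show ?case using step2 by simp
qed simp

lemma periodic_frac:
  fixes f :: "real \<Rightarrow> 'a"
  assumes "\<And>q. f (q + 1) = f q"
  shows "f (frac q) = f q"
  using periodic_int[of f "frac q" "\<lfloor>q\<rfloor>"] assms by (simp add: frac_def)

lemma periodic_bounded:
  assumes "continuous_on UNIV f" "\<And>q. f (q + 1) = f (q::real)"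
  obtains B :: real where "B > 0" "\<And>q. \<bar>f q\<bar> \<le> B"
proof -
  have "compact (f ` {0..1})"
    using assms(1) by (intro compact_continuous_image) (auto intro: continuous_on_subset)
  then obtain B where B: "B > 0" "\<And>q. q \<in> {0..1} \<Longrightarrow> \<bar>f q\<bar> \<le> B"
    using compact_imp_bounded[of "f ` {0..1}"] unfolding bounded_pos by (metis imageI real_norm_def)
  have "\<bar>f q\<bar> \<le> B" for q
    using B(2)[of "frac q"] frac_lt_1[of q] periodic_frac[of f, OF assms(2)] by auto
  with B(1) show ?thesis by (rule that)
qed

lemma periodic_deriv:
  assumes "smooth_on UNIV f" "\<And>q. f (q + 1) = f q"
  shows "deriv f (q + 1) = deriv f q"
proof -
  have "(f has_real_derivative deriv f (q + 1)) (at (q + 1))"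
    using smooth_on_DERIV[OF assms(1)] by simp
  then have "((\<lambda>x. f (x + 1)) has_real_derivative deriv f (q + 1)) (at q)"
    by (simp only: DERIV_shift)
  then show ?thesis using DERIV_imp_deriv by (fastforce simp: assms(2))
qed

lemma periodic_funpow_deriv:
  assumes "smooth_on UNIV f" "\<And>q. f (q + 1) = f q"
  shows "(deriv ^^ k) f (q + 1) = (deriv ^^ k) f q"
  by (induction k arbitrary: q) (auto simp: assms intro!: periodic_deriv smooth_on_funpow_deriv)

lemma smooth_periodic_iff:
  "U \<in> smooth_periodic \<longleftrightarrow> smooth_on UNIV U \<and> (\<forall>q. U (q + 1) = U q)"
proof -
  have "(\<forall>k. (deriv ^^ k) U differentiable_on UNIV) \<longleftrightarrow> smooth_on UNIV U"
  proof
    assume "smooth_on UNIV U"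
    then have "((deriv ^^ k) U has_real_derivative (deriv ^^ Suc k) U x) (at x)" for k x
      using smooth_on_DERIV[OF smooth_on_funpow_deriv[OF open_UNIV], of U x k] by simp
    then show "\<forall>k. (deriv ^^ k) U differentiable_on UNIV"
      by (auto simp: differentiable_on_def real_differentiable_def)
  qed (rule smooth_on_if_funpow_differentiable, blast)
  then show ?thesis by (simp add: smooth_periodic_def)
qed

text \<open>With an antiderivative \<open>g\<close> the integral over \<open>{x..x + 1}\<close> is
  \<open>g (x + 1) - g x\<close>, whose derivative in \<open>x\<close> is
  \<open>f (x + 1) - f x = 0\<close>.\<close>

lemma periodic_integral:
  fixes f :: "real \<Rightarrow> real"
  assumes "continuous_on UNIV f" "\<And>q. f (q + 1) = f q"
  shows "integral {a..a + 1} f = integral {b..b + 1} f"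
proof -
  define L H where "L = min a b" "H = max a b"
  obtain g where g: "\<And>x. x \<in> {L..H + 1} \<Longrightarrow> (g has_vector_derivative f x) (at x within {L..H + 1})"
    using antiderivative_continuous[of L "H + 1" f] assms(1) by (meson continuous_on_subset subset_UNIV)
  have int: "integral {x..x + 1} f = g (x + 1) - g x" if "x \<in> {L..H}" for x
  proof (rule integral_unique, rule fundamental_theorem_of_calculus)
    fix y assume y: "y \<in> {x..x + 1}"
    show "(g has_vector_derivative f y) (at y within {x..x + 1})"
      by (rule has_vector_derivative_within_subset[OF g]) (use that y in auto)
  qed simp
  have d: "((\<lambda>x. g (x + 1) - g x) has_vector_derivative 0) (at x within {L..H})" if "x \<in> {L..H}" for x
  proof -
    have "(g has_vector_derivative f (x + 1)) (at (x + 1) within (\<lambda>x. x + 1) ` {L..H})"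
      by (rule has_vector_derivative_within_subset[OF g]) (use that in auto)
    then have "((g \<circ> (\<lambda>x. x + 1)) has_vector_derivative 1 *\<^sub>R f (x + 1)) (at x within {L..H})"
      by (intro vector_diff_chain_within) (auto intro!: derivative_eq_intros)
    moreover have "(g has_vector_derivative f x) (at x within {L..H})"
      by (rule has_vector_derivative_within_subset[OF g]) (use that in auto)
    ultimately have "((\<lambda>x. (g \<circ> (\<lambda>x. x + 1)) x - g x) has_vector_derivative 1 *\<^sub>R f (x + 1) - f x) (at x within {L..H})"
      by (rule has_vector_derivative_diff)
    then show ?thesis by (simp add: assms(2))
  qed
  have "g (a + 1) - g a = g (b + 1) - g b"
  proof -
    have "\<exists>c. \<forall>x\<in>{L..H}. g (x + 1) - g x = c"
      using has_vector_derivative_zero_constant[of "{L..H}" "\<lambda>x. g (x + 1) - g x"] d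
      by (metis convex_real_interval(5))
    then show ?thesis by (auto simp: L_H_def)
  qed
  then show ?thesis using int by (auto simp: L_H_def)
qed

text \<open>Subtracting the floor moves \<open>q\<close> into \<open>[a, a + 1)\<close>. The jumps
  do no harm since \<open>f\<close> vanishes near both ends of this interval; the derivative of
  \<open>f\<close> inherits the support, so the derivative of the extension is the extension of the
  derivative.\<close>

lemma smooth_on_periodic_extension:
  assumes f: "smooth_on UNIV f" and ab: "a < a'" "a' \<le> b'" "b' < a + 1"
    and supp: "\<And>x. x \<notin> {a'..b'} \<Longrightarrow> f x = 0"
  shows "smooth_on UNIV (\<lambda>q. f (q - of_int \<lfloor>q - a\<rfloor>))"
  unfolding smooth_on_def
proof
  have D: "((\<lambda>q. f (q - of_int \<lfloor>q - a\<rfloor>)) has_real_derivative deriv f (q - of_int \<lfloor>q - a\<rfloor>)) (at q)"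
    if f: "smooth_on UNIV f" and supp: "\<And>x. x \<notin> {a'..b'} \<Longrightarrow> f x = 0" for f q
  proof -
    define n where "n = \<lfloor>q - a\<rfloor>"
    have n: "of_int n \<le> q - a" "q - a < of_int n + 1" by (auto simp: n_def)
    have "(f has_real_derivative deriv f (q - of_int n)) (at (q - of_int n))"
      using smooth_on_DERIV[OF f] by simp
    then have "((\<lambda>y. f (y - of_int n)) has_real_derivative deriv f (q - of_int n)) (at q)"
      using DERIV_shift[of f _ q "- of_int n"] by simp
    then show ?thesis
      unfolding n_def[symmetric]
    \<comment> \<open>The neighbourhood reaches to the left of the jump at
      \<open>of_int n + a\<close> because \<open>b' < a + 1\<close>. Left of the jump both
      expressions evaluate \<open>f\<close> outside its support.\<close>
    proof (rule has_field_derivative_transform_within_open[of _ _ _ "{of_int n + b' - 1<..<of_int n + a + 1}"])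
      show "q \<in> {of_int n + b' - 1<..<of_int n + a + 1}" using n ab by auto
      fix y assume y: "y \<in> {of_int n + b' - 1<..<of_int n + a + 1}"
      show "f (y - of_int n) = f (y - of_int \<lfloor>y - a\<rfloor>)"
      proof (cases "of_int n + a \<le> y")
        case True
        then have "\<lfloor>y - a\<rfloor> = n" using y by (intro floor_unique) auto
        then show ?thesis by simp
      next
        case False
        then have "\<lfloor>y - a\<rfloor> = n - 1" using y ab by (intro floor_unique) auto
        then have "f (y - of_int \<lfloor>y - a\<rfloor>) = 0" using y ab by (intro supp) auto
        moreover have "f (y - of_int n) = 0" using False ab by (intro supp) auto
        ultimately show ?thesis by simp
      qed
    qed simp
  qed
  have dsupp: "deriv f x = 0" if supp: "\<And>x. x \<notin> {a'..b'} \<Longrightarrow> f x = 0" and x: "x \<notin> {a'..b'}" for f x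
  proof -
    have "((\<lambda>x. 0::real) has_real_derivative 0) (at x)" by simp
    then have "(f has_real_derivative 0) (at x)"
      by (rule has_field_derivative_transform_within_open[of _ _ _ "- {a'..b'}"]) (use x supp in auto)
    then show ?thesis by (rule DERIV_imp_deriv)
  qed
  fix n show "Ck n UNIV (\<lambda>q. f (q - of_int \<lfloor>q - a\<rfloor>))"
    using f supp
  proof (induction n arbitrary: f)
    case 0
    show ?case
      unfolding Ck.simps by (intro continuous_at_imp_continuous_on ballI DERIV_isCont[OF D[OF 0]])
  next
    case (Suc n)
    show ?case
      by (rule Ck_SucI[OF D[OF Suc.prems]], assumption, rule Suc.IH)
        (use Suc.prems dsupp in \<open>blast intro: smooth_on_deriv open_UNIV\<close>)+
  qed
qed

subsection \<open>Families of functions on the circle\<close>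

text \<open>Expressions in \<open>v\<close>, smooth functions of \<open>q\<close> and \<open>1 / (1 + v b(q))\<close>. With
  \<open>b = \<beta>'\<close> they contain, up to the substitution of the inverse diffeomorphism, all derivatives of
  the perturbed potentials.\<close>

inductive family :: "(real \<Rightarrow> real) \<Rightarrow> (real \<Rightarrow> real \<Rightarrow> real) \<Rightarrow> bool" for b where
  family_base: "smooth_on UNIV f \<Longrightarrow> family b (\<lambda>v. f)"
| family_par: "family b (\<lambda>v q. v)"
| family_inv: "family b (\<lambda>v q. inverse (1 + v * b q))"
| family_add: "family b f \<Longrightarrow> family b g \<Longrightarrow> family b (\<lambda>v q. f v q + g v q)"
| family_mult: "family b f \<Longrightarrow> family b g \<Longrightarrow> family b (\<lambda>v q. f v q * g v q)"

lemma family_DERIV: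
  assumes "family b f" "smooth_on UNIV b"
  shows "\<exists>f'. family b f' \<and> (\<forall>v q. 1 + v * b q \<noteq> 0 \<longrightarrow> (f v has_real_derivative f' v q) (at q))"
  using assms(1)
proof induction
  case (family_base f)
  then show ?case
    by (intro exI[of _ "\<lambda>v. deriv f"]) (auto intro!: family.intros smooth_on_deriv smooth_on_DERIV)
next
  case family_par
  show ?case by (intro exI[of _ "\<lambda>v q. 0"]) (auto intro!: family.family_base)
next
  case family_inv
  let ?w = "\<lambda>v q. inverse (1 + v * b q)"
  have "family b (\<lambda>v q. -1 * v * (\<lambda>v. deriv b) v q * (?w v q * ?w v q))"
    by (intro family.family_mult family.family_par family.family_inv family.family_base smooth_on_deriv assms) auto
  moreover have "(?w v has_real_derivative -1 * v * deriv b q * (?w v q * ?w v q)) (at q)"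
    if "1 + v * b q \<noteq> 0" for v q
    using that smooth_on_DERIV[OF assms(2), of q]
    by (auto intro!: derivative_eq_intros simp: power2_eq_square)
  ultimately show ?case by blast
next
  case (family_add f g)
  then obtain f' g' where "family b f'" "family b g'"
    "\<And>v q. 1 + v * b q \<noteq> 0 \<Longrightarrow> (f v has_real_derivative f' v q) (at q)"
    "\<And>v q. 1 + v * b q \<noteq> 0 \<Longrightarrow> (g v has_real_derivative g' v q) (at q)" by blast
  then show ?case
    by (intro exI[of _ "\<lambda>v q. f' v q + g' v q"]) (auto intro!: family.family_add DERIV_add)
next
  case (family_mult f g)
  then obtain f' g' where "family b f'" "family b g'"
    "\<And>v q. 1 + v * b q \<noteq> 0 \<Longrightarrow> (f v has_real_derivative f' v q) (at q)"
    "\<And>v q. 1 + v * b q \<noteq> 0 \<Longrightarrow> (g v has_real_derivative g' v q) (at q)" by blast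
  with family_mult show ?case
    by (intro exI[of _ "\<lambda>v q. f' v q * g v q + g' v q * f v q"])
      (auto intro!: family.family_add family.family_mult DERIV_mult)
qed

lemma family_continuous:
  assumes "family b f" "smooth_on UNIV b" "\<And>p. p \<in> K \<Longrightarrow> 1 + fst p * b (snd p) \<noteq> 0"
  shows "continuous_on K (\<lambda>p. f (fst p) (snd p))"
proof -
  have c: "continuous_on K (\<lambda>p. g (snd p))" if "smooth_on UNIV g" for g
    by (rule continuous_on_compose2[OF smooth_on_continuous[OF that]]) (auto intro: continuous_intros)
  show ?thesis
    using assms(1) by induction (auto intro!: continuous_intros c assms(2,3))
qed

section \<open>Local extrema of periodic functions\<close>

lemma is_local_min_compose:
  "isCont h q \<Longrightarrow> is_local_min f (h q) \<Longrightarrow> is_local_min (\<lambda>x. f (h x)) q"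
  unfolding is_local_min_def isCont_def
  by (erule eventually_compose_filterlim) (simp add: filterlim_at_within_not_equal tendsto_nhds_iff)

lemma is_local_max_iff: "is_local_max f q \<longleftrightarrow> is_local_min (\<lambda>x. - f x) q"
  by (simp add: is_local_max_def is_local_min_def)

text \<open>A diffeomorphism of the circle need not preserve \<open>{0..<1}\<close>. Uniqueness per
  period is therefore restated as the points forming one coset of the integers, a form that such
  maps transport.\<close>

lemma ex1_unit_interval_iff:
  assumes "\<And>q::real. P (q + 1) = P q"
  shows "(\<exists>!m. m \<in> {0..<1} \<and> P m) \<longleftrightarrow> (\<exists>c. \<forall>q. P q \<longleftrightarrow> q - c \<in> \<int>)"
proof
  assume "\<exists>!m. m \<in> {0..<1} \<and> P m"
  then obtain m where m: "m \<in> {0..<1}" "P m" "\<And>x. x \<in> {0..<1} \<Longrightarrow> P x \<Longrightarrow> x = m" by blast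
  have "P q \<longleftrightarrow> q - m \<in> \<int>" for q
  proof
    assume "P q"
    then have "P (frac q)" by (simp add: periodic_frac[of P, OF assms])
    then have "frac q = m" using m(3)[of "frac q"] frac_lt_1[of q] by simp
    then show "q - m \<in> \<int>" by (auto simp: frac_def)
  next
    assume "q - m \<in> \<int>"
    then obtain z where "q = m + of_int z" by (auto elim!: Ints_cases simp: algebra_simps)
    then show "P q" using m(2) periodic_int[of P, OF assms] by simp
  qed
  then show "\<exists>c. \<forall>q. P q \<longleftrightarrow> q - c \<in> \<int>" by blast
next
  assume "\<exists>c. \<forall>q. P q \<longleftrightarrow> q - c \<in> \<int>"
  then obtain c where c: "\<And>q. P q \<longleftrightarrow> q - c \<in> \<int>" by blast
  show "\<exists>!m. m \<in> {0..<1} \<and> P m"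
  proof (rule ex1I[of _ "frac c"])
    show "frac c \<in> {0..<1} \<and> P (frac c)"
      using frac_lt_1[of c] by (simp add: c frac_def)
    fix x assume x: "x \<in> {0..<1} \<and> P x"
    then have "x = frac x" by (simp add: frac_eq)
    have "x - c \<in> \<int>" using x c by blast
    then obtain z where "x = c + of_int z" by (auto elim!: Ints_cases simp: algebra_simps)
    then have "frac x = frac c" by (simp add: frac_def)
    then show "x = frac c" using \<open>x = frac x\<close> by simp
  qed
qed

lemma periodic_is_local_min:
  assumes "\<And>q. U (q + 1) = U q"
  shows "is_local_min U (q + 1) = is_local_min U q"
  using is_local_min_compose[where h="\<lambda>x. x + 1" and q=q and f=U]
    is_local_min_compose[where h="\<lambda>x. x - 1" and q="q + 1" and f=U]
    assms assms[of "x - 1" for x] by auto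

lemma admissible_iff:
  "admissible U \<longleftrightarrow> smooth_on UNIV U \<and> (\<forall>q. U (q + 1) = U q) \<and>
     (\<exists>c. \<forall>q. is_local_min U q \<longleftrightarrow> q - c \<in> \<int>) \<and> (\<exists>c. \<forall>q. is_local_min (\<lambda>x. - U x) q \<longleftrightarrow> q - c \<in> \<int>) \<and>
     (\<forall>q. deriv U q = 0 \<longrightarrow> deriv (deriv U) q \<noteq> 0)"
proof (cases "\<forall>q. U (q + 1) = U q")
  case True
  then have "is_local_min U (q + 1) = is_local_min U q"
    "is_local_min (\<lambda>x. - U x) (q + 1) = is_local_min (\<lambda>x. - U x) q" for q
    using periodic_is_local_min[of U] periodic_is_local_min[of "\<lambda>x. - U x"] by auto
  note ex1_unit_interval_iff[of "is_local_min U", OF this(1)]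
    ex1_unit_interval_iff[of "is_local_min (\<lambda>x. - U x)", OF this(2)]
  then show ?thesis
    unfolding admissible_def smooth_periodic_iff is_local_max_iff using True by simp
qed (auto simp: admissible_def smooth_periodic_iff)

lemma deriv_uminus_smooth:
  assumes "smooth_on UNIV U"
  shows "deriv (\<lambda>x. - U x) = (\<lambda>x. - deriv U x)"
proof
  fix x show "deriv (\<lambda>x. - U x) x = - deriv U x"
    by (rule DERIV_imp_deriv[OF DERIV_minus[OF smooth_on_DERIV[OF assms]]]) simp
qed

lemma funpow_deriv_uminus:
  assumes "smooth_on UNIV U"
  shows "(deriv ^^ k) (\<lambda>x. - U x) = (\<lambda>x. - (deriv ^^ k) U x)"
  by (induction k) (auto simp: deriv_uminus_smooth smooth_on_funpow_deriv assms)

lemma admissible_uminus: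
  assumes "admissible U"
  shows "admissible (\<lambda>x. - U x)"
  using assms unfolding admissible_iff
  by (auto simp: deriv_uminus_smooth smooth_on_minus smooth_on_deriv)

section \<open>Perturbation of a potential by diffeomorphisms of the circle\<close>

locale circle_shift =
  fixes U \<beta> :: "real \<Rightarrow> real" and v0 :: real
  assumes U: "smooth_on UNIV U" "\<And>q. U (q + 1) = U q"
    and \<beta>: "smooth_on UNIV \<beta>" "\<And>q. \<beta> (q + 1) = \<beta> q"
    and v0: "0 < v0" "\<And>q. v0 * \<bar>deriv \<beta> q\<bar> \<le> 1 / 2"
begin

definition shift :: "real \<Rightarrow> real \<Rightarrow> real" where
  "shift v q = q + v * \<beta> q"

definition unshift :: "real \<Rightarrow> real \<Rightarrow> real" where
  "unshift v = inv (shift v)"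

text \<open>For small \<open>v\<close> this is a composition with a bijection: \<open>W v\<close>
  has the range of \<open>U\<close>, and the critical values do not move with
  \<open>v\<close>.\<close>

definition W :: "real \<Rightarrow> real \<Rightarrow> real" where
  "W v q = U (unshift v q)"

lemma shift_DERIV: "(shift v has_real_derivative 1 + v * deriv \<beta> q) (at q)"
  unfolding shift_def[abs_def] using smooth_on_DERIV[OF \<beta>(1), of q]
  by (auto intro!: derivative_eq_intros)

text \<open>The bound 1/2 in the locale keeps the Jacobian away from 0 uniformly in
  \<open>v\<close>. It makes \<open>shift v\<close> strictly increasing and all the denominators
  \<open>1 + v * deriv \<beta> q\<close> nonzero.\<close>

lemma shift_deriv_ge: "\<bar>v\<bar> \<le> v0 \<Longrightarrow> 1 / 2 \<le> 1 + v * deriv \<beta> q"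
proof -
  assume "\<bar>v\<bar> \<le> v0"
  then have "\<bar>v * deriv \<beta> q\<bar> \<le> v0 * \<bar>deriv \<beta> q\<bar>"
    unfolding abs_mult by (intro mult_right_mono) auto
  then show ?thesis using v0(2)[of q] by linarith
qed

lemma shift_plus_1: "shift v (q + 1) = shift v q + 1"
  by (simp add: shift_def \<beta>)

lemma strict_mono_shift: "\<bar>v\<bar> \<le> v0 \<Longrightarrow> strict_mono (shift v)"
proof (rule strict_monoI)
  fix x y :: real assume v: "\<bar>v\<bar> \<le> v0" and "x < y"
  show "shift v x < shift v y"
  proof (rule DERIV_pos_imp_increasing[OF \<open>x < y\<close>])
    fix z
    show "\<exists>d. (shift v has_real_derivative d) (at z) \<and> 0 < d"
      using shift_DERIV shift_deriv_ge[OF v, of z] by (intro exI conjI) auto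
  qed
qed

lemma continuous_on_shift: "continuous_on A (shift v)"
  by (intro continuous_at_imp_continuous_on ballI DERIV_isCont[OF shift_DERIV])

lemma surj_shift: "surj (shift v)"
proof -
  obtain B where B: "B > 0" "\<And>q. \<bar>\<beta> q\<bar> \<le> B"
    using periodic_bounded[OF smooth_on_continuous[OF \<beta>(1)] \<beta>(2)] by blast
  have bd: "\<bar>v * \<beta> q\<bar> \<le> \<bar>v\<bar> * B" for q
    unfolding abs_mult using B by (intro mult_left_mono) auto
  have "\<exists>x. shift v x = y" for y
  proof -
    have 1: "shift v (y - \<bar>v\<bar> * B) \<le> y"
      using bd[of "y - \<bar>v\<bar> * B"] by (auto simp: shift_def abs_le_iff)
    have 2: "y \<le> shift v (y + \<bar>v\<bar> * B)"
      using bd[of "y + \<bar>v\<bar> * B"] by (auto simp: shift_def abs_le_iff)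
    have "0 \<le> \<bar>v\<bar> * B" using B(1) by simp
    then have 3: "y - \<bar>v\<bar> * B \<le> y + \<bar>v\<bar> * B" by linarith
    show ?thesis
      using IVT'[OF 1 2 3 continuous_on_shift] by blast
  qed
  then show ?thesis by (metis surjI)
qed

lemma shift_unshift [simp]: "shift v (unshift v q) = q"
  unfolding unshift_def by (rule surj_f_inv_f[OF surj_shift])

lemma unshift_shift [simp]: "\<bar>v\<bar> \<le> v0 \<Longrightarrow> unshift v (shift v q) = q"
  unfolding unshift_def by (rule inv_f_f[OF strict_mono_imp_inj_on[OF strict_mono_shift]])

lemma W_0: "W 0 = U"
  using unshift_shift[of 0] v0(1) by (auto simp: W_def shift_def)

lemma unshift_plus_1:
  assumes "\<bar>v\<bar> \<le> v0" shows "unshift v (q + 1) = unshift v q + 1"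
proof -
  have "q + 1 = shift v (unshift v q + 1)" by (simp add: shift_plus_1)
  then show ?thesis using unshift_shift[OF assms] by metis
qed

lemma unshift_continuous: "\<bar>v\<bar> \<le> v0 \<Longrightarrow> isCont (unshift v) q"
  using isCont_inverse_function[of 1 "unshift v q" "unshift v" "shift v"]
    DERIV_isCont[OF shift_DERIV] by simp

lemma unshift_DERIV:
  assumes "\<bar>v\<bar> \<le> v0"
  shows "(unshift v has_real_derivative inverse (1 + v * deriv \<beta> (unshift v q))) (at q)"
proof (rule DERIV_inverse_function[where f="shift v" and a="q - 1" and b="q + 1"])
  show "1 + v * deriv \<beta> (unshift v q) \<noteq> 0"
    using shift_deriv_ge[OF assms, of "unshift v q"] by auto
qed (auto intro: shift_DERIV unshift_continuous assms)

lemma smooth_on_unshift: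
  assumes "\<bar>v\<bar> \<le> v0" shows "smooth_on UNIV (unshift v)"
proof (rule smooth_on_inverse_function[OF unshift_DERIV[OF assms]])
  show "smooth_on UNIV (\<lambda>q. 1 + v * deriv \<beta> q)"
    by (intro smooth_on_add smooth_on_mult smooth_on_deriv \<beta>) auto
  show "1 + v * deriv \<beta> x \<noteq> 0" for x
    using shift_deriv_ge[OF assms, of x] by auto
qed auto

lemma smooth_on_W: "\<bar>v\<bar> \<le> v0 \<Longrightarrow> smooth_on UNIV (W v)"
  unfolding W_def[abs_def] by (rule smooth_on_compose[OF U(1) smooth_on_unshift]) auto

lemma W_periodic: "\<bar>v\<bar> \<le> v0 \<Longrightarrow> W v (q + 1) = W v q"
  by (simp add: W_def unshift_plus_1 U)

lemma range_W: "\<bar>v\<bar> \<le> v0 \<Longrightarrow> range (W v) = range U"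
proof -
  assume v: "\<bar>v\<bar> \<le> v0"
  have "U q = W v (shift v q)" for q using v by (simp add: W_def)
  then show ?thesis by (auto simp: W_def)
qed

lemma max_val_W: "\<bar>v\<bar> \<le> v0 \<Longrightarrow> max_val (W v) = max_val U"
  and min_val_W: "\<bar>v\<bar> \<le> v0 \<Longrightarrow> min_val (W v) = min_val U"
  unfolding max_val_def min_val_def using range_W by simp_all

lemma is_local_min_W:
  assumes v: "\<bar>v\<bar> \<le> v0"
  shows "is_local_min (\<lambda>q. f (unshift v q)) q \<longleftrightarrow> is_local_min f (unshift v q)"
proof
  assume "is_local_min f (unshift v q)"
  then show "is_local_min (\<lambda>q. f (unshift v q)) q"
    by (rule is_local_min_compose[OF unshift_continuous[OF v]])
next
  assume "is_local_min (\<lambda>q. f (unshift v q)) q"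
  then have "is_local_min (\<lambda>x. f (unshift v (shift v x))) (unshift v q)"
    using is_local_min_compose[where h="shift v" and q="unshift v q" and f="\<lambda>q. f (unshift v q)"]
      DERIV_isCont[OF shift_DERIV] by simp
  then show "is_local_min f (unshift v q)" using v by simp
qed

text \<open>\<open>shift v\<close> commutes with integer translations and so carries cosets of the
  integers to cosets; this transports the uniqueness of the extrema.\<close>

lemma unshift_Ints:
  assumes v: "\<bar>v\<bar> \<le> v0"
  shows "unshift v q - c \<in> \<int> \<longleftrightarrow> q - shift v c \<in> \<int>"
proof
  have sh: "shift v (c + of_int z) = shift v c + of_int z" for c z
    using periodic_int[of "\<lambda>q. shift v q - q" c z] shift_plus_1[of v] by simp
  show "unshift v q - c \<in> \<int> \<Longrightarrow> q - shift v c \<in> \<int>"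
  proof -
    assume "unshift v q - c \<in> \<int>"
    then obtain z where "unshift v q = c + of_int z" by (auto elim!: Ints_cases simp: algebra_simps)
    then have "q = shift v c + of_int z" using sh[of c z] shift_unshift[of v q] by simp
    then show ?thesis by simp
  qed
  assume "q - shift v c \<in> \<int>"
  then obtain z where "q = shift v c + of_int z" by (auto elim!: Ints_cases simp: algebra_simps)
  then have "q = shift v (c + of_int z)" using sh by simp
  then have "unshift v q = c + of_int z" using v by simp
  then show "unshift v q - c \<in> \<int>" by simp
qed

lemma deriv_W:
  "\<bar>v\<bar> \<le> v0 \<Longrightarrow> deriv (W v) = (\<lambda>q. deriv U (unshift v q) * deriv (unshift v) q)"
  unfolding W_def[abs_def]
  by (intro ext DERIV_imp_deriv DERIV_chain2 smooth_on_DERIV[OF U(1)] smooth_on_DERIV[OF smooth_on_unshift]) auto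

lemma deriv_unshift_neq_0: "\<bar>v\<bar> \<le> v0 \<Longrightarrow> deriv (unshift v) q \<noteq> 0"
  using DERIV_imp_deriv[OF unshift_DERIV, of v q] shift_deriv_ge[of v "unshift v q"] by auto

lemma admissible_W:
  assumes "admissible U" and v: "\<bar>v\<bar> \<le> v0"
  shows "admissible (W v)"
proof -
  obtain c d where cd: "\<And>q. is_local_min U q \<longleftrightarrow> q - c \<in> \<int>" "\<And>q. is_local_min (\<lambda>x. - U x) q \<longleftrightarrow> q - d \<in> \<int>"
    using assms(1) unfolding admissible_iff by blast
  have "is_local_min (W v) q \<longleftrightarrow> q - shift v c \<in> \<int>" for q
    using is_local_min_W[OF v, of U q] cd unshift_Ints[OF v] by (simp add: W_def[abs_def])
  moreover have "is_local_min (\<lambda>x. - W v x) q \<longleftrightarrow> q - shift v d \<in> \<int>" for q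
    using is_local_min_W[OF v, of "\<lambda>x. - U x" q] cd unshift_Ints[OF v] by (simp add: W_def[abs_def])
  moreover have "deriv (deriv (W v)) q \<noteq> 0" if "deriv (W v) q = 0" for q
  proof -
    let ?\<Phi> = "unshift v"
    have U0: "deriv U (?\<Phi> q) = 0"
      using that deriv_unshift_neq_0[OF v, of q] by (simp add: deriv_W[OF v])
    have "((\<lambda>q. deriv U (?\<Phi> q)) has_real_derivative deriv (deriv U) (?\<Phi> q) * deriv ?\<Phi> q) (at q)"
      by (intro DERIV_chain2[where f="deriv U"] smooth_on_DERIV[OF smooth_on_deriv[OF U(1)]] smooth_on_DERIV[OF smooth_on_unshift[OF v]]) auto
    moreover have "(deriv ?\<Phi> has_real_derivative deriv (deriv ?\<Phi>) q) (at q)"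
      by (intro smooth_on_DERIV[OF smooth_on_deriv[OF smooth_on_unshift[OF v]]]) auto
    \<comment> \<open>At a critical point of \<open>W v\<close> the term with the second derivative
      of \<open>unshift v\<close> carries the factor \<open>deriv U = 0\<close>. What remains is the
      second derivative of \<open>U\<close> times a nonzero square.\<close>
    ultimately have "(deriv (W v) has_real_derivative
        deriv (deriv U) (?\<Phi> q) * deriv ?\<Phi> q * deriv ?\<Phi> q + deriv (deriv ?\<Phi>) q * deriv U (?\<Phi> q)) (at q)"
      unfolding deriv_W[OF v] by (rule DERIV_mult)
    from DERIV_imp_deriv[OF this] show ?thesis
      using U0 deriv_unshift_neq_0[OF v, of q] assms(1) unfolding admissible_iff by simp
  qed
  ultimately show ?thesis
    unfolding admissible_iff using smooth_on_W[OF v] W_periodic[OF v] by blast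
qed

lemma funpow_deriv_W:
  "\<exists>E. family (deriv \<beta>) E \<and> (\<forall>v q. \<bar>v\<bar> \<le> v0 \<longrightarrow> (deriv ^^ k) (W v) q = E v (unshift v q))"
proof (induction k)
  case 0
  show ?case by (rule exI[of _ "\<lambda>v. U"]) (auto simp: W_def intro: family_base U)
next
  case (Suc k)
  then obtain E where E: "family (deriv \<beta>) E" "\<And>v q. \<bar>v\<bar> \<le> v0 \<Longrightarrow> (deriv ^^ k) (W v) q = E v (unshift v q)"
    by blast
  obtain E' where E': "family (deriv \<beta>) E'"
    "\<And>v q. 1 + v * deriv \<beta> q \<noteq> 0 \<Longrightarrow> (E v has_real_derivative E' v q) (at q)"
    using family_DERIV[OF E(1) smooth_on_deriv[OF \<beta>(1)]] by blast
  have "(deriv ^^ Suc k) (W v) q = E' v (unshift v q) * inverse (1 + v * deriv \<beta> (unshift v q))"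
    if v: "\<bar>v\<bar> \<le> v0" for v q
  proof -
    have "1 + v * deriv \<beta> (unshift v q) \<noteq> 0"
      using shift_deriv_ge[OF v, of "unshift v q"] by auto
    from DERIV_chain2[OF E'(2)[OF this] unshift_DERIV[OF v]]
    have "((deriv ^^ k) (W v) has_real_derivative E' v (unshift v q) * inverse (1 + v * deriv \<beta> (unshift v q))) (at q)"
      using E(2)[OF v] by presburger
    then show ?thesis using DERIV_imp_deriv by simp
  qed
  then show ?case
    by (intro exI[of _ "\<lambda>v q. E' v q * inverse (1 + v * deriv \<beta> q)"]) (auto intro: family.intros E')
qed

text \<open>The comparison is made at \<open>q = shift v p\<close>. There both derivatives are
  jointly continuous in \<open>(v, p)\<close> on a compact rectangle and agree at
  \<open>v = 0\<close>, so uniform continuity suffices; the dependence of \<open>unshift v\<close>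
  on \<open>v\<close> never has to be studied.\<close>

lemma W_tendsto:
  assumes "e > 0"
  obtains d where "d > 0" "\<And>v q. \<bar>v\<bar> \<le> d \<Longrightarrow> \<bar>v\<bar> \<le> v0 \<Longrightarrow> \<bar>(deriv ^^ k) (W v) q - (deriv ^^ k) U q\<bar> < e"
proof -
  obtain E where E: "family (deriv \<beta>) E" "\<And>v q. \<bar>v\<bar> \<le> v0 \<Longrightarrow> (deriv ^^ k) (W v) q = E v (unshift v q)"
    using funpow_deriv_W by blast
  have EW: "E v p = (deriv ^^ k) (W v) (shift v p)" if "\<bar>v\<bar> \<le> v0" for v p
    using E(2)[OF that, of "shift v p"] that by simp
  let ?D = "(deriv ^^ k) U"
  let ?H = "\<lambda>z. E (fst z) (snd z) - ?D (snd z + fst z * \<beta> (snd z))"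
  let ?K = "{-v0..v0} \<times> {0..1::real}"
  have c\<beta>: "continuous_on ?K (\<lambda>z. \<beta> (snd z))"
    by (rule continuous_on_compose2[OF smooth_on_continuous[OF \<beta>(1)] continuous_on_snd[OF continuous_on_id]]) simp
  have "continuous_on ?K (\<lambda>z. snd z + fst z * \<beta> (snd z))"
    by (intro continuous_on_add continuous_on_mult c\<beta> continuous_on_fst continuous_on_snd continuous_on_id)
  then have "continuous_on ?K (\<lambda>z. ?D (snd z + fst z * \<beta> (snd z)))"
    by (rule continuous_on_compose2[OF smooth_on_continuous[OF smooth_on_funpow_deriv[OF open_UNIV U(1)]]]) simp
  moreover have "continuous_on ?K (\<lambda>z. E (fst z) (snd z))"
  proof (rule family_continuous[OF E(1) smooth_on_deriv[OF \<beta>(1) open_UNIV]])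
    fix p assume "p \<in> ?K"
    then have "\<bar>fst p\<bar> \<le> v0" by auto
    from shift_deriv_ge[OF this, of "snd p"] show "1 + fst p * deriv \<beta> (snd p) \<noteq> 0" by auto
  qed
  ultimately have "continuous_on ?K ?H" by (intro continuous_on_diff)
  then have "uniformly_continuous_on ?K ?H"
    by (intro compact_uniformly_continuous compact_Times) auto
  then obtain d where d: "d > 0" "\<And>x y. x \<in> ?K \<Longrightarrow> y \<in> ?K \<Longrightarrow> dist y x < d \<Longrightarrow> dist (?H y) (?H x) < e"
    using assms unfolding uniformly_continuous_on_def by metis
  have H0: "?H (0, p) = 0" for p
    using EW[of 0 p] v0(1) W_0 by (simp add: shift_def)
  have small: "\<bar>?H (v, p)\<bar> < e" if v: "\<bar>v\<bar> \<le> d / 2" "\<bar>v\<bar> \<le> v0" and p: "p \<in> {0..1}" for v p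
  proof -
    have "dist (v, p) (0, p) < d" using v d(1) by (simp add: dist_Pair_Pair)
    then have "dist (?H (v, p)) (?H (0, p)) < e" using v p v0 by (intro d(2)) auto
    then show ?thesis unfolding H0 by simp
  qed
  have per: "?H (v, p + 1) = ?H (v, p)" if v: "\<bar>v\<bar> \<le> v0" for v p
  proof -
    have "E v (p + 1) = E v p"
      unfolding EW[OF v] shift_plus_1 by (rule periodic_funpow_deriv[OF smooth_on_W[OF v] W_periodic[OF v]])
    moreover have "?D (p + 1 + v * \<beta> (p + 1)) = ?D (p + v * \<beta> p)"
    proof -
      have "p + 1 + v * \<beta> (p + 1) = (p + v * \<beta> p) + 1" by (simp add: \<beta>(2))
      then show ?thesis using periodic_funpow_deriv[OF U, of k "p + v * \<beta> p"] by (simp only:)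
    qed
    ultimately show ?thesis by simp
  qed
  have "\<bar>(deriv ^^ k) (W v) q - ?D q\<bar> < e" if v: "\<bar>v\<bar> \<le> d / 2" "\<bar>v\<bar> \<le> v0" for v q
  proof -
    define p where "p = unshift v q"
    have "q = p + v * \<beta> p" unfolding p_def using shift_unshift[of v q] unfolding shift_def by simp
    then have eq: "(deriv ^^ k) (W v) q - ?D q = ?H (v, p)" using E(2)[OF v(2), of q] by (simp add: p_def)
    have "?H (v, frac p) = ?H (v, p)" using periodic_frac[of "\<lambda>p. ?H (v, p)", OF per[OF v(2)]] .
    then show ?thesis using small[OF v, of "frac p"] frac_lt_1[of p] unfolding eq by simp
  qed
  then show ?thesis using d(1) by (intro that[of "d / 2"]) auto
qed

text \<open>The substitution \<open>q = shift v p\<close> turns \<open>W v\<close> into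
  \<open>U\<close> and leaves \<open>v\<close> only in the Jacobian. Periodicity allows any unit
  interval as the domain, in particular one that starts at a maximum.\<close>

lemma integral_W:
  fixes h :: "real \<Rightarrow> real"
  assumes h: "continuous_on UNIV h" and v: "\<bar>v\<bar> \<le> v0"
  shows "integral {0..1} (\<lambda>q. h (W v q)) = integral {a..a + 1} (\<lambda>p. h (U p) * (1 + v * deriv \<beta> p))"
proof -
  have c: "continuous_on A (\<lambda>q. h (W v q))" for A
    by (rule continuous_on_compose2[OF h]) (use smooth_on_continuous[OF smooth_on_W[OF v]] in \<open>auto intro: continuous_on_subset\<close>)
  have mono: "shift v x \<le> shift v y" if "x \<le> y" for x y
    using strict_mono_less_eq[OF strict_mono_shift[OF v]] that by simp
  have "((\<lambda>p. (1 + v * deriv \<beta> p) *\<^sub>R h (W v (shift v p))) has_integral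
      (integral {shift v a..shift v (a + 1)} (\<lambda>q. h (W v q)))) {a..a + 1}"
    by (rule has_integral_substitution[OF _ _ _ c, of a "a + 1" "shift v" "shift v a" "shift v (a + 1)"])
      (auto intro!: mono has_field_derivative_at_within[OF shift_DERIV])
  then have "integral {a..a + 1} (\<lambda>p. h (U p) * (1 + v * deriv \<beta> p)) = integral {shift v a..shift v a + 1} (\<lambda>q. h (W v q))"
    using v by (auto intro!: integral_unique simp: W_def shift_plus_1 mult.commute)
  also have "\<dots> = integral {0..0 + 1} (\<lambda>q. h (W v q))"
    by (rule periodic_integral[OF c]) (simp add: W_periodic[OF v])
  finally show ?thesis by simp
qed

end

section \<open>Potential wells\<close>

lemma is_local_min_if_second_deriv_pos:
  assumes f: "smooth_on UNIV f" and 1: "deriv f q = 0" and 2: "deriv (deriv f) q > 0"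
  shows "is_local_min f q"
proof -
  have D: "(f has_real_derivative deriv f x) (at x)" for x
    by (rule smooth_on_DERIV[OF f]) simp
  have D2: "(deriv f has_real_derivative deriv (deriv f) q) (at q)"
    by (rule smooth_on_DERIV[OF smooth_on_deriv[OF f]]) simp_all
  obtain d1 where d1: "d1 > 0" "\<And>h. h > 0 \<Longrightarrow> h < d1 \<Longrightarrow> deriv f q < deriv f (q + h)"
    using DERIV_pos_inc_right[OF D2 2] by blast
  obtain d2 where d2: "d2 > 0" "\<And>h. h > 0 \<Longrightarrow> h < d2 \<Longrightarrow> deriv f (q - h) < deriv f q"
    using DERIV_pos_inc_left[OF D2 2] by blast
  have "f q \<le> f x" if x: "dist x q < min d1 d2" for x
  proof -
    consider "x < q" | "x = q" | "q < x" by linarith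
    then show ?thesis
    proof cases
      case 1
      obtain z where z: "x < z" "z < q" "f q - f x = (q - x) * deriv f z"
        using MVT2[OF 1, of f "deriv f"] D by blast
      have "deriv f (q - (q - z)) < deriv f q" using z x by (intro d2(2)) (auto simp: dist_real_def)
      then have "(q - x) * deriv f z \<le> 0" using assms(2) 1 by (intro mult_nonneg_nonpos) auto
      then show ?thesis using z by linarith
    next
      case 3
      obtain z where z: "q < z" "z < x" "f x - f q = (x - q) * deriv f z"
        using MVT2[OF 3, of f "deriv f"] D by blast
      have "deriv f q < deriv f (q + (z - q))" using z x by (intro d1(2)) (auto simp: dist_real_def)
      then have "0 \<le> (x - q) * deriv f z" using assms(2) 3 by (intro mult_nonneg_nonneg) auto
      then show ?thesis using z by linarith
    qed simp
  qed
  then show ?thesis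
    unfolding is_local_min_def eventually_nhds_metric using d1 d2 by (intro exI[of _ "min d1 d2"]) auto
qed

text \<open>The circle is cut open at a maximum \<open>a\<close>, so that the fundamental interval
  \<open>[a, a + 1]\<close> holds the whole well with its bottom \<open>m\<close>.\<close>

locale well =
  fixes U :: "real \<Rightarrow> real" and m a :: real
  assumes U: "smooth_on UNIV U" "\<And>q. U (q + 1) = U q"
    and am: "a < m" "m < a + 1"
    and dec: "\<And>q. a < q \<Longrightarrow> q < m \<Longrightarrow> deriv U q < 0"
    and inc: "\<And>q. m < q \<Longrightarrow> q < a + 1 \<Longrightarrow> 0 < deriv U q"
    and crit: "deriv U m = 0" "deriv U a = 0"
    and nondeg: "0 < deriv (deriv U) m" "deriv (deriv U) a < 0"

text \<open>A nondegenerate critical point is a local extremum and lies in the coset of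
  \<open>m\<close> or of the maximum, so only \<open>m\<close> remains inside the interval. On each
  side the mean value theorem gives one point with the right sign of \<open>deriv U\<close>, and a
  change of sign would produce a further zero.\<close>

lemma admissible_imp_well:
  assumes "admissible U"
  obtains m a where "well U m a" "U m = min_val U" "U a = max_val U"
proof -
  obtain c d where U: "smooth_on UNIV U" "\<And>q. U (q + 1) = U q"
    and cd: "\<And>q. is_local_min U q \<longleftrightarrow> q - c \<in> \<int>" "\<And>q. is_local_min (\<lambda>x. - U x) q \<longleftrightarrow> q - d \<in> \<int>"
    and nd: "\<And>q. deriv U q = 0 \<Longrightarrow> deriv (deriv U) q \<noteq> 0"
    using assms unfolding admissible_iff by blast
  have sp: "U \<in> smooth_periodic" using U by (simp add: smooth_periodic_iff)
  obtain M where M: "U M = max_val U" "\<And>q. U q \<le> U M" using extremal_values_attained(1)[OF sp] by blast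
  obtain m where m: "U m = min_val U" "\<And>q. U m \<le> U q" using extremal_values_attained(2)[OF sp] by blast
  \<comment> \<open>The translate of the maximum point for which \<open>m\<close> lies in
    \<open>[a, a + 1)\<close>.\<close>
  define a where "a = M + of_int \<lfloor>m - M\<rfloor>"
  have Ua: "U a = U M" unfolding a_def by (rule periodic_int[of U, OF U(2)])
  have D: "(U has_real_derivative deriv U x) (at x)" for x
    by (rule smooth_on_DERIV[OF U(1)]) simp
  have "U m \<noteq> U a"
  proof
    assume eq: "U m = U a"
    then have "U = (\<lambda>x. U m)" using m(2) M(2) Ua by (metis order_antisym)
    then have "deriv U = (\<lambda>x. 0)" by (metis deriv_const)
    then have "deriv U m = 0" "deriv (deriv U) m = 0" by simp_all
    then show False using nd by blast
  qed
  then have lt: "U m < U a" using M(2)[of m] Ua by simp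
  have am: "a < m" "m < a + 1"
  proof -
    have "a \<le> m" "m < a + 1" unfolding a_def by linarith+
    then show "a < m" "m < a + 1" using lt by (auto simp: less_le)
  qed
  have lm: "is_local_min U m" using m(2) by (simp add: is_local_min_def)
  have la: "is_local_min (\<lambda>x. - U x) a" using M(2) Ua by (simp add: is_local_min_def)
  have crit: "deriv U m = 0" "deriv U a = 0"
    using DERIV_local_min[OF D, of 1 m] DERIV_local_max[OF D, of 1 a] m(2) M(2) Ua by simp_all
  have Ints1: "q = m" if I: "q - m \<in> \<int>" and "a < q" "q < a + 1" for q
  proof -
    obtain z where "q - m = of_int z" using Ints_cases[OF I] by blast
    moreover have "\<bar>q - m\<bar> < 1" using that am by linarith
    ultimately have "real_of_int z < 1" "- 1 < real_of_int z" by auto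
    then have "z = 0" by linarith
    with \<open>q - m = of_int z\<close> show ?thesis by simp
  qed
  have Ints2: False if I: "q - a \<in> \<int>" and "a < q" "q < a + 1" for q
  proof -
    obtain z where "q - a = of_int z" using Ints_cases[OF I] by blast
    moreover have "0 < q - a" "q - a < 1" using that am by linarith+
    ultimately show ?thesis by simp
  qed
  have lmax: "q - a \<in> \<int>" if "deriv U q = 0" "deriv (deriv U) q < 0" for q
  proof -
    have "is_local_min (\<lambda>x. - U x) q"
      using that U by (intro is_local_min_if_second_deriv_pos)
        (auto simp: smooth_on_minus deriv_uminus_smooth smooth_on_deriv)
    then have "(q - d) - (a - d) \<in> \<int>" using la unfolding cd by (rule Ints_diff)
    then show ?thesis by simp
  qed
  have lmin: "q - m \<in> \<int>" if "deriv U q = 0" "deriv (deriv U) q > 0" for q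
  proof -
    have "is_local_min U q"
      using that U by (intro is_local_min_if_second_deriv_pos)
    then have "(q - c) - (m - c) \<in> \<int>" using lm unfolding cd by (rule Ints_diff)
    then show ?thesis by simp
  qed
  have nz: "deriv U q \<noteq> 0" if "a < q" "q < a + 1" "q \<noteq> m" for q
    using lmax[of q] lmin[of q] nd[of q] Ints1[of q] Ints2[of q] that by (meson linorder_neqE_linordered_idom)
  have cont: "continuous_on A (deriv U)" for A
    using smooth_on_continuous[OF smooth_on_deriv[OF U(1)]] by (auto intro: continuous_on_subset)
  have ivt: "\<exists>z. min x y \<le> z \<and> z \<le> max x y \<and> deriv U z = 0" if "deriv U x < 0" "deriv U y > 0" for x y
  proof (cases "x \<le> y")
    case True
    then show ?thesis using IVT'[of "deriv U" x 0 y] that cont by fastforce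
  next
    case False
    then show ?thesis using IVT2'[of "deriv U" x 0 y] that cont by fastforce
  qed
  have Ua1: "U (a + 1) = U a" by (rule U(2))
  have inc: "0 < deriv U q" if q: "m < q" "q < a + 1" for q
  proof (rule ccontr)
    assume "\<not> 0 < deriv U q"
    then have neg: "deriv U q < 0" using nz[of q] q am by auto
    obtain z where z: "m < z" "z < a + 1" "U (a + 1) - U m = (a + 1 - m) * deriv U z"
      using MVT2[OF am(2), of U "deriv U"] D by blast
    then have "0 < deriv U z" using lt Ua1 am by (metis diff_gt_0_iff_gt zero_less_mult_pos)
    then obtain y where "min q z \<le> y" "y \<le> max q z" "deriv U y = 0" using ivt[OF neg] by blast
    then show False using nz[of y] q z am by auto
  qed
  have dec: "deriv U q < 0" if q: "a < q" "q < m" for q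
  proof (rule ccontr)
    assume "\<not> deriv U q < 0"
    then have pos: "deriv U q > 0" using nz[of q] q am by auto
    obtain z where z: "a < z" "z < m" "U m - U a = (m - a) * deriv U z"
      using MVT2[OF am(1), of U "deriv U"] D by blast
    then have "(m - a) * deriv U z < 0" using lt by linarith
    then have "deriv U z < 0" using am(1) by (simp add: mult_less_0_iff)
    then obtain y where "min z q \<le> y" "y \<le> max z q" "deriv U y = 0" using ivt[OF _ pos] by blast
    then show False using nz[of y] q z am by auto
  qed
  have n1: "0 < deriv (deriv U) m"
    using lmax[of m] nd[of m] crit Ints2[of m] am by (meson linorder_neqE_linordered_idom)
  have n2: "deriv (deriv U) a < 0"
  proof (rule ccontr)
    assume "\<not> deriv (deriv U) a < 0"
    then have "a - m \<in> \<int>" using lmin[of a] nd[of a] crit by auto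
    then have "m - a \<in> \<int>" using Ints_minus by fastforce
    then show False using Ints2[of m] am by simp
  qed
  have "well U m a"
    by unfold_locales (use U am inc dec crit n1 n2 in blast)+
  then show ?thesis using that m M Ua by simp
qed

context well
begin

abbreviation "S \<equiv> {a<..<a + 1}"
definition "lo = U m"
definition "hi = U a"
definition "R = sqrt (hi - lo)"

lemma DU: "(U has_real_derivative deriv U x) (at x)"
  by (rule smooth_on_DERIV[OF U(1)]) simp

lemma DDU: "(deriv U has_real_derivative deriv (deriv U) x) (at x)"
  by (rule smooth_on_DERIV[OF smooth_on_deriv[OF U(1)]]) simp_all

lemma continuous_U: "continuous_on A U" and continuous_dU: "continuous_on A (deriv U)"
  and continuous_ddU: "continuous_on A (deriv (deriv U))"
  using smooth_on_continuous U(1) smooth_on_deriv by (meson continuous_on_subset open_UNIV subset_UNIV)+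

lemma U_a1: "U (a + 1) = hi"
  by (simp add: hi_def U)

lemma U_strict_mono: "m \<le> x \<Longrightarrow> x < y \<Longrightarrow> y \<le> a + 1 \<Longrightarrow> U x < U y"
proof -
  assume xy: "m \<le> x" "x < y" "y \<le> a + 1"
  obtain z where z: "x < z" "z < y" "U y - U x = (y - x) * deriv U z"
    using MVT2[OF xy(2), of U "deriv U"] DU by blast
  have "0 < (y - x) * deriv U z" using inc[of z] xy z by simp
  then show ?thesis using z by linarith
qed

lemma U_strict_antimono: "a \<le> x \<Longrightarrow> x < y \<Longrightarrow> y \<le> m \<Longrightarrow> U y < U x"
proof -
  assume xy: "a \<le> x" "x < y" "y \<le> m"
  obtain z where z: "x < z" "z < y" "U y - U x = (y - x) * deriv U z"
    using MVT2[OF xy(2), of U "deriv U"] DU by blast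
  have "(y - x) * deriv U z < 0" using dec[of z] xy z by (simp add: mult_less_0_iff)
  then show ?thesis using z by linarith
qed

lemma lo_less_hi: "lo < hi"
  using U_strict_antimono[of a m] am by (simp add: lo_def hi_def)

lemma R_pos: "0 < R" and R_sq: "R\<^sup>2 = hi - lo"
  using lo_less_hi by (simp_all add: R_def)

lemma U_greater_lo: "a \<le> q \<Longrightarrow> q \<le> a + 1 \<Longrightarrow> q \<noteq> m \<Longrightarrow> lo < U q"
  using U_strict_mono[of m q] U_strict_antimono[of q m] by (force simp: lo_def)

lemma U_less_hi: "q \<in> S \<Longrightarrow> U q < hi"
proof (cases "m \<le> q")
  case True
  assume "q \<in> S"
  then show ?thesis using U_strict_mono[of q "a + 1"] True U_a1 by simp
next
  case False
  assume "q \<in> S"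
  then show ?thesis using U_strict_antimono[of a q] False by (simp add: hi_def)
qed

lemma U_le_hi: "a \<le> q \<Longrightarrow> q \<le> a + 1 \<Longrightarrow> U q \<le> hi"
  using U_less_hi[of q] U_a1 by (cases "q = a \<or> q = a + 1") (auto simp: hi_def)

subsection \<open>The Morse coordinate\<close>

definition V :: "real \<Rightarrow> real" where
  "V q = integral {0..1} (\<lambda>s. (1 - s) * deriv (deriv U) (m + s * (q - m)))"

lemma smooth_on_V: "smooth_on UNIV V"
  unfolding V_def[abs_def]
  by (rule smooth_on_integral) (auto intro!: smooth_on_deriv U continuous_intros)

text \<open>Taylor's formula with integral remainder, as a single application of the fundamental theorem
  to \<open>U(m + s(q - m)) + (1 - s)(q - m) U'(m + s(q - m))\<close>.\<close>

lemma U_eq_V: "U q = lo + (q - m)\<^sup>2 * V q"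
proof -
  let ?y = "\<lambda>s. m + s * (q - m)"
  let ?F = "\<lambda>s. U (?y s) + (1 - s) * (q - m) * deriv U (?y s)"
  have d: "(?F has_real_derivative (q - m)\<^sup>2 * ((1 - s) * deriv (deriv U) (?y s))) (at s)" for s
  proof -
    have y: "(?y has_real_derivative (q - m)) (at s)" by (auto intro!: derivative_eq_intros)
    have "((\<lambda>s. U (?y s)) has_real_derivative deriv U (?y s) * (q - m)) (at s)"
      by (rule DERIV_chain2[where g="?y", OF DU y])
    moreover have "((\<lambda>s. deriv U (?y s)) has_real_derivative deriv (deriv U) (?y s) * (q - m)) (at s)"
      by (rule DERIV_chain2[where g="?y", OF DDU y])
    moreover have "((\<lambda>s. (1 - s) * (q - m)) has_real_derivative - (q - m)) (at s)"
      by (auto intro!: derivative_eq_intros)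
    ultimately have "(?F has_real_derivative deriv U (?y s) * (q - m) +
        (- (q - m) * deriv U (?y s) + deriv (deriv U) (?y s) * (q - m) * ((1 - s) * (q - m)))) (at s)"
      by (intro DERIV_add DERIV_mult)
    then show ?thesis by (rule DERIV_cong) (simp add: power2_eq_square algebra_simps)
  qed
  have "((\<lambda>s. (q - m)\<^sup>2 * ((1 - s) * deriv (deriv U) (?y s))) has_integral ?F 1 - ?F 0) {0..1}"
    by (rule fundamental_theorem_of_calculus)
      (auto intro: has_field_derivative_at_within[OF d] simp flip: has_real_derivative_iff_has_vector_derivative)
  then have "integral {0..1} (\<lambda>s. (q - m)\<^sup>2 * ((1 - s) * deriv (deriv U) (?y s))) = ?F 1 - ?F 0"
    by (rule integral_unique)
  then have "(q - m)\<^sup>2 * V q = ?F 1 - ?F 0"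
    unfolding V_def by (simp only: integral_mult_right)
  then show ?thesis by (simp add: crit lo_def)
qed

lemma V_m: "V m = deriv (deriv U) m / 2"
proof -
  have "((\<lambda>s::real. 1 - s) has_integral (1 - 1\<^sup>2 / 2) - (0 - 0\<^sup>2 / 2)) {0..1}"
    by (rule fundamental_theorem_of_calculus)
      (auto intro!: derivative_eq_intros simp flip: has_real_derivative_iff_has_vector_derivative)
  then have "integral {0..1} (\<lambda>s::real. 1 - s) = 1 / 2" by (simp add: integral_unique)
  then show ?thesis by (simp add: V_def)
qed

lemma V_pos: "q \<in> S \<Longrightarrow> 0 < V q"
proof (cases "q = m")
  case True
  then show ?thesis using V_m nondeg by simp
next
  case False
  assume "q \<in> S"
  then have "0 < (q - m)\<^sup>2 * V q" using U_greater_lo[of q] U_eq_V[of q] False by simp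
  then show ?thesis using False by (simp add: zero_less_mult_iff)
qed

text \<open>A smooth signed square root of \<open>U - lo\<close>: the double zero at
  \<open>m\<close> has been split off, and \<open>V\<close> is positive on the whole arc, at
  \<open>m\<close> itself because its value there is half the second derivative of
  \<open>U\<close>.\<close>

definition X :: "real \<Rightarrow> real" where
  "X q = (q - m) * sqrt (V q)"

lemma smooth_on_X: "smooth_on S X"
  unfolding X_def[abs_def]
  by (intro smooth_on_mult smooth_on_diff smooth_on_sqrt smooth_on_subset[OF smooth_on_V]) (auto intro: V_pos)

lemma X_sq: "q \<in> S \<Longrightarrow> U q = lo + (X q)\<^sup>2"
  using U_eq_V[of q] V_pos[of q] by (simp add: X_def power_mult_distrib)

lemma X_sgn: "q \<in> S \<Longrightarrow> 0 < X q \<longleftrightarrow> m < q" "q \<in> S \<Longrightarrow> X q < 0 \<longleftrightarrow> q < m"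
  using V_pos[of q] by (simp_all add: X_def zero_less_mult_iff mult_less_0_iff)

lemma X_m: "X m = 0"
  by (simp add: X_def)

lemma DX: "q \<in> S \<Longrightarrow> (X has_real_derivative deriv X q) (at q)"
  by (rule smooth_on_DERIV[OF smooth_on_X])

lemma deriv_X_eq: "q \<in> S \<Longrightarrow> deriv U q = 2 * X q * deriv X q"
proof -
  assume q: "q \<in> S"
  have "((\<lambda>q. lo + (X q)\<^sup>2) has_real_derivative 2 * X q * deriv X q) (at q)"
    using DX[OF q] by (auto intro!: derivative_eq_intros)
  then have "(U has_real_derivative 2 * X q * deriv X q) (at q)"
    by (rule has_field_derivative_transform_within_open[of _ _ _ S]) (use q X_sq in auto)
  then show ?thesis by (rule DERIV_imp_deriv)
qed

text \<open>Off \<open>m\<close> the sign follows from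
  \<open>deriv U q = 2 * X q * deriv X q\<close>. At \<open>m\<close> this identity is empty, and
  the product rule gives the value \<open>sqrt (V m)\<close> instead.\<close>

lemma deriv_X_pos: "q \<in> S \<Longrightarrow> 0 < deriv X q"
proof -
  assume q: "q \<in> S"
  consider "q < m" | "q = m" | "m < q" by linarith
  then show ?thesis
  proof cases
    case 1
    then have "2 * X q * deriv X q < 0" "X q < 0" using dec[of q] q deriv_X_eq[OF q] X_sgn[OF q] by auto
    then show ?thesis by (simp add: mult_less_0_iff)
  next
    case 2
    have "m \<in> S" using am by simp
    from smooth_on_DERIV[OF smooth_on_sqrt[OF smooth_on_subset[OF smooth_on_V] V_pos] this]
    have "((\<lambda>x. sqrt (V x)) has_real_derivative deriv (\<lambda>x. sqrt (V x)) m) (at m)" by simp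
    moreover have "((\<lambda>x. x - m) has_real_derivative 1) (at m)" by (auto intro!: derivative_eq_intros)
    ultimately have "(X has_real_derivative 1 * sqrt (V m) + deriv (\<lambda>x. sqrt (V x)) m * (m - m)) (at m)"
      unfolding X_def[abs_def] by (intro DERIV_mult)
    from DERIV_imp_deriv[OF this] show ?thesis using 2 V_pos[OF \<open>m \<in> S\<close>] by simp
  next
    case 3
    then have "0 < 2 * X q * deriv X q" "0 < X q" using inc[of q] q deriv_X_eq[OF q] X_sgn[OF q] by auto
    then show ?thesis by (simp add: zero_less_mult_iff)
  qed
qed

lemma X_strict_mono: "x \<in> S \<Longrightarrow> y \<in> S \<Longrightarrow> x < y \<Longrightarrow> X x < X y"
proof (erule DERIV_pos_imp_increasing)
  fix z assume "x \<in> S" "y \<in> S" "x \<le> z" "z \<le> y"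
  then have "z \<in> S" by simp
  then show "\<exists>d. (X has_real_derivative d) (at z) \<and> 0 < d" using DX deriv_X_pos by blast
qed

lemma X_less_iff: "x \<in> S \<Longrightarrow> y \<in> S \<Longrightarrow> X x < X y \<longleftrightarrow> x < y"
  using X_strict_mono[of x y] X_strict_mono[of y x] by (metis linorder_neqE_linordered_idom order_less_asym)

definition \<psi> :: "real \<Rightarrow> real" where
  "\<psi> = inv_into S X"

lemma X_surj: "y \<in> {-R<..<R} \<Longrightarrow> y \<in> X ` S"
proof -
  assume y: "y \<in> {-R<..<R}"
  have ysq: "y\<^sup>2 < hi - lo"
    using y power_strict_mono[of "\<bar>y\<bar>" R 2] unfolding R_sq[symmetric] by auto
  consider "y = 0" | "0 < y" | "y < 0" by linarith
  then show ?thesis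
  proof cases
    case 1
    then show ?thesis using X_m am by (intro image_eqI[of _ _ m]) auto
  next
    case 2
    obtain q where q: "m \<le> q" "q \<le> a + 1" "U q = lo + y\<^sup>2"
      using IVT'[of U m "lo + y\<^sup>2" "a + 1"] continuous_U U_a1 ysq am by (auto simp: lo_def)
    have "q \<noteq> m" "q \<noteq> a + 1" using q 2 ysq U_a1 by (auto simp: lo_def)
    then have qS: "q \<in> S" "m < q" using q am by auto
    then have "(X q)\<^sup>2 = y\<^sup>2" "0 < X q" using X_sq q X_sgn by auto
    then have "X q = y" using 2 by (simp add: power2_eq_iff)
    then show ?thesis using qS by blast
  next
    case 3
    obtain q where q: "a \<le> q" "q \<le> m" "U q = lo + y\<^sup>2"
      using IVT2'[of U m "lo + y\<^sup>2" a] continuous_U ysq am by (auto simp: lo_def hi_def)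
    have "q \<noteq> m" "q \<noteq> a" using q 3 ysq by (auto simp: lo_def hi_def)
    then have qS: "q \<in> S" "q < m" using q am by auto
    then have "(X q)\<^sup>2 = y\<^sup>2" "X q < 0" using X_sq q X_sgn by auto
    then have "X q = y" using 3 by (simp add: power2_eq_iff)
    then show ?thesis using qS by blast
  qed
qed

lemma \<psi>_mem: "y \<in> {-R<..<R} \<Longrightarrow> \<psi> y \<in> S" and X_\<psi>: "y \<in> {-R<..<R} \<Longrightarrow> X (\<psi> y) = y"
  unfolding \<psi>_def using X_surj by (auto intro: inv_into_into f_inv_into_f simp del: greaterThanLessThan_iff)

lemma \<psi>_X: "q \<in> S \<Longrightarrow> \<psi> (X q) = q"
  unfolding \<psi>_def by (rule inv_into_f_f) (auto intro!: inj_onI dest: X_strict_mono simp del: greaterThanLessThan_iff, metis X_strict_mono linorder_neqE_linordered_idom order_less_irrefl)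

lemma U_\<psi>: "y \<in> {-R<..<R} \<Longrightarrow> U (\<psi> y) = lo + y\<^sup>2"
  using X_sq[OF \<psi>_mem] X_\<psi> by simp

lemma \<psi>_mono: "x \<in> {-R<..<R} \<Longrightarrow> y \<in> {-R<..<R} \<Longrightarrow> x \<le> y \<Longrightarrow> \<psi> x \<le> \<psi> y"
  using X_less_iff[OF \<psi>_mem \<psi>_mem, of y x] X_\<psi>[of x] X_\<psi>[of y] by linarith

lemma \<psi>_continuous: "y \<in> {-R<..<R} \<Longrightarrow> isCont \<psi> y"
proof -
  assume y: "y \<in> {-R<..<R}"
  obtain d where d: "d > 0" "cball (\<psi> y) d \<subseteq> S"
    using open_contains_cball[THEN iffD1, rule_format, OF open_greaterThanLessThan \<psi>_mem[OF y]] by blast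
  have "isCont \<psi> (X (\<psi> y))"
  proof (rule isCont_inverse_function[where f=X and g=\<psi> and x="\<psi> y", OF d(1)])
    fix z assume "\<bar>z - \<psi> y\<bar> \<le> d"
    then have "z \<in> S" using d(2) by (auto simp: dist_real_def abs_minus_commute)
    then show "\<psi> (X z) = z" "isCont X z" using \<psi>_X DERIV_isCont[OF DX] by auto
  qed
  then show ?thesis using X_\<psi>[OF y] by simp
qed

lemma \<psi>_DERIV0: "y \<in> {-R<..<R} \<Longrightarrow> (\<psi> has_real_derivative inverse (deriv X (\<psi> y))) (at y)"
  using DERIV_inverse_function[of X "deriv X (\<psi> y)" \<psi> y "-R" R] DX[OF \<psi>_mem] deriv_X_pos[OF \<psi>_mem]
    X_\<psi> \<psi>_continuous by force

lemma smooth_on_\<psi>: "smooth_on {-R<..<R} \<psi>"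
  by (rule smooth_on_inverse_function[OF \<psi>_DERIV0 \<psi>_mem smooth_on_deriv[OF smooth_on_X]])
    (auto dest!: deriv_X_pos simp del: greaterThanLessThan_iff)

lemma D\<psi>: "y \<in> {-R<..<R} \<Longrightarrow> (\<psi> has_real_derivative deriv \<psi> y) (at y)"
  by (rule smooth_on_DERIV[OF smooth_on_\<psi>])

lemma deriv_\<psi>_pos: "y \<in> {-R<..<R} \<Longrightarrow> 0 < deriv \<psi> y"
  using DERIV_imp_deriv[OF \<psi>_DERIV0] deriv_X_pos[OF \<psi>_mem] by simp

lemma deriv_U_\<psi>: "y \<in> {-R<..<R} \<Longrightarrow> deriv U (\<psi> y) * deriv \<psi> y = 2 * y"
  using deriv_X_eq[OF \<psi>_mem] X_\<psi> DERIV_imp_deriv[OF \<psi>_DERIV0] deriv_X_pos[OF \<psi>_mem, of y]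
  by (simp add: field_simps)

end

subsection \<open>Integrals over an arc\<close>

abbreviation half_circle :: "real set" where
  "half_circle \<equiv> {- (pi / 2)..pi / 2}"

text \<open>With \<open>t = r\<^sup>2\<close> and \<open>x = r sin \<theta>\<close> the case
  \<open>j = 0\<close> is the Abel-type integral of
  \<open>G(x\<^sup>2) / (2 sqrt (r\<^sup>2 - x\<^sup>2))\<close> over \<open>[-r, r]\<close>. In the
  angle the domain is independent of \<open>t\<close> and the singularity is gone; each derivative
  in \<open>t\<close> contributes a factor \<open>(sin \<theta>)\<^sup>2\<close>, counted by
  \<open>j\<close>.\<close>

definition arc :: "nat \<Rightarrow> (real \<Rightarrow> real) \<Rightarrow> real \<Rightarrow> real" where
  "arc j G t = integral half_circle (\<lambda>\<theta>. sin \<theta> ^ (2 * j) * G (t * (sin \<theta>)\<^sup>2)) / 2"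

lemma mult_sin_sq_mem:
  fixes \<theta> t :: real
  shows "t \<in> {0..<T} \<Longrightarrow> t * (sin \<theta>)\<^sup>2 \<in> {0..<T}"
proof -
  assume t: "t \<in> {0..<T}"
  have "(sin \<theta>)\<^sup>2 \<le> 1" using sin_cos_squared_add[of \<theta>] zero_le_power2[of "cos \<theta>"] by linarith
  then have "t * (sin \<theta>)\<^sup>2 \<le> t * 1" using t by (intro mult_left_mono) auto
  then show ?thesis using t by auto
qed

lemma continuous_arc_integrand:
  fixes k G :: "real \<Rightarrow> real"
  assumes "continuous_on {0..<T} G" "continuous_on UNIV k" "t \<in> {0..<T}"
  shows "continuous_on A (\<lambda>\<theta>. k \<theta> * G (t * (sin \<theta>)\<^sup>2))"
proof (rule continuous_on_mult)
  show "continuous_on A k" using assms(2) by (auto intro: continuous_on_subset)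
  have "continuous_on A (\<lambda>\<theta>. t * (sin \<theta>)\<^sup>2)" by (intro continuous_intros)
  then show "continuous_on A (\<lambda>\<theta>. G (t * (sin \<theta>)\<^sup>2))"
    by (rule continuous_on_compose2[OF assms(1)]) (rule image_subsetI, rule mult_sin_sq_mem[OF assms(3)])
qed

lemma arc_integral_DERIV:
  fixes k G G' :: "real \<Rightarrow> real"
  assumes k: "continuous_on UNIV k"
    and G: "\<And>w. w \<in> {0..<T} \<Longrightarrow> (G has_real_derivative G' w) (at w within {0..})"
    and G': "continuous_on {0..<T} G'" and t: "t \<in> {0..<T}"
  shows "((\<lambda>t. integral half_circle (\<lambda>\<theta>. k \<theta> * G (t * (sin \<theta>)\<^sup>2))) has_real_derivative
     integral half_circle (\<lambda>\<theta>. (k \<theta> * (sin \<theta>)\<^sup>2) * G' (t * (sin \<theta>)\<^sup>2))) (at t within {0..<T})"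
proof -
  have contG: "continuous_on {0..<T} G"
    unfolding continuous_on_eq_continuous_within
    using DERIV_subset[OF G, of _ "{0..<T}"] DERIV_continuous by fastforce
  have "((\<lambda>t. integral (cbox (- (pi / 2)) (pi / 2)) (\<lambda>\<theta>. k \<theta> * G (t * (sin \<theta>)\<^sup>2))) has_real_derivative
     integral (cbox (- (pi / 2)) (pi / 2)) (\<lambda>\<theta>. (k \<theta> * (sin \<theta>)\<^sup>2) * G' (t * (sin \<theta>)\<^sup>2))) (at t within {0..<T})"
  proof (rule leibniz_rule_field_derivative[OF _ _ _ t])
    fix x \<theta> :: real assume x: "x \<in> {0..<T}"
    have "(\<lambda>t. t * (sin \<theta>)\<^sup>2) ` {0..<T} \<subseteq> {0..}" by auto
    then have "(G has_real_derivative G' (x * (sin \<theta>)\<^sup>2)) (at (x * (sin \<theta>)\<^sup>2) within (\<lambda>t. t * (sin \<theta>)\<^sup>2) ` {0..<T})"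
      by (rule DERIV_subset[OF G[OF mult_sin_sq_mem[OF x]]])
    moreover have "((\<lambda>t. t * (sin \<theta>)\<^sup>2) has_real_derivative (sin \<theta>)\<^sup>2) (at x within {0..<T})"
      by (auto intro!: derivative_eq_intros)
    ultimately have "(G \<circ> (\<lambda>t. t * (sin \<theta>)\<^sup>2) has_real_derivative G' (x * (sin \<theta>)\<^sup>2) * (sin \<theta>)\<^sup>2) (at x within {0..<T})"
      by (rule DERIV_image_chain)
    from DERIV_cmult[OF this, of "k \<theta>"]
    show "((\<lambda>t. k \<theta> * G (t * (sin \<theta>)\<^sup>2)) has_real_derivative k \<theta> * (sin \<theta>)\<^sup>2 * G' (x * (sin \<theta>)\<^sup>2)) (at x within {0..<T})"
      by (simp add: o_def mult_ac)
  next
    fix x assume x: "x \<in> {0..<T}"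
    show "(\<lambda>\<theta>. k \<theta> * G (x * (sin \<theta>)\<^sup>2)) integrable_on cbox (- (pi / 2)) (pi / 2)"
      by (rule integrable_continuous[OF continuous_arc_integrand[OF contG k x]])
  next
    let ?B = "{0..<T} \<times> cbox (- (pi / 2)) (pi / 2)"
    have "continuous_on ?B (\<lambda>z. fst z * (sin (snd z))\<^sup>2)" by (intro continuous_intros)
    then have "continuous_on ?B (\<lambda>z. G' (fst z * (sin (snd z))\<^sup>2))"
      by (rule continuous_on_compose2[OF G']) (auto simp del: atLeastLessThan_iff intro!: mult_sin_sq_mem)
    moreover have "continuous_on ?B (\<lambda>z. k (snd z))"
      by (rule continuous_on_compose2[OF k]) (auto intro!: continuous_intros)
    ultimately have "continuous_on ?B (\<lambda>z. (k (snd z) * (sin (snd z))\<^sup>2) * G' (fst z * (sin (snd z))\<^sup>2))"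
      by (intro continuous_intros)
    then show "continuous_on ?B (\<lambda>(x, \<theta>). (k \<theta> * (sin \<theta>)\<^sup>2) * G' (x * (sin \<theta>)\<^sup>2))"
      by (simp add: case_prod_unfold)
  qed simp
  then show ?thesis by (simp add: cbox_interval)
qed

lemma arc_DERIV:
  fixes G G' :: "real \<Rightarrow> real"
  assumes "\<And>w. w \<in> {0..<T} \<Longrightarrow> (G has_real_derivative G' w) (at w within {0..})"
    and "continuous_on {0..<T} G'" and "t \<in> {0..<T}"
  shows "(arc j G has_real_derivative arc (Suc j) G' t) (at t within {0..<T})"
proof -
  have "sin \<theta> ^ (2 * j) * (sin \<theta>)\<^sup>2 = sin \<theta> ^ (2 * Suc j)" for \<theta> :: real
    by (simp add: power2_eq_square)
  note eq = this
  have "((\<lambda>t. integral half_circle (\<lambda>\<theta>. sin \<theta> ^ (2 * j) * G (t * (sin \<theta>)\<^sup>2))) has_real_derivative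
     integral half_circle (\<lambda>\<theta>. (sin \<theta> ^ (2 * j) * (sin \<theta>)\<^sup>2) * G' (t * (sin \<theta>)\<^sup>2))) (at t within {0..<T})"
    by (rule arc_integral_DERIV[OF _ assms]) (auto intro!: continuous_intros)
  from DERIV_cdivide[OF this, of 2] show ?thesis
    unfolding arc_def[abs_def] eq .
qed

text \<open>With \<open>t = r\<^sup>2\<close> the function differentiated here is the integral of
  \<open>sqrt (r\<^sup>2 - x\<^sup>2) G(x\<^sup>2)\<close> over \<open>[-r, r]\<close>; its derivative is an
  integration by parts away from the form that the Leibniz rule gives.\<close>

lemma arc_primitive_DERIV:
  fixes G G' :: "real \<Rightarrow> real"
  assumes G: "\<And>w. w \<in> {0..<T} \<Longrightarrow> (G has_real_derivative G' w) (at w within {0..})"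
    and G': "continuous_on {0..<T} G'" and t: "t \<in> {0..<T}"
  shows "((\<lambda>t. t * integral half_circle (\<lambda>\<theta>. (cos \<theta>)\<^sup>2 * G (t * (sin \<theta>)\<^sup>2))) has_real_derivative
    arc 0 G t) (at t within {0..<T})"
proof -
  have contG: "continuous_on {0..<T} G"
    unfolding continuous_on_eq_continuous_within
    using DERIV_subset[OF G, of _ "{0..<T}"] DERIV_continuous by fastforce
  let ?w = "\<lambda>\<theta>. t * (sin \<theta>)\<^sup>2"
  let ?f = "\<lambda>\<theta>. (cos \<theta>)\<^sup>2 * G (?w \<theta>)" and ?g = "\<lambda>\<theta>. ((cos \<theta>)\<^sup>2 * (sin \<theta>)\<^sup>2) * G' (?w \<theta>)"
    and ?h = "\<lambda>\<theta>. 1 * G (?w \<theta>)"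
  \<comment> \<open>The factor \<open>sin \<theta> * cos \<theta>\<close> vanishes at both ends, so
    this derivative integrates to 0. That trades the term with \<open>G'\<close> for the plain
    integral of \<open>G\<close>, which is twice the arc.\<close>
  have d: "((\<lambda>\<theta>. sin \<theta> * cos \<theta> * G (?w \<theta>)) has_real_derivative 2 * ?f \<theta> + 2 * t * ?g \<theta> - ?h \<theta>)
      (at \<theta> within half_circle)" for \<theta>
  proof -
    have "?w ` half_circle \<subseteq> {0..}" using t by auto
    then have "(G has_real_derivative G' (?w \<theta>)) (at (?w \<theta>) within ?w ` half_circle)"
      by (rule DERIV_subset[OF G[OF mult_sin_sq_mem[OF t]]])
    moreover have "(?w has_real_derivative 2 * t * sin \<theta> * cos \<theta>) (at \<theta> within half_circle)"
      by (auto intro!: derivative_eq_intros)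
    ultimately have 1: "(G \<circ> ?w has_real_derivative G' (?w \<theta>) * (2 * t * sin \<theta> * cos \<theta>)) (at \<theta> within half_circle)"
      by (rule DERIV_image_chain)
    have 2: "((\<lambda>\<theta>. sin \<theta> * cos \<theta>) has_real_derivative 2 * (cos \<theta>)\<^sup>2 - 1) (at \<theta> within half_circle)"
      by (auto intro!: derivative_eq_intros simp: power2_eq_square[symmetric] sin_squared_eq)
    show ?thesis
      using DERIV_mult[OF 2 1] unfolding o_def by (rule DERIV_cong) (simp add: algebra_simps power2_eq_square)
  qed
  have "((\<lambda>\<theta>. 2 * ?f \<theta> + 2 * t * ?g \<theta> - ?h \<theta>) has_integral
      sin (pi / 2) * cos (pi / 2) * G (?w (pi / 2)) - sin (- (pi / 2)) * cos (- (pi / 2)) * G (?w (- (pi / 2)))) half_circle"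
    by (rule fundamental_theorem_of_calculus[OF _ d[unfolded has_real_derivative_iff_has_vector_derivative]]) simp
  then have z: "integral half_circle (\<lambda>\<theta>. 2 * ?f \<theta> + 2 * t * ?g \<theta> - ?h \<theta>) = 0"
    by (simp add: integral_unique)
  have int: "?f integrable_on half_circle" "?g integrable_on half_circle" "?h integrable_on half_circle"
    by (rule integrable_continuous_real, rule continuous_arc_integrand[OF contG _ t] continuous_arc_integrand[OF G' _ t],
        intro continuous_intros)+
  have "((\<lambda>\<theta>. 2 * ?f \<theta> + 2 * t * ?g \<theta> - ?h \<theta>) has_integral
      2 * integral half_circle ?f + 2 * t * integral half_circle ?g - integral half_circle ?h) half_circle"
    by (intro has_integral_diff has_integral_add has_integral_mult_right integrable_integral int)
  then have "2 * integral half_circle ?f + 2 * t * integral half_circle ?g - integral half_circle ?h = 0"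
    unfolding z[symmetric] by (rule integral_unique[symmetric])
  then have eq: "integral half_circle ?f + t * integral half_circle ?g = arc 0 G t"
    by (simp add: arc_def)
  have "((\<lambda>t. integral half_circle (\<lambda>\<theta>. (cos \<theta>)\<^sup>2 * G (t * (sin \<theta>)\<^sup>2))) has_real_derivative
     integral half_circle ?g) (at t within {0..<T})"
    by (rule arc_integral_DERIV[OF _ G G' t]) (auto intro!: continuous_intros)
  then have "((\<lambda>t. t * integral half_circle (\<lambda>\<theta>. (cos \<theta>)\<^sup>2 * G (t * (sin \<theta>)\<^sup>2))) has_real_derivative
      1 * integral half_circle ?f + integral half_circle ?g * t) (at t within {0..<T})"
    by (intro DERIV_mult DERIV_ident)
  then show ?thesis by (rule DERIV_cong) (simp add: eq[symmetric] mult.commute)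
qed

lemma has_integral_superset_zero:
  fixes f :: "real \<Rightarrow> real"
  assumes "(f has_integral i) A" "A \<subseteq> B" "\<And>x. x \<in> B \<Longrightarrow> x \<notin> A \<Longrightarrow> f x = 0"
  shows "(f has_integral i) B"
proof -
  have "((\<lambda>x. if x \<in> A then f x else 0) has_integral i) B"
    using has_integral_restrict[OF assms(2)] assms(1) by blast
  then show ?thesis by (rule has_integral_eq[rotated]) (use assms(3) in auto)
qed

text \<open>An integral over \<open>[-r, r]\<close> against an even kernel sees \<open>e\<close>
  only through its even part, written here as a function of the square
  \<open>t = y\<^sup>2\<close>.\<close>

definition even_part :: "(real \<Rightarrow> real) \<Rightarrow> real \<Rightarrow> real" where
  "even_part e t = (e (sqrt t) + e (- sqrt t)) / 2"

lemma even_part_abs: "sqrt u = \<bar>x\<bar> \<Longrightarrow> even_part e u = (e x + e (- x)) / 2"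
  by (cases "x < 0") (simp_all add: even_part_def add.commute)

text \<open>Although \<open>e\<close> may have an odd part, its even part is a smooth function of
  the square, by two rounds of the theorem on even functions. Two derivatives here give three of the
  action, whose first derivative involves only the even part itself.\<close>

lemma even_part_DERIV:
  assumes e: "smooth_on {-R<..<R} e" and R: "R > 0"
  obtains G1 G2 where
    "\<And>t. t \<in> {0..<R\<^sup>2} \<Longrightarrow> (even_part e has_real_derivative G1 t) (at t within {0..})"
    "\<And>t. t \<in> {0..<R\<^sup>2} \<Longrightarrow> (G1 has_real_derivative G2 t) (at t within {0..})"
    "continuous_on {0..<R\<^sup>2} G1" "continuous_on {0..<R\<^sup>2} G2"
proof -
  define g where "g x = (e x + e (- x)) / 2" for x
  have "smooth_on {-R<..<R} (\<lambda>x. e (- x))"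
    by (rule smooth_on_compose[OF e]) (auto intro!: smooth_on_minus)
  then have "smooth_on {-R<..<R} (\<lambda>x. (e x + e (- x)) * (1/2))"
    by (intro smooth_on_mult smooth_on_add e) auto
  then have g: "smooth_on {-R<..<R} g" by (simp add: g_def[abs_def])
  have ge: "g (- x) = g x" for x by (simp add: g_def)
  obtain h1 where h1: "smooth_on {-R<..<R} h1" "\<And>x. h1 (- x) = h1 x"
    "\<And>w. 0 \<le> w \<Longrightarrow> w < R\<^sup>2 \<Longrightarrow> ((\<lambda>w. g (sqrt w)) has_real_derivative h1 (sqrt w)) (at w within {0..})"
    by (rule even_smooth_derivative_sqrt[OF g ge R]) (rule that)
  obtain h2 where h2: "smooth_on {-R<..<R} h2" "\<And>x. h2 (- x) = h2 x"
    "\<And>w. 0 \<le> w \<Longrightarrow> w < R\<^sup>2 \<Longrightarrow> ((\<lambda>w. h1 (sqrt w)) has_real_derivative h2 (sqrt w)) (at w within {0..})"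
    by (rule even_smooth_derivative_sqrt[OF h1(1,2) R]) (rule that)
  have cont: "continuous_on {0..<R\<^sup>2} (\<lambda>w. h (sqrt w))" if "smooth_on {-R<..<R} h" for h
  proof (rule continuous_on_compose2[OF smooth_on_continuous[OF that]])
    show "continuous_on {0..<R\<^sup>2} sqrt" by (intro continuous_on_real_sqrt continuous_on_id[unfolded id_def])
    show "sqrt ` {0..<R\<^sup>2} \<subseteq> {-R<..<R}"
    proof (rule image_subsetI)
      fix w assume "w \<in> {0..<R\<^sup>2}"
      then have "sqrt w < R" "0 \<le> sqrt w" using R by (auto intro: real_less_lsqrt)
      then show "sqrt w \<in> {-R<..<R}" using R unfolding greaterThanLessThan_iff by linarith
    qed
  qed
  have g_eq: "(\<lambda>w. g (sqrt w)) = even_part e" by (simp add: g_def even_part_def fun_eq_iff)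
  show ?thesis
  proof (rule that[of "\<lambda>w. h1 (sqrt w)" "\<lambda>w. h2 (sqrt w)"])
    fix t assume t: "t \<in> {0..<R\<^sup>2}"
    show "(even_part e has_real_derivative h1 (sqrt t)) (at t within {0..})"
      using h1(3)[of t] t unfolding g_eq by simp
    show "((\<lambda>w. h1 (sqrt w)) has_real_derivative h2 (sqrt t)) (at t within {0..})"
      using h2(3)[of t] t by simp
  qed (rule cont[OF h1(1)], rule cont[OF h2(1)])
qed

context well
begin

text \<open>The truncation \<open>max 0\<close> keeps the domain independent of \<open>c\<close>.
  The weight is 1 for the action of \<open>U\<close> and the derivative of the perturbing field for
  its variation.\<close>

definition J :: "(real \<Rightarrow> real) \<Rightarrow> real \<Rightarrow> real" where
  "J w c = integral {a..a + 1} (\<lambda>p. sqrt (max 0 (c - U p)) * w p)"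

text \<open>Under \<open>p = \<psi> (r * sin \<theta>)\<close> with \<open>r = sqrt t\<close> the
  potential becomes \<open>lo + t * (sin \<theta>)\<^sup>2\<close>, so the square root is
  \<open>r * cos \<theta>\<close>, and \<open>dp\<close> contributes another factor
  \<open>r * cos \<theta>\<close>. Reflection in \<open>\<theta>\<close> removes the odd part of the
  density.\<close>

lemma J_arc:
  assumes w: "continuous_on UNIV w" and t: "0 \<le> t" "t < R\<^sup>2"
  shows "J w (lo + t) = t * integral half_circle (\<lambda>\<theta>. (cos \<theta>)\<^sup>2 * even_part (\<lambda>y. deriv \<psi> y * w (\<psi> y)) (t * (sin \<theta>)\<^sup>2))"
proof -
  define r where "r = sqrt t"
  have r: "0 \<le> r" "r < R" "r\<^sup>2 = t" using t R_pos by (auto simp: r_def intro: real_less_lsqrt)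
  let ?e = "\<lambda>y. deriv \<psi> y * w (\<psi> y)"
  let ?f = "\<lambda>p. sqrt (max 0 (lo + t - U p)) * w p"
  have mem: "r * sin \<theta> \<in> {-R<..<R}" "r * sin \<theta> \<in> {-r..r}" for \<theta>
  proof -
    have "\<bar>r * sin \<theta>\<bar> \<le> r * 1" unfolding abs_mult using r by (intro mult_mono) auto
    then show "r * sin \<theta> \<in> {-R<..<R}" "r * sin \<theta> \<in> {-r..r}" using r by auto
  qed
  have memr: "r \<in> {-R<..<R}" "- r \<in> {-R<..<R}" using r by auto
  have cf: "continuous_on A ?f" for A
    using w by (intro continuous_intros continuous_U) (auto intro: continuous_on_subset)
  have "((\<lambda>\<theta>. (deriv \<psi> (r * sin \<theta>) * (r * cos \<theta>)) *\<^sub>R ?f (\<psi> (r * sin \<theta>))) has_integral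
      integral {\<psi> (r * sin (- (pi / 2)))..\<psi> (r * sin (pi / 2))} ?f) half_circle"
  proof (rule has_integral_substitution[OF _ _ _ cf, where g="\<lambda>\<theta>. \<psi> (r * sin \<theta>)" and c="\<psi> (- r)" and d="\<psi> r"])
    show "\<psi> (r * sin (- (pi / 2))) \<le> \<psi> (r * sin (pi / 2))" using r memr by (auto intro!: \<psi>_mono)
    show "(\<lambda>\<theta>. \<psi> (r * sin \<theta>)) ` half_circle \<subseteq> {\<psi> (- r)..\<psi> r}"
      using mem memr by (auto intro!: \<psi>_mono simp del: greaterThanLessThan_iff)
    fix \<theta> :: real
    have "((\<lambda>\<theta>. r * sin \<theta>) has_real_derivative r * cos \<theta>) (at \<theta> within half_circle)"
      by (auto intro!: derivative_eq_intros)
    from DERIV_chain2[OF D\<psi>[OF mem(1)] this]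
    show "((\<lambda>\<theta>. \<psi> (r * sin \<theta>)) has_real_derivative deriv \<psi> (r * sin \<theta>) * (r * cos \<theta>)) (at \<theta> within half_circle)" .
  qed simp
  then have I1: "((\<lambda>\<theta>. (deriv \<psi> (r * sin \<theta>) * (r * cos \<theta>)) *\<^sub>R ?f (\<psi> (r * sin \<theta>))) has_integral
      integral {\<psi> (- r)..\<psi> r} ?f) half_circle" by simp
  have "((\<lambda>\<theta>. t * ((cos \<theta>)\<^sup>2 * ?e (r * sin \<theta>))) has_integral integral {\<psi> (- r)..\<psi> r} ?f) half_circle"
  proof (rule has_integral_eq[OF _ I1])
    fix \<theta> :: real assume \<theta>: "\<theta> \<in> half_circle"
    then have c: "0 \<le> cos \<theta>" by (intro cos_ge_zero) auto
    have "lo + t - U (\<psi> (r * sin \<theta>)) = (r * cos \<theta>)\<^sup>2"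
      unfolding U_\<psi>[OF mem(1)] r(3)[symmetric] power_mult_distrib sin_squared_eq by (simp add: algebra_simps)
    then have "sqrt (max 0 (lo + t - U (\<psi> (r * sin \<theta>)))) = r * cos \<theta>"
      using r c by (simp add: max_def)
    then show "(deriv \<psi> (r * sin \<theta>) * (r * cos \<theta>)) *\<^sub>R ?f (\<psi> (r * sin \<theta>)) = t * ((cos \<theta>)\<^sup>2 * ?e (r * sin \<theta>))"
      by (simp add: r(3)[symmetric] power2_eq_square)
  qed
  then have I2: "t * integral half_circle (\<lambda>\<theta>. (cos \<theta>)\<^sup>2 * ?e (r * sin \<theta>)) = integral {\<psi> (- r)..\<psi> r} ?f"
    by (simp add: integral_unique flip: integral_mult_right)
  have "(?f has_integral integral {\<psi> (- r)..\<psi> r} ?f) {a..a + 1}"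
  proof (rule has_integral_superset_zero)
    show "(?f has_integral integral {\<psi> (- r)..\<psi> r} ?f) {\<psi> (- r)..\<psi> r}"
      by (intro integrable_integral integrable_continuous_real cf)
    show "{\<psi> (- r)..\<psi> r} \<subseteq> {a..a + 1}" using \<psi>_mem[OF memr(1)] \<psi>_mem[OF memr(2)] by auto
    fix x assume x: "x \<in> {a..a + 1}" "x \<notin> {\<psi> (- r)..\<psi> r}"
    have "lo + t \<le> U x"
    proof (cases "x \<in> S")
      case True
      have "r < \<bar>X x\<bar>"
        using x(2) X_less_iff[OF \<psi>_mem[OF memr(1)] True] X_less_iff[OF True \<psi>_mem[OF memr(2)]]
          X_\<psi>[OF memr(1)] X_\<psi>[OF memr(2)] by auto
      then have "r\<^sup>2 \<le> \<bar>X x\<bar>\<^sup>2" using r by (intro power_mono) auto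
      then show ?thesis using X_sq[OF True] r by simp
    next
      case False
      then have "U x = hi" using x U_a1 by (auto simp: hi_def)
      then show ?thesis using t R_sq by simp
    qed
    then show "?f x = 0" by simp
  qed
  then have "J w (lo + t) = integral {\<psi> (- r)..\<psi> r} ?f"
    unfolding J_def by (rule integral_unique)
  also have "\<dots> = t * integral half_circle (\<lambda>\<theta>. (cos \<theta>)\<^sup>2 * ?e (r * sin \<theta>))" using I2 by simp
  also have "integral half_circle (\<lambda>\<theta>. (cos \<theta>)\<^sup>2 * ?e (r * sin \<theta>))
      = integral half_circle (\<lambda>\<theta>. (cos \<theta>)\<^sup>2 * even_part ?e (t * (sin \<theta>)\<^sup>2))"
  proof -
    let ?k = "\<lambda>\<theta>. (cos \<theta>)\<^sup>2 * ?e (r * sin \<theta>)"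
    have "continuous_on half_circle ?k"
    proof (intro continuous_intros)
      have c: "continuous_on half_circle (\<lambda>\<theta>. r * sin \<theta>)" by (intro continuous_intros)
      show "continuous_on half_circle (\<lambda>\<theta>. deriv \<psi> (r * sin \<theta>))"
        by (rule continuous_on_compose2[OF smooth_on_continuous[OF smooth_on_deriv[OF smooth_on_\<psi> open_greaterThanLessThan]] c])
          (rule image_subsetI, rule mem(1))
      have "continuous_on half_circle (\<lambda>\<theta>. \<psi> (r * sin \<theta>))"
        by (rule continuous_on_compose2[OF smooth_on_continuous[OF smooth_on_\<psi>] c]) (rule image_subsetI, rule mem(1))
      then show "continuous_on half_circle (\<lambda>\<theta>. w (\<psi> (r * sin \<theta>)))"
        by (rule continuous_on_compose2[OF w]) simp
    qed
    then have int: "?k integrable_on half_circle" by (rule integrable_continuous_real)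
    have refl: "integral half_circle ?k = integral half_circle (\<lambda>\<theta>. ?k (- \<theta>))"
      using Henstock_Kurzweil_Integration.integral_reflect_real[of "pi / 2" "- (pi / 2)" ?k] by simp
    have int2: "(\<lambda>\<theta>. ?k (- \<theta>)) integrable_on half_circle"
      using Henstock_Kurzweil_Integration.integrable_reflect_real[of ?k "pi / 2" "- (pi / 2)"] int by simp
    have ev: "(?k \<theta> + ?k (- \<theta>)) / 2 = (cos \<theta>)\<^sup>2 * even_part ?e (t * (sin \<theta>)\<^sup>2)" for \<theta>
    proof -
      have sq: "sqrt (t * (sin \<theta>)\<^sup>2) = \<bar>r * sin \<theta>\<bar>" using r by (simp add: real_sqrt_mult r_def abs_mult)
      show ?thesis unfolding even_part_abs[OF sq] by (simp add: distrib_left)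
    qed
    have "integral half_circle (\<lambda>\<theta>. (?k \<theta> + ?k (- \<theta>)) / 2) = integral half_circle ?k"
      using refl integral_add[OF int int2] by simp
    then show ?thesis unfolding ev by simp
  qed
  finally show ?thesis .
qed

end

section \<open>Bounds for arc integrals\<close>

lemma integral_pos_if_continuous:
  fixes f :: "real \<Rightarrow> real"
  assumes "continuous_on {p..q} f" "p < q" "\<And>x. x \<in> {p..q} \<Longrightarrow> 0 \<le> f x" "x0 \<in> {p..q}" "0 < f x0"
  shows "0 < integral {p..q} f"
proof -
  have i: "f integrable_on {p..q}" by (rule integrable_continuous_real[OF assms(1)])
  have "0 \<le> integral {p..q} f" by (rule integral_nonneg[OF i assms(3)])
  moreover have "integral {p..q} f \<noteq> 0"
  proof
    assume "integral {p..q} f = 0"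
    then have "(f has_integral 0) (cbox p q)" using integrable_integral[OF i] by (simp add: cbox_interval)
    then have "f x0 = 0"
      by (rule has_integral_0_cbox_imp_0[rotated 2]) (use assms in \<open>auto simp: cbox_interval\<close>)
    then show False using assms(5) by simp
  qed
  ultimately show ?thesis by linarith
qed

lemma integral_ge_const:
  fixes f :: "real \<Rightarrow> real"
  assumes "f integrable_on {p..q}" "p \<le> q" "\<And>x. x \<in> {p..q} \<Longrightarrow> L \<le> f x"
  shows "L * (q - p) \<le> integral {p..q} f"
proof -
  have "integral {p..q} (\<lambda>x. L) \<le> integral {p..q} f"
    by (rule integral_le[OF integrable_const_ivl assms(1,3)])
  then show ?thesis using assms(2) by (simp add: mult.commute)
qed

lemma continuous_on_if_DERIV_within:
  fixes G G' :: "real \<Rightarrow> real"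
  assumes "\<And>w. w \<in> {0..<T} \<Longrightarrow> (G has_real_derivative G' w) (at w within {0..})"
  shows "continuous_on {0..<T} G"
  unfolding continuous_on_eq_continuous_within
proof
  fix w assume "w \<in> {0..<T}"
  from DERIV_continuous[OF assms[OF this]] show "continuous (at w within {0..<T}) G"
    by (rule continuous_within_subset) auto
qed

lemma arc_abs_le:
  fixes G :: "real \<Rightarrow> real"
  assumes G: "continuous_on {0..<T} G" and t: "t \<in> {0..<T}" and C: "\<And>w. w \<in> {0..<T} \<Longrightarrow> \<bar>G w\<bar> \<le> C"
  shows "\<bar>arc j G t\<bar> \<le> C * pi / 2"
proof -
  let ?f = "\<lambda>\<theta>. sin \<theta> ^ (2 * j) * G (t * (sin \<theta>)\<^sup>2)"
  have C0: "0 \<le> C" using C[OF t] by linarith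
  have i: "(\<lambda>\<theta>. s * ?f \<theta>) integrable_on half_circle" for s
    by (intro integrable_on_mult_right integrable_continuous_real continuous_arc_integrand[OF G _ t] continuous_intros)
  have b: "\<bar>?f \<theta>\<bar> \<le> C" for \<theta>
  proof -
    have "\<bar>sin \<theta>\<bar> ^ (2 * j) \<le> 1" by (intro power_le_one) auto
    then have "\<bar>sin \<theta>\<bar> ^ (2 * j) * \<bar>G (t * (sin \<theta>)\<^sup>2)\<bar> \<le> 1 * C"
      by (intro mult_mono C mult_sin_sq_mem t) auto
    then show ?thesis by (simp add: abs_mult power_abs)
  qed
  have "- C * (pi / 2 - - (pi / 2)) \<le> integral half_circle (\<lambda>\<theta>. s * ?f \<theta>)" if "\<bar>s\<bar> = 1" for s
  proof (rule integral_ge_const[OF i])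
    fix \<theta> :: real
    have "\<bar>s * ?f \<theta>\<bar> \<le> C" using b[of \<theta>] that by (simp add: abs_mult)
    then show "- C \<le> s * ?f \<theta>" by linarith
  qed simp
  from this[of 1] this[of "-1"] show ?thesis by (simp add: arc_def abs_le_iff)
qed

text \<open>If \<open>G1 / G0\<close> and \<open>G0\<close> blow up at \<open>T\<close> at least like \<open>1 / (T - w)\<close> and
  \<open>1 / sqrt (T - w)\<close>, then the difference of the arcs is at least of order \<open>1 / (T - t)\<close>: this
  much comes already from the angles within \<open>sqrt (T - t)\<close> of \<open>pi / 2\<close>.\<close>

lemma arc_steep:
  fixes G0 G1 :: "real \<Rightarrow> real"
  assumes G: "continuous_on {0..<T} G0" "continuous_on {0..<T} G1"
    and t0: "0 < t0" "t0 < T" and pos: "0 < \<alpha>" "0 < \<gamma>" "0 < K"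
    and G0: "\<And>w. w \<in> {t0..<T} \<Longrightarrow> \<gamma> / sqrt (T - w) \<le> G0 w"
    and G1: "\<And>w. w \<in> {t0..<T} \<Longrightarrow> \<alpha> * G0 w / (T - w) \<le> G1 w"
  obtains s where "0 < s" "s < T" "\<And>t. t \<in> {s..<T} \<Longrightarrow> K * arc 0 G0 t + 1 \<le> arc 1 G1 t"
proof -
  \<comment> \<open>Beyond \<open>t1\<close> the factor \<open>\<alpha> / (T - w)\<close> is at
    least \<open>4 * K\<close>, and \<open>t1 \<ge> T / 2\<close> forces
    \<open>(sin \<theta>)\<^sup>2 \<ge> 1 / 2\<close> wherever
    \<open>t * (sin \<theta>)\<^sup>2 \<ge> t1\<close>. Together they make the integrand at least
    \<open>G1 / 4\<close> there.\<close>
  define t1 where "t1 = max (max t0 (T / 2)) (T - \<alpha> / (4 * K))"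
  have t1: "t0 \<le> t1" "T / 2 \<le> t1" "T - \<alpha> / (4 * K) \<le> t1" "t1 < T" "0 < t1"
  proof -
    show "t0 \<le> t1" "T / 2 \<le> t1" "T - \<alpha> / (4 * K) \<le> t1"
      unfolding t1_def by (rule max.coboundedI1[OF max.cobounded1] max.coboundedI1[OF max.cobounded2] max.cobounded2)+
    show "t1 < T" using t0 pos by (simp add: t1_def)
    show "0 < t1" using \<open>t0 \<le> t1\<close> t0 by linarith
  qed
  have G0pos: "0 \<le> G0 w" if "w \<in> {t0..<T}" for w
  proof -
    have "0 \<le> \<gamma> / sqrt (T - w)" using pos that by simp
    then show ?thesis using G0[OF that] by linarith
  qed
  have big: "4 * K * G0 w \<le> G1 w" if w: "w \<in> {t1..<T}" for w
  proof -
    have "(T - w) * (4 * K) \<le> \<alpha> / (4 * K) * (4 * K)" using w t1(3) pos by (intro mult_right_mono) auto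
    then have "(T - w) * (4 * K) \<le> \<alpha>" using pos by simp
    then have "4 * K \<le> \<alpha> / (T - w)" using w by (simp add: field_simps)
    then have "4 * K * G0 w \<le> \<alpha> / (T - w) * G0 w" using G0pos[of w] w t1 by (intro mult_right_mono) auto
    also have "\<dots> \<le> G1 w" using G1[of w] w t1 by simp
    finally show ?thesis .
  qed
  have "compact (G0 ` {0..t1})" "compact (G1 ` {0..t1})"
    using G t1 by (auto intro!: compact_continuous_image elim!: continuous_on_subset)
  then have "bounded (G0 ` {0..t1})" "bounded (G1 ` {0..t1})" by (auto intro: compact_imp_bounded)
  then obtain C0 C1 where C: "\<And>w. w \<in> {0..t1} \<Longrightarrow> \<bar>G0 w\<bar> \<le> C0" "\<And>w. w \<in> {0..t1} \<Longrightarrow> \<bar>G1 w\<bar> \<le> C1"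
    unfolding bounded_real by (auto simp del: atLeastAtMost_iff)
  define B where "B = C1 + K * C0"
  have C01: "0 \<le> C0" "0 \<le> C1" using C(1)[of 0] C(2)[of 0] t1 by auto
  then have B: "0 \<le> B" using pos by (simp add: B_def)
  let ?I = "\<lambda>t \<theta>. sin \<theta> ^ (2 * 1) * G1 (t * (sin \<theta>)\<^sup>2) - K * (sin \<theta> ^ (2 * 0) * G0 (t * (sin \<theta>)\<^sup>2))"
  have I_large: "G1 (t * (sin \<theta>)\<^sup>2) / 4 \<le> ?I t \<theta>" "0 \<le> G1 (t * (sin \<theta>)\<^sup>2)"
    if t: "t \<in> {0..<T}" and w: "t1 \<le> t * (sin \<theta>)\<^sup>2" for t \<theta>
  proof -
    let ?w = "t * (sin \<theta>)\<^sup>2"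
    have wm: "?w \<in> {t1..<T}" using mult_sin_sq_mem[OF t] w by simp
    have G0w: "0 \<le> G0 ?w" using G0pos[of ?w] wm t1 by simp
    then have "0 \<le> 4 * K * G0 ?w" using pos by simp
    then show g: "0 \<le> G1 ?w" using big[OF wm] by linarith
    have "T * (1 / 2) \<le> t * (sin \<theta>)\<^sup>2" using w t1 by simp
    also have "\<dots> \<le> T * (sin \<theta>)\<^sup>2" using t by (intro mult_right_mono) auto
    finally have "1 / 2 \<le> (sin \<theta>)\<^sup>2" using t0 by simp
    then have "1 / 2 * G1 ?w \<le> (sin \<theta>)\<^sup>2 * G1 ?w" using g by (rule mult_right_mono)
    then show "G1 ?w / 4 \<le> ?I t \<theta>" using big[OF wm] by simp
  qed
  have I_lower: "- B \<le> ?I t \<theta>" if t: "t \<in> {0..<T}" for t \<theta>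
  proof (cases "t1 \<le> t * (sin \<theta>)\<^sup>2")
    case True
    then show ?thesis using I_large[OF t True] B by linarith
  next
    case False
    let ?w = "t * (sin \<theta>)\<^sup>2"
    have wm: "?w \<in> {0..t1}" using False t by simp
    have "(sin \<theta>)\<^sup>2 \<le> 1" using sin_cos_squared_add[of \<theta>] zero_le_power2[of "cos \<theta>"] by linarith
    then have "\<bar>(sin \<theta>)\<^sup>2 * G1 ?w\<bar> \<le> 1 * C1"
      unfolding abs_mult using C(2)[OF wm] by (intro mult_mono) auto
    moreover have "K * G0 ?w \<le> K * C0" using C(1)[OF wm] pos by (intro mult_left_mono) auto
    ultimately show ?thesis by (simp add: B_def abs_le_iff)
  qed
  \<comment> \<open>\<open>c / (T - t)\<close> will be the contribution of the angles close to
    \<open>pi / 2\<close>. The number \<open>d\<close> below is so small that these angles stay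
    beyond \<open>t1\<close> and contribute at least \<open>B * pi + 2\<close>: the first summand
    pays for the lower bound \<open>- B\<close> elsewhere, and the 2 becomes 1 through the factor
    1/2 in \<open>arc\<close>.\<close>
  define c where "c = \<alpha> * \<gamma> / (4 * ((1 + T) * sqrt (1 + T)))"
  have c: "0 < c" using pos t0 by (simp add: c_def)
  define d where "d = min (min 1 ((T - t1) / (1 + T))) (c / (B * pi + 2))"
  have Bp: "0 < B * pi + 2" using B by (simp add: add_nonneg_pos)
  have d: "0 < d" "d \<le> 1" "d * (1 + T) \<le> T - t1" "d * (B * pi + 2) \<le> c"
  proof -
    have T: "0 < 1 + T" using t0 by simp
    show "0 < d" using t1 T c Bp by (simp add: d_def)
    show "d \<le> 1" by (simp add: d_def)
    have "d \<le> (T - t1) / (1 + T)" "d \<le> c / (B * pi + 2)" by (simp_all add: d_def)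
    then show "d * (1 + T) \<le> T - t1" "d * (B * pi + 2) \<le> c"
      unfolding pos_le_divide_eq[OF T] pos_le_divide_eq[OF Bp] .
  qed
  have main: "K * arc 0 G0 t + 1 \<le> arc 1 G1 t" if t: "t \<in> {T - d..<T}" for t
  proof -
    define f where "f = sqrt (T - t)"
    have f: "0 < f" "f \<le> 1" "f\<^sup>2 = T - t" using t d by (auto simp: f_def)
    have "d \<le> d * (1 + T)" using d t0 by simp
    then have tm: "t \<in> {0..<T}" using t d(3) t1(5) unfolding atLeastLessThan_iff by linarith
    have f_pi: "f \<le> pi" using f pi_gt3 by linarith
    let ?x = "(1 + T) * (T - t)"
    have x: "0 < ?x" "?x \<le> T - t1"
    proof -
      show "0 < ?x" using t t0 by simp
      have "?x \<le> (1 + T) * d" using t t0 by (intro mult_left_mono) auto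
      then show "?x \<le> T - t1" using d(3) by (simp add: mult.commute)
    qed
    define L where "L = \<alpha> * (\<gamma> / sqrt ?x) / ?x / 4"
    \<comment> \<open>For these angles \<open>\<bar>cos \<theta>\<bar> \<le> f\<close>, hence
      \<open>T - t * (sin \<theta>)\<^sup>2 = (T - t) + t * (cos \<theta>)\<^sup>2\<close> is at
      most \<open>(1 + T) * (T - t)\<close>.\<close>
    have near: "L \<le> ?I t \<theta>" if \<theta>: "\<theta> \<in> {pi / 2 - f..pi / 2}" for \<theta>
    proof -
      let ?w = "t * (sin \<theta>)\<^sup>2"
      have "\<bar>cos \<theta>\<bar> \<le> f"
      proof -
        have "\<bar>sin (pi / 2 - \<theta>)\<bar> \<le> \<bar>pi / 2 - \<theta>\<bar>" by (rule abs_sin_x_le_abs_x)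
        then show ?thesis using \<theta> by (simp add: cos_sin_eq)
      qed
      then have "(cos \<theta>)\<^sup>2 \<le> f\<^sup>2" by (metis abs_ge_zero power2_abs power_mono)
      then have "t * (cos \<theta>)\<^sup>2 \<le> T * (T - t)" using f tm by (intro mult_mono) auto
      then have Tw: "T - ?w \<le> ?x" by (simp add: sin_squared_eq algebra_simps)
      then have w1: "t1 \<le> ?w" using x by linarith
      have wm: "?w \<in> {t0..<T}" using mult_sin_sq_mem[OF tm, of \<theta>] w1 t1 by simp
      have "\<gamma> / sqrt ?x \<le> \<gamma> / sqrt (T - ?w)" using Tw wm x pos by (intro divide_left_mono) auto
      then have g0: "\<gamma> / sqrt ?x \<le> G0 ?w" using G0[OF wm] by linarith
      have "\<alpha> * (\<gamma> / sqrt ?x) / ?x \<le> \<alpha> * G0 ?w / (T - ?w)"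
        using g0 Tw wm x pos G0pos[OF wm] by (intro frac_le mult_left_mono) auto
      also have "\<dots> \<le> G1 ?w" by (rule G1[OF wm])
      finally have "L \<le> G1 ?w / 4" unfolding L_def by (rule divide_right_mono) simp
      then show ?thesis by (rule order_trans[OF _ I_large(1)[OF tm w1]])
    qed
    have int: "?I t integrable_on {p..q}" for p q
      by (intro integrable_continuous_real continuous_on_diff continuous_on_mult_left
          continuous_arc_integrand[OF G(1) _ tm] continuous_arc_integrand[OF G(2) _ tm] continuous_intros)
    have "- B * (pi / 2 - f - - (pi / 2)) \<le> integral {- (pi / 2)..pi / 2 - f} (?I t)"
      by (rule integral_ge_const[OF int]) (use f_pi I_lower[OF tm] in auto)
    moreover have "- B * (pi / 2 - f - - (pi / 2)) \<ge> - B * pi" using B f by (simp add: algebra_simps)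
    moreover have "L * (pi / 2 - (pi / 2 - f)) \<le> integral {pi / 2 - f..pi / 2} (?I t)"
      by (rule integral_ge_const[OF int]) (use f near in auto)
    moreover have "integral {- (pi / 2)..pi / 2 - f} (?I t) + integral {pi / 2 - f..pi / 2} (?I t) = integral half_circle (?I t)"
      by (rule Henstock_Kurzweil_Integration.integral_combine[OF _ _ int]) (use f f_pi in auto)
    moreover have "L * f = c / (T - t)"
    proof -
      have sx: "sqrt ?x = sqrt (1 + T) * f" by (simp add: real_sqrt_mult f_def)
      have ff: "T - t = f * f" using f(3) by (simp add: power2_eq_square)
      have "0 < sqrt (1 + T)" "0 < 1 + T" using t0 by auto
      then show ?thesis unfolding L_def c_def sx unfolding ff using f(1) by (simp add: divide_simps)
    qed
    moreover have "B * pi + 2 \<le> c / (T - t)"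
    proof -
      have "(B * pi + 2) * (T - t) \<le> (B * pi + 2) * d" using t Bp by (intro mult_left_mono) auto
      then have "(B * pi + 2) * (T - t) \<le> c" using d(4) by (simp add: mult.commute)
      then show ?thesis using t by (simp add: field_simps)
    qed
    ultimately have "2 \<le> integral half_circle (?I t)" by simp
    also have "integral half_circle (?I t) = 2 * arc 1 G1 t - K * (2 * arc 0 G0 t)"
    proof -
      have "(?I t has_integral 2 * arc 1 G1 t - K * (2 * arc 0 G0 t)) half_circle"
      proof (intro has_integral_diff has_integral_mult_right)
        show "((\<lambda>\<theta>. sin \<theta> ^ (2 * 1) * G1 (t * (sin \<theta>)\<^sup>2)) has_integral 2 * arc 1 G1 t) half_circle"
          unfolding arc_def by (simp, intro integrable_integral integrable_continuous_real
            continuous_arc_integrand[OF G(2) _ tm] continuous_intros)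
        show "((\<lambda>\<theta>. sin \<theta> ^ (2 * 0) * G0 (t * (sin \<theta>)\<^sup>2)) has_integral 2 * arc 0 G0 t) half_circle"
          unfolding arc_def using integrable_integral[OF integrable_continuous_real[OF
            continuous_arc_integrand[OF G(1) _ tm, where k="\<lambda>\<theta>. sin \<theta> ^ (2 * 0)" and A=half_circle]]] by (simp add: continuous_on_const)
      qed
      then show ?thesis by (rule integral_unique)
    qed
    finally show ?thesis by simp
  qed
  show ?thesis
  proof (rule that[OF _ _ main])
    have "d \<le> d * (1 + T)" using d t0 by simp
    then show "0 < T - d" using d t1 by linarith
    show "T - d < T" using d by simp
  qed
qed

context well
begin

subsection \<open>Action integrals inside the well\<close>

text \<open>The form \<open>w dp\<close> expressed in the Morse coordinate \<open>y\<close>, where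
  \<open>p = \<psi> y\<close>.\<close>

definition density :: "(real \<Rightarrow> real) \<Rightarrow> real \<Rightarrow> real" where
  "density w y = deriv \<psi> y * w (\<psi> y)"

lemma smooth_on_density: "smooth_on UNIV w \<Longrightarrow> smooth_on {-R<..<R} (density w)"
  unfolding density_def[abs_def]
  by (rule smooth_on_mult[OF smooth_on_deriv[OF smooth_on_\<psi> open_greaterThanLessThan] smooth_on_compose[OF _ smooth_on_\<psi>]])
    (assumption, rule UNIV_I)

lemma sqrt_mem: "t \<in> {0..<R\<^sup>2} \<Longrightarrow> sqrt t \<in> {-R<..<R}" "t \<in> {0..<R\<^sup>2} \<Longrightarrow> - sqrt t \<in> {-R<..<R}"
proof -
  have "sqrt t \<in> {-R<..<R} \<and> - sqrt t \<in> {-R<..<R}" if "t \<in> {0..<R\<^sup>2}"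
  proof -
    have "sqrt t < R" "0 \<le> sqrt t" using that R_pos by (auto intro: real_less_lsqrt)
    then show ?thesis using R_pos unfolding greaterThanLessThan_iff by linarith
  qed
  then show "t \<in> {0..<R\<^sup>2} \<Longrightarrow> sqrt t \<in> {-R<..<R}" "t \<in> {0..<R\<^sup>2} \<Longrightarrow> - sqrt t \<in> {-R<..<R}" by blast+
qed

lemma has_derivative_shift_lo:
  assumes F: "(F has_real_derivative D) (at (c - lo) within {0..<R\<^sup>2})" and c: "c \<in> {lo..<hi}"
  shows "((\<lambda>c. F (c - lo)) has_real_derivative D) (at c within {lo..})"
proof -
  have "(\<lambda>c. c - lo) ` {lo..<hi} \<subseteq> {0..<R\<^sup>2}" using R_sq by auto
  then have "(F has_real_derivative D) (at (c - lo) within (\<lambda>c. c - lo) ` {lo..<hi})"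
    by (rule DERIV_subset[OF F])
  moreover have "((\<lambda>c. c - lo) has_real_derivative 1) (at c within {lo..<hi})"
    by (auto intro!: derivative_eq_intros)
  ultimately have "(F \<circ> (\<lambda>c. c - lo) has_real_derivative D * 1) (at c within {lo..<hi})"
    by (rule DERIV_image_chain)
  moreover have "at c within {lo..<hi} = at c within {lo..}"
    by (rule at_within_nhd[of c "{..<hi}"]) (use c in auto)
  ultimately show ?thesis by (simp add: o_def)
qed

lemma J_DERIV:
  assumes w: "smooth_on UNIV w"
  obtains G1 G2 where
    "\<And>t. t \<in> {0..<R\<^sup>2} \<Longrightarrow> (even_part (density w) has_real_derivative G1 t) (at t within {0..})"
    "continuous_on {0..<R\<^sup>2} (even_part (density w))" "continuous_on {0..<R\<^sup>2} G1"
    "\<And>c. c \<in> {lo..<hi} \<Longrightarrow> (J w has_real_derivative arc 0 (even_part (density w)) (c - lo)) (at c within {lo..})"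
    "\<And>c. c \<in> {lo..<hi} \<Longrightarrow> ((\<lambda>c. arc 0 (even_part (density w)) (c - lo)) has_real_derivative arc 1 G1 (c - lo)) (at c within {lo..})"
    "\<And>c. c \<in> {lo..<hi} \<Longrightarrow> ((\<lambda>c. arc 1 G1 (c - lo)) has_real_derivative arc 2 G2 (c - lo)) (at c within {lo..})"
proof -
  let ?G0 = "even_part (density w)"
  obtain G1 G2 where G:
    "\<And>t. t \<in> {0..<R\<^sup>2} \<Longrightarrow> (?G0 has_real_derivative G1 t) (at t within {0..})"
    "\<And>t. t \<in> {0..<R\<^sup>2} \<Longrightarrow> (G1 has_real_derivative G2 t) (at t within {0..})"
    "continuous_on {0..<R\<^sup>2} G1" "continuous_on {0..<R\<^sup>2} G2"
    by (rule even_part_DERIV[OF smooth_on_density[OF w] R_pos]) (rule that)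
  have mem: "c - lo \<in> {0..<R\<^sup>2}" if "c \<in> {lo..<hi}" for c using that R_sq by auto
  have G0: "continuous_on {0..<R\<^sup>2} ?G0"
    by (rule continuous_on_if_DERIV_within[OF G(1)])
  show ?thesis
  proof (rule that[OF G(1) G0 G(3)])
    fix c assume c: "c \<in> {lo..<hi}"
    have "((\<lambda>c. (c - lo) * integral half_circle (\<lambda>\<theta>. (cos \<theta>)\<^sup>2 * ?G0 ((c - lo) * (sin \<theta>)\<^sup>2))) has_real_derivative
        arc 0 ?G0 (c - lo)) (at c within {lo..})"
      by (rule has_derivative_shift_lo[OF arc_primitive_DERIV[OF G(1,3) mem[OF c]] c])
    then show "(J w has_real_derivative arc 0 ?G0 (c - lo)) (at c within {lo..})"
    proof (rule has_field_derivative_transform_within)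
      show "0 < hi - c" "c \<in> {lo..}" using c by auto
      fix x assume x: "x \<in> {lo..}" "dist x c < hi - c"
      have "0 \<le> x - lo" "x - lo < R\<^sup>2" using x R_sq by (auto simp: dist_real_def)
      from J_arc[OF smooth_on_continuous[OF w] this]
      show "(x - lo) * integral half_circle (\<lambda>\<theta>. (cos \<theta>)\<^sup>2 * ?G0 ((x - lo) * (sin \<theta>)\<^sup>2)) = J w x"
        by (simp add: density_def[abs_def])
    qed
    show "((\<lambda>c. arc 0 ?G0 (c - lo)) has_real_derivative arc 1 G1 (c - lo)) (at c within {lo..})"
      unfolding One_nat_def by (rule has_derivative_shift_lo[OF arc_DERIV[OF G(1,3) mem[OF c]] c])
    show "((\<lambda>c. arc 1 G1 (c - lo)) has_real_derivative arc 2 G2 (c - lo)) (at c within {lo..})"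
      unfolding Suc_1[symmetric] by (rule has_derivative_shift_lo[OF arc_DERIV[OF G(2,4) mem[OF c]] c])
  qed
qed

text \<open>With a bound \<open>C\<close> for the second derivative,
  \<open>2 * C * (hi - U) - (deriv U)\<^sup>2\<close> vanishes at the top and has derivative
  \<open>- 2 * deriv U * (C + deriv (deriv U))\<close>. It is therefore monotone on each side of
  \<open>m\<close>, in the direction that makes it nonnegative.\<close>

lemma deriv_U_sq_le:
  obtains B where "0 < B" "\<And>q. a \<le> q \<Longrightarrow> q \<le> a + 1 \<Longrightarrow> (deriv U q)\<^sup>2 \<le> B * (hi - U q)"
proof -
  obtain C where C: "C > 0" "\<And>q. \<bar>deriv (deriv U) q\<bar> \<le> C"
    by (rule periodic_bounded[OF continuous_ddU
          periodic_deriv[OF smooth_on_deriv[OF U(1) open_UNIV] periodic_deriv[OF U]]]) (rule that)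
  let ?F = "\<lambda>q. 2 * C * (hi - U q) - (deriv U q)\<^sup>2"
  have D: "(?F has_real_derivative - 2 * deriv U q * (C + deriv (deriv U) q)) (at q)" for q
    by (rule DERIV_cong[OF DERIV_diff[OF DERIV_cmult[OF DERIV_diff[OF DERIV_const DU]] DERIV_power[OF DDU, of 2]]])
      (simp add: algebra_simps)
  have Cp: "0 \<le> C + deriv (deriv U) q" for q using C(2)[of q] by linarith
  have d1: "deriv U (a + 1) = 0" using periodic_deriv[OF U, of a] crit by simp
  have sgn: "0 \<le> deriv U q" if "m \<le> q" "q \<le> a + 1" for q
    using inc[of q] crit d1 that by (cases "q = m \<or> q = a + 1") auto
  have sgn': "deriv U q \<le> 0" if "a \<le> q" "q \<le> m" for q
    using dec[of q] crit that by (cases "q = m \<or> q = a") auto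
  have "(deriv U q)\<^sup>2 \<le> 2 * C * (hi - U q)" if q: "a \<le> q" "q \<le> a + 1" for q
  proof (cases "m \<le> q")
    case True
    have "?F (a + 1) \<le> ?F q"
    proof (rule DERIV_nonpos_imp_nonincreasing[OF q(2)])
      fix x assume "q \<le> x" "x \<le> a + 1"
      then have "- 2 * deriv U x * (C + deriv (deriv U) x) \<le> 0"
        using sgn[of x] Cp[of x] True by (simp add: mult_nonneg_nonneg)
      then show "\<exists>y. (?F has_real_derivative y) (at x) \<and> y \<le> 0" by (intro exI conjI) (rule D, assumption)
    qed
    then show ?thesis using U_a1 d1 by simp
  next
    case False
    have "?F a \<le> ?F q"
    proof (rule DERIV_nonneg_imp_nondecreasing[OF q(1)])
      fix x assume "a \<le> x" "x \<le> q"
      then have "0 \<le> - 2 * deriv U x * (C + deriv (deriv U) x)"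
        using sgn'[of x] False by (intro mult_nonneg_nonneg[OF _ Cp]) auto
      then show "\<exists>y. (?F has_real_derivative y) (at x) \<and> 0 \<le> y" by (intro exI conjI) (rule D, assumption)
    qed
    then show ?thesis using crit by (simp add: hi_def)
  qed
  then show ?thesis using C(1) by (intro that[of "2 * C"]) auto
qed

end

lemma at_within_Ici_neq_bot:
  fixes c l :: real
  assumes "l \<le> c"
  shows "at c within {l..} \<noteq> bot"
proof -
  have "at c within {c<..} \<le> at c within {l..}" using assms by (intro at_le) auto
  then show ?thesis using trivial_limit_at_right_real[of c] by (metis bot.extremum_uniqueI trivial_limit_def)
qed

lemma DERIV_unique_Ici:
  fixes c l :: real
  assumes "(f has_real_derivative D) (at c within {l..})" "(f has_real_derivative E) (at c within {l..})" "l \<le> c"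
  shows "D = E"
  by (rule has_field_derivative_unique[OF assms(1,2) at_within_Ici_neq_bot[OF assms(3)]])

text \<open>Existence statements such as \<open>J_DERIV\<close> provide derivatives without a
  formula. Where the function is locally constant, their values are recovered from the uniqueness of
  one-sided derivatives.\<close>

lemma DERIV_locally_const_Ici:
  fixes c l :: real
  assumes "(f has_real_derivative D) (at c within {l..})" "l \<le> c" "open T" "c \<in> T"
    and "\<And>x. x \<in> T \<Longrightarrow> l \<le> x \<Longrightarrow> f x = k"
  shows "D = 0"
proof -
  obtain d where d: "d > 0" "ball c d \<subseteq> T" using assms(3,4) openE by blast
  have "((\<lambda>x. k) has_real_derivative 0) (at c within {l..})" by simp
  then have "(f has_real_derivative 0) (at c within {l..})"
    by (rule has_field_derivative_transform_within[OF _ d(1)])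
      (use assms d in \<open>auto simp: dist_commute subset_iff mem_ball\<close>)
  from DERIV_unique_Ici[OF assms(1) this assms(2)] show ?thesis .
qed

lemma smooth_on_Un:
  assumes "open S" "open T" "smooth_on S f" "smooth_on T f"
  shows "smooth_on (S \<union> T) f"
  unfolding smooth_on_def
proof
  fix n show "Ck n (S \<union> T) f"
    using assms(3,4)
  proof (induction n arbitrary: f)
    case 0
    then show ?case using assms(1,2) by (simp add: continuous_on_open_Un smooth_on_continuous)
  next
    case (Suc n)
    then have "Ck n (S \<union> T) (deriv f)" using assms(1,2) by (intro Suc.IH smooth_on_deriv)
    then show ?case
      using smooth_on_DERIV[OF Suc.prems(1)] smooth_on_DERIV[OF Suc.prems(2)] by (intro Ck_SucI) auto
  qed
qed

section \<open>The second derivative of the action near the separatrix\<close>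

context well
begin

lemma dens_one: "density (\<lambda>p. 1) = deriv \<psi>"
  by (simp add: density_def[abs_def])

lemma deriv_deriv_\<psi>:
  assumes y: "y \<in> {-R<..<R}"
  shows "deriv (deriv \<psi>) y * deriv U (\<psi> y) = 2 - deriv (deriv U) (\<psi> y) * (deriv \<psi> y)\<^sup>2"
proof -
  have 1: "(deriv \<psi> has_real_derivative deriv (deriv \<psi>) y) (at y)"
    by (rule smooth_on_DERIV[OF smooth_on_deriv[OF smooth_on_\<psi> open_greaterThanLessThan] y])
  have 2: "((\<lambda>y. deriv U (\<psi> y)) has_real_derivative deriv (deriv U) (\<psi> y) * deriv \<psi> y) (at y)"
    by (rule DERIV_chain2[OF DDU D\<psi>[OF y]])
  have "((\<lambda>y. 2 * y) has_real_derivative 2) (at y)" by (auto intro!: derivative_eq_intros)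
  then have 3: "((\<lambda>y. deriv U (\<psi> y) * deriv \<psi> y) has_real_derivative 2) (at y)"
    by (rule has_field_derivative_transform_within_open[OF _ open_greaterThanLessThan y]) (simp only: deriv_U_\<psi>)
  from DERIV_unique[OF DERIV_mult[OF 2 1] 3] show ?thesis by (simp add: power2_eq_square algebra_simps)
qed

text \<open>Differentiating \<open>U'(\<psi>) \<psi>' = 2 y\<close> gives \<open>\<psi>'' U' = 2 -
  U'' \<psi>'\<^sup>2 \<ge> \<eta> \<psi>'\<^sup>2\<close>. Multiplication by \<open>\<psi>'\<close>
  replaces \<open>U' \<psi>'\<close> by \<open>2 y\<close>, and
  \<open>U'\<^sup>2 \<le> B (R\<^sup>2 - y\<^sup>2)\<close> turns the same identity into a lower
  bound for \<open>\<psi>'\<close>.\<close>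

lemma deriv_deriv_\<psi>_ge:
  assumes y: "y \<in> {-R<..<R}" "y \<noteq> 0" and \<eta>: "0 < \<eta>" "deriv (deriv U) (\<psi> y) \<le> - \<eta>"
    and B: "0 < B" "\<forall>q. a \<le> q \<longrightarrow> q \<le> a + 1 \<longrightarrow> (deriv U q)\<^sup>2 \<le> B * (hi - U q)"
  shows "2 * (\<eta> / B) * deriv \<psi> y / (R\<^sup>2 - y\<^sup>2) \<le> deriv (deriv \<psi>) y / y"
    and "2 * \<bar>y\<bar> / sqrt (B * (R\<^sup>2 - y\<^sup>2)) \<le> deriv \<psi> y"
proof -
  let ?e = "deriv \<psi> y" and ?e' = "deriv (deriv \<psi>) y" and ?u = "deriv U (\<psi> y)"
  have e: "0 < ?e" by (rule deriv_\<psi>_pos[OF y(1)])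
  have ue: "?u * ?e = 2 * y" by (rule deriv_U_\<psi>[OF y(1)])
  have Ty: "0 < R\<^sup>2 - y\<^sup>2"
    using y power_strict_mono[of "\<bar>y\<bar>" R 2] by auto
  have "?u\<^sup>2 \<le> B * (hi - U (\<psi> y))" using \<psi>_mem[OF y(1)] B(2) by simp
  moreover have "hi - U (\<psi> y) = R\<^sup>2 - y\<^sup>2" using U_\<psi>[OF y(1)] R_sq by simp
  ultimately have u2: "?u\<^sup>2 \<le> B * (R\<^sup>2 - y\<^sup>2)" by simp
  have e2: "4 * y\<^sup>2 \<le> B * (R\<^sup>2 - y\<^sup>2) * ?e\<^sup>2"
  proof -
    have "4 * y\<^sup>2 = ?u\<^sup>2 * ?e\<^sup>2" unfolding power_mult_distrib[symmetric] ue by (simp add: power_mult_distrib)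
    also have "\<dots> \<le> B * (R\<^sup>2 - y\<^sup>2) * ?e\<^sup>2" by (intro mult_right_mono u2) simp
    finally show ?thesis .
  qed
  have "\<eta> * ?e\<^sup>2 \<le> - deriv (deriv U) (\<psi> y) * ?e\<^sup>2" using \<eta> by (intro mult_right_mono) auto
  then have "\<eta> * ?e\<^sup>2 \<le> ?e' * ?u" using deriv_deriv_\<psi>[OF y(1)] by linarith
  then have "\<eta> * ?e\<^sup>2 * ?e \<le> ?e' * ?u * ?e" using e by (intro mult_right_mono) auto
  also have "\<dots> = 2 * (?e' * y)" using ue by (simp add: mult.assoc)
  finally have k: "\<eta> * ?e\<^sup>2 * ?e \<le> 2 * (?e' * y)" .
  have "\<eta> * ?e * (4 * y\<^sup>2) \<le> \<eta> * ?e * (B * (R\<^sup>2 - y\<^sup>2) * ?e\<^sup>2)"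
    using e2 \<eta> e by (intro mult_left_mono) auto
  also have "\<dots> = B * (R\<^sup>2 - y\<^sup>2) * (\<eta> * ?e\<^sup>2 * ?e)" by (simp add: algebra_simps)
  also have "\<dots> \<le> B * (R\<^sup>2 - y\<^sup>2) * (2 * (?e' * y))" using k B Ty by (intro mult_left_mono) auto
  finally have "2 * \<eta> * ?e * y\<^sup>2 \<le> (?e' * y) * (B * (R\<^sup>2 - y\<^sup>2))" by (simp add: mult_ac)
  then have "2 * \<eta> * ?e / (B * (R\<^sup>2 - y\<^sup>2)) \<le> (?e' * y) / y\<^sup>2"
    using y(2) B Ty by (simp add: divide_simps)
  moreover have "(?e' * y) / y\<^sup>2 = ?e' / y" using y(2) by (simp add: power2_eq_square)
  moreover have "2 * (\<eta> / B) * ?e / (R\<^sup>2 - y\<^sup>2) = 2 * \<eta> * ?e / (B * (R\<^sup>2 - y\<^sup>2))" by simp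
  ultimately show "2 * (\<eta> / B) * ?e / (R\<^sup>2 - y\<^sup>2) \<le> ?e' / y" by linarith
  have "(2 * \<bar>y\<bar>)\<^sup>2 \<le> (sqrt (B * (R\<^sup>2 - y\<^sup>2)) * ?e)\<^sup>2"
    using e2 B Ty by (simp add: power_mult_distrib)
  then have "2 * \<bar>y\<bar> \<le> sqrt (B * (R\<^sup>2 - y\<^sup>2)) * ?e"
    by (rule power2_le_imp_le) (use B Ty e in auto)
  moreover have "0 < sqrt (B * (R\<^sup>2 - y\<^sup>2))" using B Ty by simp
  ultimately show "2 * \<bar>y\<bar> / sqrt (B * (R\<^sup>2 - y\<^sup>2)) \<le> ?e" by (simp add: divide_le_eq mult.commute)
qed

lemma second_deriv_negative_near_top:
  obtains \<eta> t0 where "0 < \<eta>" "0 < t0" "t0 < R\<^sup>2"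
    "\<And>y. y \<in> {-R<..<R} \<Longrightarrow> t0 \<le> y\<^sup>2 \<Longrightarrow> deriv (deriv U) (\<psi> y) \<le> - \<eta>"
proof -
  define \<eta> where "\<eta> = - deriv (deriv U) a / 2"
  have \<eta>: "0 < \<eta>" using nondeg by (simp add: \<eta>_def)
  have "isCont (deriv (deriv U)) a"
    using continuous_ddU[of UNIV] by (simp add: continuous_on_eq_continuous_at)
  then obtain d where d: "0 < d" "\<And>q. dist q a < d \<Longrightarrow> dist (deriv (deriv U) q) (deriv (deriv U) a) < \<eta>"
    using \<eta> unfolding continuous_at_eps_delta dist_real_def by blast
  have near: "deriv (deriv U) q \<le> - \<eta>" if "\<bar>q - a\<bar> < d" for q
    using d(2)[of q] that by (simp add: dist_real_def \<eta>_def abs_less_iff)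
  have per: "deriv (deriv U) (q + 1) = deriv (deriv U) q" for q
    by (rule periodic_deriv[OF smooth_on_deriv[OF U(1) open_UNIV] periodic_deriv[OF U]])
  have near1: "deriv (deriv U) q \<le> - \<eta>" if "\<bar>q - (a + 1)\<bar> < d" for q
    using near[of "q - 1"] per[of "q - 1"] that by simp
  define e where "e = Min {d / 2, (m - a) / 2, (a + 1 - m) / 2}"
  have e: "0 < e" "e < d" "a + e < m" "m < a + 1 - e" "e \<le> d / 2" "e \<le> (m - a) / 2" "e \<le> (a + 1 - m) / 2"
  proof -
    show le: "e \<le> d / 2" "e \<le> (m - a) / 2" "e \<le> (a + 1 - m) / 2"
      unfolding e_def by (rule Min_le; simp)+
    show "0 < e" using d am by (simp add: e_def)
    show "e < d" using le(1) d by linarith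
    have "2 * e \<le> m - a" "2 * e \<le> a + 1 - m" using le(2,3) by (simp_all add: field_simps)
    then show "a + e < m" "m < a + 1 - e" using am by linarith+
  qed
  \<comment> \<open>By monotonicity on each slope, a point at height at least \<open>t0\<close>
    above the bottom lies within \<open>e\<close> of one of the ends \<open>a\<close> and
    \<open>a + 1\<close>.\<close>
  define t0 where "t0 = max (U (a + e)) (U (a + 1 - e)) - lo"
  have t0: "0 < t0" "t0 < R\<^sup>2"
    using U_greater_lo[of "a + e"] U_less_hi[of "a + e"] U_less_hi[of "a + 1 - e"] e am R_sq
    by (auto simp: t0_def)
  have "deriv (deriv U) (\<psi> y) \<le> - \<eta>" if y: "y \<in> {-R<..<R}" "t0 \<le> y\<^sup>2" for y
  proof (cases "\<psi> y < m")
    case True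
    have "\<psi> y \<le> a + e"
    proof (rule ccontr)
      assume "\<not> \<psi> y \<le> a + e"
      then have "U (\<psi> y) < U (a + e)" using True e by (intro U_strict_antimono) auto
      then show False using U_\<psi>[OF y(1)] y(2) by (auto simp: t0_def)
    qed
    then show ?thesis using \<psi>_mem[OF y(1)] e by (intro near) auto
  next
    case False
    have "a + 1 - e \<le> \<psi> y"
    proof (rule ccontr)
      assume "\<not> a + 1 - e \<le> \<psi> y"
      then have "U (\<psi> y) < U (a + 1 - e)" using False e by (intro U_strict_mono) auto
      then show False using U_\<psi>[OF y(1)] y(2) by (auto simp: t0_def)
    qed
    then show ?thesis using \<psi>_mem[OF y(1)] e by (intro near1) auto
  qed
  with \<eta> t0 show ?thesis by (rule that)
qed

text \<open>At \<open>t\<close> the function \<open>G1\<close> is half the mean of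
  \<open>\<psi>''(y) / y\<close> over \<open>y = sqrt t\<close> and \<open>y = - sqrt t\<close>. The
  pointwise bounds on \<open>\<psi>'\<close> and \<open>\<psi>''\<close> are thus the hypotheses of
  \<open>arc_steep\<close>, with \<open>\<alpha> = \<eta> / B\<close> and
  \<open>\<gamma> = 2 * sqrt t0 / sqrt B\<close>.\<close>

lemma action_steep:
  assumes K: "0 < K"
    and G1: "\<And>t. t \<in> {0..<R\<^sup>2} \<Longrightarrow> (even_part (density (\<lambda>p. 1)) has_real_derivative G1 t) (at t within {0..})"
    and cont: "continuous_on {0..<R\<^sup>2} (even_part (density (\<lambda>p. 1)))" "continuous_on {0..<R\<^sup>2} G1"
  obtains s where "0 < s" "s < R\<^sup>2"
    "\<And>t. t \<in> {s..<R\<^sup>2} \<Longrightarrow> K * arc 0 (even_part (density (\<lambda>p. 1))) t + 1 \<le> arc 1 G1 t"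
proof -
  obtain \<eta> t0 where \<eta>: "0 < \<eta>" and t0: "0 < t0" "t0 < R\<^sup>2"
    and neg: "\<And>y. y \<in> {-R<..<R} \<Longrightarrow> t0 \<le> y\<^sup>2 \<Longrightarrow> deriv (deriv U) (\<psi> y) \<le> - \<eta>"
    by (rule second_deriv_negative_near_top) (rule that)
  obtain B where B: "0 < B" "\<And>q. a \<le> q \<Longrightarrow> q \<le> a + 1 \<Longrightarrow> (deriv U q)\<^sup>2 \<le> B * (hi - U q)"
    by (rule deriv_U_sq_le) (rule that)
  then have B': "\<forall>q. a \<le> q \<longrightarrow> q \<le> a + 1 \<longrightarrow> (deriv U q)\<^sup>2 \<le> B * (hi - U q)" by blast
  let ?G0 = "even_part (density (\<lambda>p. 1))"
  have main: "2 * sqrt t0 / sqrt B / sqrt (R\<^sup>2 - t) \<le> ?G0 t \<and> \<eta> / B * ?G0 t / (R\<^sup>2 - t) \<le> G1 t"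
    if t: "t \<in> {t0..<R\<^sup>2}" for t
  proof -
    have tm: "t \<in> {0..<R\<^sup>2}" "0 < t" using t t0 by auto
    let ?y = "sqrt t"
    note y = sqrt_mem[OF tm(1)]
    have y2: "?y\<^sup>2 = t" "(- ?y)\<^sup>2 = t" using tm by auto
    have y0: "?y \<noteq> 0" "- ?y \<noteq> 0" using tm by auto
    have n: "deriv (deriv U) (\<psi> ?y) \<le> - \<eta>" "deriv (deriv U) (\<psi> (- ?y)) \<le> - \<eta>"
      using neg[OF y(1)] neg[OF y(2)] y2 t by auto
    have d: "(deriv \<psi> has_real_derivative deriv (deriv \<psi>) z) (at z)" if "z \<in> {-R<..<R}" for z
      by (rule smooth_on_DERIV[OF smooth_on_deriv[OF smooth_on_\<psi> open_greaterThanLessThan] that])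
    have s: "(sqrt has_real_derivative inverse ?y / 2) (at t)" by (rule DERIV_real_sqrt[OF tm(2)])
    have "((\<lambda>t. (deriv \<psi> (sqrt t) + deriv \<psi> (- sqrt t)) / 2) has_real_derivative
       (deriv (deriv \<psi>) ?y * (inverse ?y / 2) + deriv (deriv \<psi>) (- ?y) * (- (inverse ?y / 2))) / 2) (at t)"
      by (rule DERIV_cdivide[OF DERIV_add[OF DERIV_chain2[OF d[OF y(1)] s] DERIV_chain2[OF d[OF y(2)] DERIV_minus[OF s]]]])
    then have "(?G0 has_real_derivative
       (deriv (deriv \<psi>) ?y * (inverse ?y / 2) + deriv (deriv \<psi>) (- ?y) * (- (inverse ?y / 2))) / 2) (at t)"
      by (simp add: even_part_def[abs_def] dens_one)
    then have g1: "G1 t = (deriv (deriv \<psi>) ?y * (inverse ?y / 2) + deriv (deriv \<psi>) (- ?y) * (- (inverse ?y / 2))) / 2"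
      using tm by (intro DERIV_unique_Ici[OF G1[OF tm(1)] has_field_derivative_at_within]) auto
    then have g1: "G1 t = (deriv (deriv \<psi>) ?y / ?y + deriv (deriv \<psi>) (- ?y) / (- ?y)) / 4"
      using y0 by (simp add: field_simps)
    have g0: "?G0 t = (deriv \<psi> ?y + deriv \<psi> (- ?y)) / 2" by (simp add: even_part_def dens_one)
    note E1 = deriv_deriv_\<psi>_ge[OF y(1) y0(1) \<eta> n(1) B(1) B'] and E2 = deriv_deriv_\<psi>_ge[OF y(2) y0(2) \<eta> n(2) B(1) B']
    have "\<eta> / B * ?G0 t / (R\<^sup>2 - t)
        = (2 * (\<eta> / B) * deriv \<psi> ?y / (R\<^sup>2 - t) + 2 * (\<eta> / B) * deriv \<psi> (- ?y) / (R\<^sup>2 - t)) / 4"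
    proof -
      have "k * ((x + y) / 2) / D = (2 * k * x / D + 2 * k * y / D) / 4" for k x y D :: real
        by (simp add: add_divide_distrib distrib_left)
      then show ?thesis unfolding g0 .
    qed
    also have "\<dots> \<le> G1 t"
      unfolding g1 by (rule divide_right_mono[OF add_mono[OF E1(1)[unfolded y2] E2(1)[unfolded y2]]]) simp
    finally have 2: "\<eta> / B * ?G0 t / (R\<^sup>2 - t) \<le> G1 t" .
    have "2 * sqrt t0 / sqrt B / sqrt (R\<^sup>2 - t) \<le> 2 * \<bar>?y\<bar> / sqrt (B * (R\<^sup>2 - t))"
      using t tm B by (simp add: real_sqrt_mult divide_right_mono)
    moreover have "2 * \<bar>- ?y\<bar> / sqrt (B * (R\<^sup>2 - t)) = 2 * \<bar>?y\<bar> / sqrt (B * (R\<^sup>2 - t))" by simp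
    ultimately have 1: "2 * sqrt t0 / sqrt B / sqrt (R\<^sup>2 - t) \<le> ?G0 t"
      using add_mono[OF E1(2) E2(2)] unfolding g0 y2 by simp
    from 1 2 show ?thesis by blast
  qed
  have "0 < \<eta> / B" "0 < 2 * sqrt t0 / sqrt B" using \<eta> B t0 by auto
  from arc_steep[OF cont t0 this K] main show ?thesis using that by blast
qed

subsection \<open>Action integrals above the well\<close>

text \<open>Above the top \<open>c - U\<close> is positive on the whole circle, so the action can be
  differentiated directly: each derivative lowers the exponent \<open>r\<close> by one, starting
  from 1/2.\<close>

definition M :: "real \<Rightarrow> (real \<Rightarrow> real) \<Rightarrow> real \<Rightarrow> real" where
  "M r w c = integral {a..a + 1} (\<lambda>p. (c - U p) powr r * w p)"

lemma hi_less_diff_pos: "hi < c \<Longrightarrow> p \<in> {a..a + 1} \<Longrightarrow> 0 < c - U p"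
  using U_le_hi[of p] by simp

lemma continuous_M_integrand:
  assumes "continuous_on {a..a + 1} w" "hi < c"
  shows "continuous_on {a..a + 1} (\<lambda>p. (c - U p) powr r * w p)"
  by (intro continuous_on_mult assms continuous_on_powr continuous_on_diff continuous_on_const continuous_U)
    (use hi_less_diff_pos[OF assms(2)] in fastforce)

lemma M_DERIV:
  assumes w: "continuous_on {a..a + 1} w" and c: "hi < c"
  shows "(M r w has_real_derivative r * M (r - 1) w c) (at c)"
proof -
  have "((\<lambda>c. integral (cbox a (a + 1)) (\<lambda>p. (c - U p) powr r * w p)) has_real_derivative
     integral (cbox a (a + 1)) (\<lambda>p. r * ((c - U p) powr (r - 1) * w p))) (at c within {hi<..})"
  proof (rule leibniz_rule_field_derivative)
    fix x p assume x: "x \<in> {hi<..}" "p \<in> cbox a (a + 1)"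
    then have pos: "0 < x - U p" using hi_less_diff_pos[of x p] by (simp add: cbox_interval)
    have "((\<lambda>x. x - U p) has_real_derivative 1) (at x)" by (auto intro!: derivative_eq_intros)
    from DERIV_chain2[OF has_real_derivative_powr[OF pos, of r] this]
    have "((\<lambda>x. (x - U p) powr r) has_real_derivative r * (x - U p) powr (r - 1) * 1) (at x)" .
    from DERIV_cmult_right[OF this, of "w p"]
    have "((\<lambda>x. (x - U p) powr r * w p) has_real_derivative r * ((x - U p) powr (r - 1) * w p)) (at x)"
      by (simp add: mult_ac)
    then show "((\<lambda>x. (x - U p) powr r * w p) has_real_derivative r * ((x - U p) powr (r - 1) * w p)) (at x within {hi<..})"
      by (rule has_field_derivative_at_within)
  next
    fix x assume "x \<in> {hi<..}"
    then show "(\<lambda>p. (x - U p) powr r * w p) integrable_on cbox a (a + 1)"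
      unfolding cbox_interval by (intro integrable_continuous_real continuous_M_integrand w) simp
  next
    let ?B = "{hi<..} \<times> cbox a (a + 1)"
    have pos: "fst z - U (snd z) \<noteq> 0" if "z \<in> ?B" for z
      using hi_less_diff_pos[of "fst z" "snd z"] that by (auto simp: cbox_interval)
    have cw: "continuous_on ?B (\<lambda>z. w (snd z))"
      by (rule continuous_on_compose2[OF w]) (auto intro!: continuous_intros simp: cbox_interval)
    have cU: "continuous_on ?B (\<lambda>z. U (snd z))"
      by (rule continuous_on_compose2[OF continuous_U[of UNIV]]) (auto intro!: continuous_intros)
    have "continuous_on ?B (\<lambda>z. (fst z - U (snd z)) powr (r - 1))"
      by (intro continuous_on_powr continuous_on_diff continuous_on_fst continuous_on_id continuous_on_const cU ballI pos)
    then have "continuous_on ?B (\<lambda>z. r * ((fst z - U (snd z)) powr (r - 1) * w (snd z)))"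
      by (intro continuous_on_mult continuous_on_const cw)
    then show "continuous_on ?B (\<lambda>(x, p). r * ((x - U p) powr (r - 1) * w p))"
      by (simp add: case_prod_unfold)
  qed (use c in auto)
  then show ?thesis
    using at_within_open[of c "{hi<..}"] c unfolding M_def[abs_def] by (simp add: cbox_interval)
qed

lemma J_eq_M: "hi \<le> c \<Longrightarrow> J w c = M (1 / 2) w c"
  unfolding J_def M_def
  by (intro integral_cong) (use U_le_hi in \<open>fastforce simp: powr_half_sqrt\<close>)

lemma continuous_J_integrand: "continuous_on UNIV w \<Longrightarrow> continuous_on A (\<lambda>p. sqrt (max 0 (c - U p)) * w p)"
  by (intro continuous_intros continuous_U) (auto intro: continuous_on_subset)

lemma J_add: "continuous_on UNIV w \<Longrightarrow> continuous_on UNIV w' \<Longrightarrow> J (\<lambda>p. w p + v * w' p) c = J w c + v * J w' c"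
proof -
  assume w: "continuous_on UNIV w" "continuous_on UNIV w'"
  note i = integrable_integral[OF integrable_continuous_real[OF continuous_J_integrand[OF w(1), of _ c]]]
    integrable_integral[OF integrable_continuous_real[OF continuous_J_integrand[OF w(2), of _ c]]]
  have "((\<lambda>p. sqrt (max 0 (c - U p)) * w p + v * (sqrt (max 0 (c - U p)) * w' p)) has_integral J w c + v * J w' c) {a..a + 1}"
    unfolding J_def by (intro has_integral_add has_integral_mult_right i)
  then have "((\<lambda>p. sqrt (max 0 (c - U p)) * (w p + v * w' p)) has_integral J w c + v * J w' c) {a..a + 1}"
    by (simp add: algebra_simps)
  then show ?thesis unfolding J_def by (rule integral_unique)
qed

lemma M_add:
  "continuous_on {a..a + 1} w \<Longrightarrow> continuous_on {a..a + 1} w' \<Longrightarrow> hi < c \<Longrightarrow>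
    M r (\<lambda>p. w p + v * w' p) c = M r w c + v * M r w' c"
proof -
  assume w: "continuous_on {a..a + 1} w" "continuous_on {a..a + 1} w'" "hi < c"
  note i = integrable_integral[OF integrable_continuous_real[OF continuous_M_integrand[OF w(1,3), of r]]]
    integrable_integral[OF integrable_continuous_real[OF continuous_M_integrand[OF w(2,3), of r]]]
  have "((\<lambda>p. (c - U p) powr r * w p + v * ((c - U p) powr r * w' p)) has_integral M r w c + v * M r w' c) {a..a + 1}"
    unfolding M_def by (intro has_integral_add has_integral_mult_right i)
  then have "((\<lambda>p. (c - U p) powr r * (w p + v * w' p)) has_integral M r w c + v * M r w' c) {a..a + 1}"
    by (simp add: algebra_simps)
  then show ?thesis unfolding M_def by (rule integral_unique)
qed

lemma M_pos:
  assumes "continuous_on {a..a + 1} w" "hi < c" "\<And>p. p \<in> {a..a + 1} \<Longrightarrow> 0 < w p"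
  shows "0 < M r w c"
  unfolding M_def
proof (rule integral_pos_if_continuous[OF continuous_M_integrand[OF assms(1,2)]])
  have pos: "0 < (c - U p) powr r * w p" if "p \<in> {a..a + 1}" for p
    using hi_less_diff_pos[OF assms(2) that] assms(3)[OF that] by simp
  show "0 < (c - U a) powr r * w a" by (rule pos) simp
  show "0 \<le> (c - U p) powr r * w p" if "p \<in> {a..a + 1}" for p using pos[OF that] by simp
qed auto

text \<open>Pointwise \<open>c - hi \<le> c - U p\<close>. With \<open>r = - 1 / 2\<close> this
  bounds the second derivative of an action above its top by the first one, with a constant that
  depends only on the distance of \<open>c\<close> from \<open>hi\<close>.\<close>

lemma M_le:
  assumes w: "continuous_on {a..a + 1} w" "hi < c" "\<And>p. p \<in> {a..a + 1} \<Longrightarrow> 0 < w p"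
  shows "(c - hi) * M (r - 1) w c \<le> M r w c"
proof -
  note i = integrable_continuous_real[OF continuous_M_integrand[OF w(1,2)]]
  have "integral {a..a + 1} (\<lambda>p. (c - hi) * ((c - U p) powr (r - 1) * w p)) \<le> M r w c"
    unfolding M_def
  proof (rule integral_le[OF integrable_on_mult_right[OF i] i])
    fix p assume p: "p \<in> {a..a + 1}"
    note pos = hi_less_diff_pos[OF w(2) p]
    have "(c - hi) * ((c - U p) powr (r - 1) * w p) \<le> (c - U p) * ((c - U p) powr (r - 1) * w p)"
      using U_le_hi[of p] p w(3)[OF p] by (intro mult_right_mono) auto
    also have "\<dots> = (c - U p) powr r * w p" using pos powr_mult_base[of "c - U p" "r - 1"] by simp
    finally show "(c - hi) * ((c - U p) powr (r - 1) * w p) \<le> (c - U p) powr r * w p" .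
  qed
  then show ?thesis unfolding M_def by simp
qed

lemma J_pos:
  assumes w: "continuous_on UNIV w" "lo < c" "\<And>p. p \<in> {a..a + 1} \<Longrightarrow> 0 < w p"
  shows "0 < J w c"
  unfolding J_def
proof (rule integral_pos_if_continuous[OF continuous_J_integrand[OF w(1)]])
  show "m \<in> {a..a + 1}" using am by simp
  then show "0 < sqrt (max 0 (c - U m)) * w m" using w by (simp add: lo_def)
  show "0 \<le> sqrt (max 0 (c - U p)) * w p" if "p \<in> {a..a + 1}" for p
    using w(3)[OF that] by (intro mult_nonneg_nonneg) auto
qed simp

lemma arc_pos:
  assumes G: "continuous_on {0..<T} G" "t \<in> {0..<T}" "\<And>w. w \<in> {0..<T} \<Longrightarrow> 0 < G w"
  shows "0 < arc 0 G t"
proof -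
  have "0 < integral half_circle (\<lambda>\<theta>. 1 * G (t * (sin \<theta>)\<^sup>2))"
    by (rule integral_pos_if_continuous[OF continuous_arc_integrand[OF G(1) _ G(2)], where ?x0.0=0])
      (use G(2) G(3)[of 0] G(3)[OF mult_sin_sq_mem[OF G(2)]] in \<open>auto intro: less_imp_le\<close>)
  then show ?thesis by (simp add: arc_def)
qed

lemma density_add: "density (\<lambda>p. w p + v * w' p) y = density w y + v * density w' y"
  by (simp add: density_def algebra_simps)

lemma even_part_density_add:
  "even_part (density (\<lambda>p. w p + v * w' p)) t = even_part (density w) t + v * even_part (density w') t"
  by (simp add: even_part_def density_add add_divide_distrib distrib_left)

lemma arc_add:
  fixes G G' :: "real \<Rightarrow> real"
  assumes "continuous_on {0..<T} G" "continuous_on {0..<T} G'" "t \<in> {0..<T}"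
  shows "arc 0 (\<lambda>t. G t + v * G' t) t = arc 0 G t + v * arc 0 G' t"
proof -
  have i: "((\<lambda>\<theta>. 1 * G (t * (sin \<theta>)\<^sup>2)) has_integral integral half_circle (\<lambda>\<theta>. 1 * G (t * (sin \<theta>)\<^sup>2))) half_circle"
    "((\<lambda>\<theta>. 1 * G' (t * (sin \<theta>)\<^sup>2)) has_integral integral half_circle (\<lambda>\<theta>. 1 * G' (t * (sin \<theta>)\<^sup>2))) half_circle"
    by (rule integrable_integral, rule integrable_continuous_real,
        rule continuous_arc_integrand[OF assms(1) _ assms(3)] continuous_arc_integrand[OF assms(2) _ assms(3)],
        rule continuous_on_const)+
  from integral_unique[OF has_integral_add[OF i(1) has_integral_mult_right[OF i(2), of v]]]
  show ?thesis by (simp add: arc_def add_divide_distrib)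
qed

lemma even_part_density_pos:
  assumes "\<And>p. 0 < w p" "t \<in> {0..<R\<^sup>2}"
  shows "0 < even_part (density w) t"
  using deriv_\<psi>_pos[OF sqrt_mem(1)[OF assms(2)]] deriv_\<psi>_pos[OF sqrt_mem(2)[OF assms(2)]] assms(1)
  by (simp add: even_part_def density_def add_pos_pos)

end

section \<open>The perturbing field and the variation of the action\<close>

locale well_cutoff = well +
  fixes \<phi> :: "real \<Rightarrow> real" and s1 s2 :: real
  assumes s12: "lo < s1" "s1 < s2" "s2 < hi"
    and \<phi>: "smooth_on UNIV \<phi>" "\<And>w. w \<le> s1 \<Longrightarrow> \<phi> w = 1" "\<And>w. s2 \<le> w \<Longrightarrow> \<phi> w = 0" "\<And>w. 0 \<le> \<phi> w"
begin

text \<open>The direction of the perturbation. In the Morse coordinate it is the identity below the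
  level \<open>s1\<close>, so that there it multiplies the density of the action by a constant.\<close>

definition \<beta>0 :: "real \<Rightarrow> real" where
  "\<beta>0 q = (if q \<in> S then X q * \<phi> (U q) else 0)"

definition \<beta> :: "real \<Rightarrow> real" where
  "\<beta> q = \<beta>0 (q - of_int \<lfloor>q - a\<rfloor>)"

text \<open>\<open>p1\<close> and \<open>p2\<close> are the points at level \<open>s2\<close> on the
  two slopes; \<open>\<beta>0\<close> lives on the arc between them.\<close>

definition r2 where "r2 = sqrt (s2 - lo)"
definition p1 where "p1 = \<psi> (- r2)"
definition p2 where "p2 = \<psi> r2"

lemma r2: "0 < r2" "r2 < R" "r2\<^sup>2 = s2 - lo" "r2 \<in> {-R<..<R}" "- r2 \<in> {-R<..<R}"
proof -
  show 1: "0 < r2" "r2\<^sup>2 = s2 - lo" using s12 by (auto simp: r2_def)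
  show 2: "r2 < R" using s12 by (simp add: r2_def R_def)
  show "r2 \<in> {-R<..<R}" "- r2 \<in> {-R<..<R}" using 1 2 by auto
qed

lemma p12: "a < p1" "p1 < m" "m < p2" "p2 < a + 1" "p1 \<in> S" "p2 \<in> S" "X p1 = - r2" "X p2 = r2"
proof -
  show 1: "p1 \<in> S" "p2 \<in> S" unfolding p1_def p2_def using \<psi>_mem r2 by blast+
  show 2: "X p1 = - r2" "X p2 = r2" unfolding p1_def p2_def using X_\<psi> r2 by blast+
  show "a < p1" "p2 < a + 1" using 1 by auto
  show "p1 < m" "m < p2" using X_sgn(2)[OF 1(1)] X_sgn(1)[OF 1(2)] 2 r2(1) by auto
qed

lemma \<phi>_U_zero: "q \<in> S \<Longrightarrow> q \<notin> {p1<..<p2} \<Longrightarrow> \<phi> (U q) = 0"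
proof -
  assume q: "q \<in> S" "q \<notin> {p1<..<p2}"
  have "r2 \<le> \<bar>X q\<bar>"
    using X_less_iff[OF p12(5) q(1)] X_less_iff[OF q(1) p12(6)] q(2) p12(7,8) by auto
  then have "r2\<^sup>2 \<le> \<bar>X q\<bar>\<^sup>2" using r2 by (intro power_mono) auto
  then have "s2 \<le> U q" using X_sq[OF q(1)] r2 by simp
  then show ?thesis by (rule \<phi>)
qed

lemma \<beta>0_zero: "q \<notin> {p1<..<p2} \<Longrightarrow> \<beta>0 q = 0"
  using \<phi>_U_zero by (simp add: \<beta>0_def)

lemma smooth_on_\<phi>_U: "smooth_on UNIV (\<lambda>q. \<phi> (U q))"
  by (rule smooth_on_compose[OF \<phi>(1) U(1)]) simp

lemma smooth_on_\<beta>0: "smooth_on UNIV \<beta>0"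
proof -
  have "smooth_on S (\<lambda>q. X q * \<phi> (U q))"
    by (intro smooth_on_mult smooth_on_X smooth_on_subset[OF smooth_on_\<phi>_U]) auto
  then have 1: "smooth_on S \<beta>0"
    by (rule smooth_on_cong[OF open_greaterThanLessThan, rotated]) (simp add: \<beta>0_def)
  have 2: "smooth_on (- {p1..p2}) \<beta>0"
    by (rule smooth_on_cong[OF _ _ smooth_on_const[of _ 0]]) (use \<beta>0_zero in auto)
  have "S \<union> - {p1..p2} = UNIV" using p12 by auto
  then show ?thesis using smooth_on_Un[OF _ _ 1 2] by (simp add: open_Compl)
qed

lemma smooth_on_\<beta>: "smooth_on UNIV \<beta>"
  unfolding \<beta>_def[abs_def]
  by (rule smooth_on_periodic_extension[OF smooth_on_\<beta>0, of a p1 p2]) (use p12 \<beta>0_zero in auto)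

lemma \<beta>_periodic: "\<beta> (q + 1) = \<beta> q"
proof -
  have "q + 1 - a = (q - a) + 1" by simp
  then have "\<lfloor>q + 1 - a\<rfloor> = \<lfloor>q - a\<rfloor> + 1" by (simp only: floor_add2 one_add_floor floor_add_int) simp
  then show ?thesis by (simp add: \<beta>_def)
qed

lemma \<beta>_S: "q \<in> S \<Longrightarrow> \<beta> q = X q * \<phi> (U q)"
proof -
  assume q: "q \<in> S"
  then have "\<lfloor>q - a\<rfloor> = 0" by (simp add: floor_eq_iff)
  then show ?thesis using q by (simp add: \<beta>_def \<beta>0_def)
qed

lemma \<beta>_zero: "q \<in> {p2 - 1<..<p1} \<Longrightarrow> \<beta> q = 0"
proof -
  assume q: "q \<in> {p2 - 1<..<p1}"
  show ?thesis
  proof (cases "a \<le> q")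
    case True
    then have "\<lfloor>q - a\<rfloor> = 0" using q p12 by (simp add: floor_eq_iff)
    then show ?thesis using q by (simp add: \<beta>_def \<beta>0_zero)
  next
    case False
    then have "\<lfloor>q - a\<rfloor> = - 1" using q p12 by (simp add: floor_eq_iff)
    then show ?thesis using q by (simp add: \<beta>_def \<beta>0_zero)
  qed
qed

lemma D\<beta>: "(\<beta> has_real_derivative deriv \<beta> q) (at q)"
  by (rule smooth_on_DERIV[OF smooth_on_\<beta>]) simp

lemma continuous_deriv_\<beta>: "continuous_on A (deriv \<beta>)"
  using smooth_on_continuous[OF smooth_on_deriv[OF smooth_on_\<beta> open_UNIV]] continuous_on_subset by blast

lemma deriv_\<beta>_periodic: "deriv \<beta> (q + 1) = deriv \<beta> q"
  by (rule periodic_deriv[OF smooth_on_\<beta> \<beta>_periodic])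

lemma deriv_\<beta>_zero: "p \<in> {a..a + 1} \<Longrightarrow> p \<notin> {p1..p2} \<Longrightarrow> deriv \<beta> p = 0"
proof -
  have z: "deriv \<beta> q = 0" if q: "q \<in> {p2 - 1<..<p1}" for q
  proof -
    have "((\<lambda>x. 0::real) has_real_derivative 0) (at q)" by simp
    then have "(\<beta> has_real_derivative 0) (at q)"
      by (rule has_field_derivative_transform_within_open[OF _ open_greaterThanLessThan q]) (simp only: \<beta>_zero)
    then show ?thesis by (rule DERIV_imp_deriv)
  qed
  assume p: "p \<in> {a..a + 1}" "p \<notin> {p1..p2}"
  show "deriv \<beta> p = 0"
  proof (cases "p < p1")
    case True
    then show ?thesis using p p12 by (intro z) auto
  next
    case False
    then have "deriv \<beta> (p - 1) = 0" using p p12 by (intro z) auto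
    then show ?thesis using deriv_\<beta>_periodic[of "p - 1"] by simp
  qed
qed

text \<open>Integration by parts moves the derivative from \<open>\<beta>\<close> to \<open>U\<close>, and \<open>U' \<beta> \<ge> 0\<close>.\<close>

lemma deriv_\<beta>_integral_sgn:
  assumes c: "hi \<le> c" and r: "r \<noteq> 0"
  shows "0 < M r (deriv \<beta>) c / r"
proof -
  have sub: "{p1..p2} \<subseteq> S" using p12 by auto
  have pos: "0 < c - U p" if "p \<in> {p1..p2}" for p
    using U_less_hi[of p] that sub c by fastforce
  let ?Q = "\<lambda>p. (c - U p) powr (r - 1) * (deriv U p * \<beta> p)"
  let ?P = "\<lambda>p. (c - U p) powr r * deriv \<beta> p"
  have d: "((\<lambda>p. (c - U p) powr r * \<beta> p) has_real_derivative ?P p - r * ?Q p) (at p within {p1..p2})"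
    if p: "p \<in> {p1..p2}" for p
  proof -
    have "((\<lambda>p. c - U p) has_real_derivative - deriv U p) (at p)"
      using DERIV_diff[OF DERIV_const[of c] DU[of p]] by simp
    from DERIV_mult[OF DERIV_chain2[OF has_real_derivative_powr[OF pos[OF p], of r] this] D\<beta>[of p]]
    have "((\<lambda>p. (c - U p) powr r * \<beta> p) has_real_derivative ?P p - r * ?Q p) (at p)"
      by (rule DERIV_cong) (simp add: algebra_simps)
    then show ?thesis by (rule has_field_derivative_at_within)
  qed
  have "X p1 * \<phi> (U p1) = 0" "X p2 * \<phi> (U p2) = 0" using \<phi>_U_zero p12 by auto
  then have ends: "\<beta> p1 = 0" "\<beta> p2 = 0" using p12 \<beta>_S by auto
  have "((\<lambda>p. ?P p - r * ?Q p) has_integral (c - U p2) powr r * \<beta> p2 - (c - U p1) powr r * \<beta> p1) {p1..p2}"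
    by (rule fundamental_theorem_of_calculus) (use p12 d in \<open>auto simp: has_real_derivative_iff_has_vector_derivative\<close>)
  then have z: "((\<lambda>p. ?P p - r * ?Q p) has_integral 0) {p1..p2}" using ends by simp
  have cpow: "continuous_on {p1..p2} (\<lambda>p. (c - U p) powr k)" for k
    by (intro continuous_on_powr continuous_on_diff continuous_on_const continuous_U ballI)
      (use pos in fastforce)
  have c\<beta>: "continuous_on {p1..p2} \<beta>"
    using smooth_on_continuous[OF smooth_on_\<beta>] continuous_on_subset by blast
  have cQ: "continuous_on {p1..p2} ?Q" and cP: "continuous_on {p1..p2} ?P"
    by (intro continuous_on_mult cpow continuous_dU c\<beta> continuous_deriv_\<beta>)+
  note iQ = integrable_integral[OF integrable_continuous_real[OF cQ]]
    and iP = integrable_integral[OF integrable_continuous_real[OF cP]]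
  have "integral {p1..p2} ?P - r * integral {p1..p2} ?Q = 0"
    by (rule has_integral_unique[OF has_integral_diff[OF iP has_integral_mult_right[OF iQ]] z])
  then have eq: "integral {p1..p2} ?P = r * integral {p1..p2} ?Q" by simp
  have "(?P has_integral integral {p1..p2} ?P) {a..a + 1}"
    by (rule has_integral_superset_zero[OF iP]) (use sub deriv_\<beta>_zero in auto)
  then have MP: "M r (deriv \<beta>) c = integral {p1..p2} ?P" unfolding M_def by (rule integral_unique)
  have nn: "deriv U p * \<beta> p = 2 * (X p)\<^sup>2 * deriv X p * \<phi> (U p)" if "p \<in> S" for p
    using deriv_X_eq[OF that] \<beta>_S[OF that] by (simp add: power2_eq_square)
  \<comment> \<open>\<open>\<psi> r1\<close> is the point at level \<open>s1\<close> on the right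
    slope. There the cut-off still equals 1 and \<open>X\<close> is positive, so the nonnegative
    integrand is strictly positive at one point.\<close>
  define r1 where "r1 = sqrt (s1 - lo)"
  have r1: "0 < r1" "r1 < r2" "r1\<^sup>2 = s1 - lo" using s12 by (auto simp: r1_def r2_def)
  then have r1m: "r1 \<in> {-R<..<R}" using r2 by auto
  have p0: "\<psi> r1 \<in> {p1..p2}"
    unfolding p1_def p2_def using r1 r1m r2 by (auto intro!: \<psi>_mono)
  have "0 < integral {p1..p2} ?Q"
  proof (rule integral_pos_if_continuous[OF cQ _ _ p0])
    show "p1 < p2" using p12 by simp
    show "0 \<le> ?Q p" if "p \<in> {p1..p2}" for p
    proof -
      have "p \<in> S" using that sub by blast
      then show ?thesis unfolding nn[OF \<open>p \<in> S\<close>] using deriv_X_pos[of p] \<phi>(4) by (intro mult_nonneg_nonneg) auto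
    qed
    have "U (\<psi> r1) = s1" using U_\<psi>[OF r1m] r1 by simp
    then show "0 < ?Q (\<psi> r1)"
      unfolding nn[OF \<psi>_mem[OF r1m]] using deriv_X_pos[OF \<psi>_mem[OF r1m]] X_\<psi>[OF r1m] r1 pos[OF p0] \<phi>(2)[of s1] s12(1)
      by (intro mult_pos_pos) auto
  qed
  then show ?thesis using r by (simp add: MP eq)
qed

text \<open>The density is the derivative of
  \<open>\<beta> (\<psi> y) = y * \<phi> (lo + y\<^sup>2)\<close>. It is even in \<open>y\<close>,
  and it equals 1 where \<open>\<phi>\<close> is locally 1: this is the reason for taking the Morse
  coordinate as perturbing field.\<close>

lemma density_\<beta>:
  assumes y: "y \<in> {-R<..<R}"
  shows "density (deriv \<beta>) y = \<phi> (lo + y\<^sup>2) + 2 * y\<^sup>2 * deriv \<phi> (lo + y\<^sup>2)"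
proof -
  have 1: "((\<lambda>y. \<beta> (\<psi> y)) has_real_derivative deriv \<beta> (\<psi> y) * deriv \<psi> y) (at y)"
    by (rule DERIV_chain2[OF D\<beta> D\<psi>[OF y]])
  have "((\<lambda>y. lo + y\<^sup>2) has_real_derivative 2 * y) (at y)" by (auto intro!: derivative_eq_intros)
  moreover have "(\<phi> has_real_derivative deriv \<phi> (lo + y\<^sup>2)) (at (lo + y\<^sup>2))"
    by (rule smooth_on_DERIV[OF \<phi>(1)]) simp
  ultimately have "((\<lambda>y. \<phi> (lo + y\<^sup>2)) has_real_derivative deriv \<phi> (lo + y\<^sup>2) * (2 * y)) (at y)"
    by (rule DERIV_chain2[rotated])
  from DERIV_mult[OF DERIV_ident this]
  have "((\<lambda>y. y * \<phi> (lo + y\<^sup>2)) has_real_derivative \<phi> (lo + y\<^sup>2) + 2 * y\<^sup>2 * deriv \<phi> (lo + y\<^sup>2)) (at y)"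
    by (rule DERIV_cong) (simp add: power2_eq_square)
  then have "((\<lambda>y. \<beta> (\<psi> y)) has_real_derivative \<phi> (lo + y\<^sup>2) + 2 * y\<^sup>2 * deriv \<phi> (lo + y\<^sup>2)) (at y)"
    by (rule has_field_derivative_transform_within_open[OF _ open_greaterThanLessThan y])
      (simp only: \<beta>_S[OF \<psi>_mem] X_\<psi> U_\<psi>)
  from DERIV_unique[OF 1 this] show ?thesis by (simp add: density_def mult.commute)
qed

lemma even_part_density_\<beta>:
  assumes t: "t \<in> {0..<R\<^sup>2}"
  shows "even_part (density (deriv \<beta>)) t = \<phi> (lo + t) + 2 * t * deriv \<phi> (lo + t)"
  using density_\<beta>[OF sqrt_mem(1)[OF t]] density_\<beta>[OF sqrt_mem(2)[OF t]] t by (simp add: even_part_def)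

lemma deriv_\<phi>_zero: "w < s1 \<or> s2 < w \<Longrightarrow> deriv \<phi> w = 0"
proof -
  have *: "deriv \<phi> w = 0" if "open T" "w \<in> T" "\<And>x. x \<in> T \<Longrightarrow> \<phi> x = k" for T k
  proof -
    have "((\<lambda>x. k) has_real_derivative 0) (at w)" by simp
    then have "(\<phi> has_real_derivative 0) (at w)"
      by (rule has_field_derivative_transform_within_open[OF _ that(1,2)]) (simp add: that(3))
    then show ?thesis by (rule DERIV_imp_deriv)
  qed
  show "w < s1 \<or> s2 < w \<Longrightarrow> deriv \<phi> w = 0"
    using *[of "{..<s1}" 1] *[of "{s2<..}" 0] \<phi>(2,3) by auto
qed

lemma even_part_density_\<beta>_low: "t \<in> {0..<s1 - lo} \<Longrightarrow> even_part (density (deriv \<beta>)) t = 1"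
  using even_part_density_\<beta>[of t] deriv_\<phi>_zero[of "lo + t"] \<phi>(2)[of "lo + t"] s12 R_sq by simp

lemma even_part_density_\<beta>_high: "t \<in> {s2 - lo<..<R\<^sup>2} \<Longrightarrow> even_part (density (deriv \<beta>)) t = 0"
  using even_part_density_\<beta>[of t] deriv_\<phi>_zero[of "lo + t"] \<phi>(3)[of "lo + t"] s12 by simp

end

section \<open>Actions of the perturbed potentials\<close>

lemma F2_eq_integral_max:
  "F2 V c = integral {0..1} (\<lambda>q. sqrt (max 0 (c - V q)))"
proof -
  have "F2 V c = integral UNIV (\<lambda>q. if q \<in> {q \<in> {0..1}. V q \<le> c} then sqrt (c - V q) else 0)"
    unfolding F2_def by (rule integral_restrict_UNIV[symmetric])
  also have "(\<lambda>q. if q \<in> {q \<in> {0..1}. V q \<le> c} then sqrt (c - V q) else 0)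
      = (\<lambda>q. if q \<in> {0..1} then sqrt (max 0 (c - V q)) else 0)"
    by (auto simp: fun_eq_iff max_def)
  also have "integral UNIV \<dots> = integral {0..1} (\<lambda>q. sqrt (max 0 (c - V q)))"
    by (rule integral_restrict_UNIV)
  finally show ?thesis .
qed

text \<open>What is used about a potential \<open>U\<close> with values in \<open>[lo, hi]\<close>: arbitrarily small
  perturbations \<open>W v\<close> of it have an action \<open>A + v B\<close> that is affine in \<open>v\<close>. The functions
  \<open>Ak\<close>, \<open>Bk\<close> are the derivatives away from \<open>hi\<close>, one-sided at \<open>lo\<close>. The constant \<open>K\<close> will
  bound the quotient of the second and the first derivative of the other action on \<open>[lo, hi]\<close>.\<close>

locale well_curve =
  fixes U :: "real \<Rightarrow> real" and K lo hi s v0 :: real and W :: "real \<Rightarrow> real \<Rightarrow> real"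
    and A A1 A2 A3 B B1 B2 B3 :: "real \<Rightarrow> real"
  assumes s: "lo < s" "s < hi" and v0: "0 < v0"
    and W: "\<And>v. \<bar>v\<bar> \<le> v0 \<Longrightarrow> admissible (W v)" "\<And>v. \<bar>v\<bar> \<le> v0 \<Longrightarrow> min_val (W v) = lo"
      "\<And>v. \<bar>v\<bar> \<le> v0 \<Longrightarrow> max_val (W v) = hi"
    and W_close: "\<And>k e. 0 < e \<Longrightarrow> \<exists>d>0. \<forall>v q. \<bar>v\<bar> \<le> d \<longrightarrow> \<bar>v\<bar> \<le> v0 \<longrightarrow> \<bar>(deriv ^^ k) (W v) q - (deriv ^^ k) U q\<bar> < e"
    and F2_W: "\<And>v c. \<bar>v\<bar> \<le> v0 \<Longrightarrow> F2 (W v) c = A c + v * B c"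
    and DA: "\<And>c. lo \<le> c \<Longrightarrow> c \<noteq> hi \<Longrightarrow> (A has_real_derivative A1 c) (at c within {lo..})"
      "\<And>c. lo \<le> c \<Longrightarrow> c \<noteq> hi \<Longrightarrow> (A1 has_real_derivative A2 c) (at c within {lo..})"
      "\<And>c. lo \<le> c \<Longrightarrow> c \<noteq> hi \<Longrightarrow> (A2 has_real_derivative A3 c) (at c within {lo..})"
    and DB: "\<And>c. lo \<le> c \<Longrightarrow> c \<noteq> hi \<Longrightarrow> (B has_real_derivative B1 c) (at c within {lo..})"
      "\<And>c. lo \<le> c \<Longrightarrow> c \<noteq> hi \<Longrightarrow> (B1 has_real_derivative B2 c) (at c within {lo..})"
      "\<And>c. lo \<le> c \<Longrightarrow> c \<noteq> hi \<Longrightarrow> (B2 has_real_derivative B3 c) (at c within {lo..})"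
    and flat: "\<And>c. lo \<le> c \<Longrightarrow> c \<le> s \<Longrightarrow> B1 c = pi / 2" "\<And>c. lo \<le> c \<Longrightarrow> c \<le> s \<Longrightarrow> B2 c = 0"
      "\<And>c. lo \<le> c \<Longrightarrow> c \<le> s \<Longrightarrow> B3 c = 0"
    and pos1: "\<And>v c. \<bar>v\<bar> \<le> v0 \<Longrightarrow> lo \<le> c \<Longrightarrow> c \<noteq> hi \<Longrightarrow> 0 < A1 c + v * B1 c"
    and steep: "\<And>v c. \<bar>v\<bar> \<le> v0 \<Longrightarrow> s \<le> c \<Longrightarrow> c < hi \<Longrightarrow> K * (A1 c + v * B1 c) < A2 c + v * B2 c"
    and above: "\<And>c. hi \<le> c \<Longrightarrow> 0 < B c" "\<And>c. hi < c \<Longrightarrow> B1 c \<noteq> 0" "\<And>c. hi < c \<Longrightarrow> B2 c \<noteq> 0"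
      "\<And>v c. \<bar>v\<bar> \<le> v0 \<Longrightarrow> hi \<le> c \<Longrightarrow> 0 < A c + v * B c"
      "\<And>v c. \<bar>v\<bar> \<le> v0 \<Longrightarrow> hi < c \<Longrightarrow> A2 c + v * B2 c < 0"
      "\<And>v c. \<bar>v\<bar> \<le> v0 \<Longrightarrow> hi < c \<Longrightarrow> - (A2 c + v * B2 c) * (2 * (c - hi)) \<le> A1 c + v * B1 c"

context well
begin

text \<open>The first three derivatives of \<open>J w\<close>, given by arcs below the top and by
  powers above it; the coefficients 1/2, -1/4, 3/8 come from differentiating the square root. The
  derivative rules exclude \<open>c = hi\<close>.\<close>

definition cur1 :: "(real \<Rightarrow> real) \<Rightarrow> real \<Rightarrow> real" where
  "cur1 w c = (if c < hi then arc 0 (even_part (density w)) (c - lo) else M (- 1 / 2) w c / 2)"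

definition cur2 :: "(real \<Rightarrow> real) \<Rightarrow> (real \<Rightarrow> real) \<Rightarrow> real \<Rightarrow> real" where
  "cur2 G w c = (if c < hi then arc 1 G (c - lo) else - M (- 3 / 2) w c / 4)"

definition cur3 :: "(real \<Rightarrow> real) \<Rightarrow> (real \<Rightarrow> real) \<Rightarrow> real \<Rightarrow> real" where
  "cur3 G w c = (if c < hi then arc 2 G (c - lo) else 3 * M (- 5 / 2) w c / 8)"

lemma cur_DERIV:
  assumes w: "smooth_on UNIV w"
  obtains G1 G2 where
    "\<And>t. t \<in> {0..<R\<^sup>2} \<Longrightarrow> (even_part (density w) has_real_derivative G1 t) (at t within {0..})"
    "continuous_on {0..<R\<^sup>2} (even_part (density w))" "continuous_on {0..<R\<^sup>2} G1"
    "\<And>c. lo \<le> c \<Longrightarrow> c \<noteq> hi \<Longrightarrow> (J w has_real_derivative cur1 w c) (at c within {lo..})"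
    "\<And>c. lo \<le> c \<Longrightarrow> c \<noteq> hi \<Longrightarrow> (cur1 w has_real_derivative cur2 G1 w c) (at c within {lo..})"
    "\<And>c. lo \<le> c \<Longrightarrow> c \<noteq> hi \<Longrightarrow> (cur2 G1 w has_real_derivative cur3 G2 w c) (at c within {lo..})"
proof -
  obtain G1 G2 where G:
    "\<And>t. t \<in> {0..<R\<^sup>2} \<Longrightarrow> (even_part (density w) has_real_derivative G1 t) (at t within {0..})"
    "continuous_on {0..<R\<^sup>2} (even_part (density w))" "continuous_on {0..<R\<^sup>2} G1"
    "\<And>c. c \<in> {lo..<hi} \<Longrightarrow> (J w has_real_derivative arc 0 (even_part (density w)) (c - lo)) (at c within {lo..})"
    "\<And>c. c \<in> {lo..<hi} \<Longrightarrow> ((\<lambda>c. arc 0 (even_part (density w)) (c - lo)) has_real_derivative arc 1 G1 (c - lo)) (at c within {lo..})"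
    "\<And>c. c \<in> {lo..<hi} \<Longrightarrow> ((\<lambda>c. arc 1 G1 (c - lo)) has_real_derivative arc 2 G2 (c - lo)) (at c within {lo..})"
    by (rule J_DERIV[OF w]) (rule that)
  have wc: "continuous_on {a..a + 1} w" using smooth_on_continuous[OF w] continuous_on_subset by blast
  have low: "(f has_real_derivative D) (at c within {lo..})"
    if "lo \<le> c" "c < hi" "(g has_real_derivative D) (at c within {lo..})" "\<And>x. x < hi \<Longrightarrow> g x = f x" for f g D c
    by (rule has_field_derivative_transform_within[OF that(3), of "hi - c"]) (use that in \<open>auto simp: dist_real_def\<close>)
  have high: "(f has_real_derivative D) (at c within {lo..})"
    if "hi < c" "(g has_real_derivative D) (at c)" "\<And>x. hi < x \<Longrightarrow> g x = f x" for f g D c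
    by (rule has_field_derivative_at_within,
        rule has_field_derivative_transform_within_open[OF that(2), of "{hi<..}"]) (use that in auto)
  have e: "1 / 2 - 1 = (- 1 / 2 :: real)" "- 1 / 2 - 1 = (- 3 / 2 :: real)" "- 3 / 2 - 1 = (- 5 / 2 :: real)" by simp_all
  have m1: "(M (1 / 2) w has_real_derivative M (- 1 / 2) w c / 2) (at c)" if "hi < c" for c
    using M_DERIV[OF wc that, of "1 / 2"] unfolding e by (rule DERIV_cong) simp
  have m2: "((\<lambda>c. M (- 1 / 2) w c / 2) has_real_derivative - M (- 3 / 2) w c / 4) (at c)" if "hi < c" for c
    using DERIV_cdivide[OF M_DERIV[OF wc that, of "- 1 / 2"], of 2] unfolding e by (rule DERIV_cong) simp
  have m3: "((\<lambda>c. - M (- 3 / 2) w c / 4) has_real_derivative 3 * M (- 5 / 2) w c / 8) (at c)" if "hi < c" for c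
    using DERIV_cdivide[OF DERIV_minus[OF M_DERIV[OF wc that, of "- 3 / 2"]], of 4] unfolding e by (rule DERIV_cong) simp
  show ?thesis
  proof (rule that[OF G(1-3)])
    fix c assume c: "lo \<le> c" "c \<noteq> hi"
    show "(J w has_real_derivative cur1 w c) (at c within {lo..})"
    proof (cases "c < hi")
      case True
      then show ?thesis using G(4)[of c] c by (simp add: cur1_def)
    next
      case False
      then have h: "hi < c" using c by simp
      show ?thesis by (rule high[OF h]) (use h m1[OF h] J_eq_M in \<open>auto simp: cur1_def\<close>)
    qed
    show "(cur1 w has_real_derivative cur2 G1 w c) (at c within {lo..})"
    proof (cases "c < hi")
      case True
      show ?thesis by (rule low[OF c(1) True]) (use G(5)[of c] c True in \<open>auto simp: cur1_def cur2_def\<close>)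
    next
      case False
      then have h: "hi < c" using c by simp
      show ?thesis by (rule high[OF h]) (use h m2[OF h] in \<open>auto simp: cur1_def cur2_def\<close>)
    qed
    show "(cur2 G1 w has_real_derivative cur3 G2 w c) (at c within {lo..})"
    proof (cases "c < hi")
      case True
      show ?thesis by (rule low[OF c(1) True]) (use G(6)[of c] c True in \<open>auto simp: cur2_def cur3_def\<close>)
    next
      case False
      then have h: "hi < c" using c by simp
      show ?thesis by (rule high[OF h]) (use h m3[OF h] in \<open>auto simp: cur2_def cur3_def\<close>)
    qed
  qed
qed

lemma cur1_pos:
  assumes w: "smooth_on UNIV w" "smooth_on UNIV w'" and pos: "\<And>p. 0 < w p + v * w' p" and c: "lo \<le> c" "c \<noteq> hi"
  shows "0 < cur1 w c + v * cur1 w' c"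
proof (cases "c < hi")
  case True
  have mem: "c - lo \<in> {0..<R\<^sup>2}" using c True R_sq by simp
  have cont: "continuous_on {0..<R\<^sup>2} (even_part (density w))" if "smooth_on UNIV w" for w
    by (rule J_DERIV[OF that])
  have "0 < arc 0 (\<lambda>t. even_part (density w) t + v * even_part (density w') t) (c - lo)"
  proof (rule arc_pos[OF _ mem])
    show "continuous_on {0..<R\<^sup>2} (\<lambda>t. even_part (density w) t + v * even_part (density w') t)"
      by (intro continuous_on_add continuous_on_mult continuous_on_const cont w)
    show "0 < even_part (density w) t + v * even_part (density w') t" if "t \<in> {0..<R\<^sup>2}" for t
      using even_part_density_pos[OF pos that] unfolding even_part_density_add .
  qed
  then show ?thesis using True by (simp add: arc_add[OF cont[OF w(1)] cont[OF w(2)] mem] cur1_def)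
next
  case False
  have wc: "continuous_on {a..a + 1} w" "continuous_on {a..a + 1} w'"
    using smooth_on_continuous w continuous_on_subset by blast+
  have h: "hi < c" using c False by simp
  have "0 < M (- 1 / 2) (\<lambda>p. w p + v * w' p) c"
    by (rule M_pos[OF _ h]) (use pos wc in \<open>auto intro!: continuous_intros\<close>)
  then show ?thesis using False by (simp add: cur1_def M_add[OF wc h])
qed

end

lemma arc_0_const:
  fixes G :: "real \<Rightarrow> real"
  assumes "\<And>w. w \<in> {0..<T} \<Longrightarrow> G w = k" "t \<in> {0..<T}"
  shows "arc 0 G t = k * pi / 2"
  unfolding arc_def using assms(1)[OF mult_sin_sq_mem[OF assms(2)]] by simp

lemma arc_zero:
  fixes G :: "real \<Rightarrow> real"
  assumes "\<And>w. w \<in> {0..<T} \<Longrightarrow> G w = 0" "t \<in> {0..<T}"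
  shows "arc j G t = 0"
  unfolding arc_def using assms(1)[OF mult_sin_sq_mem[OF assms(2)]] by simp

context well_cutoff
begin

text \<open>Meant for the density of \<open>deriv \<beta>\<close> and its derivative, which vanish
  beyond the cut-off. The variation of the action thus has bounded derivatives up to the separatrix,
  and a small multiple of it cannot spoil the steepness of the action.\<close>

lemma bounded_if_zero_high:
  fixes G :: "real \<Rightarrow> real"
  assumes "continuous_on {0..<R\<^sup>2} G" "\<And>t. t \<in> {s2 - lo<..<R\<^sup>2} \<Longrightarrow> G t = 0"
  obtains C where "0 \<le> C" "\<And>t. t \<in> {0..<R\<^sup>2} \<Longrightarrow> \<bar>G t\<bar> \<le> C"
proof -
  have "compact (G ` {0..s2 - lo})"
    by (rule compact_continuous_image[OF continuous_on_subset[OF assms(1)]]) (use s12 R_sq in auto)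
  then have "bounded (G ` {0..s2 - lo})" by (rule compact_imp_bounded)
  then obtain C where C: "\<And>t. t \<in> {0..s2 - lo} \<Longrightarrow> \<bar>G t\<bar> \<le> C"
    unfolding bounded_real by (auto simp del: atLeastAtMost_iff)
  have C0: "0 \<le> C" using C[of 0] s12 by auto
  have "\<bar>G t\<bar> \<le> C" if "t \<in> {0..<R\<^sup>2}" for t
  proof (cases "t \<le> s2 - lo")
    case True
    then show ?thesis using that by (intro C) simp
  next
    case False
    then have "G t = 0" using that by (intro assms(2)) simp
    then show ?thesis using C0 by simp
  qed
  with C0 show ?thesis by (rule that)
qed

end

lemma (in well) ex_well_curve:
  assumes K: "0 < K" and adm: "admissible U" and lohi: "min_val U = lo" "max_val U = hi"
  shows "\<exists>s v0 W A A1 A2 A3 B B1 B2 B3. well_curve U K lo hi s v0 W A A1 A2 A3 B B1 B2 B3"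
proof -
  let ?one = "\<lambda>p::real. 1::real"
  have one: "smooth_on UNIV ?one" by simp
  obtain GA1 GA2 where GA:
    "\<And>t. t \<in> {0..<R\<^sup>2} \<Longrightarrow> (even_part (density ?one) has_real_derivative GA1 t) (at t within {0..})"
    "continuous_on {0..<R\<^sup>2} (even_part (density ?one))" "continuous_on {0..<R\<^sup>2} GA1"
    and DA: "\<And>c. lo \<le> c \<Longrightarrow> c \<noteq> hi \<Longrightarrow> (J ?one has_real_derivative cur1 ?one c) (at c within {lo..})"
    "\<And>c. lo \<le> c \<Longrightarrow> c \<noteq> hi \<Longrightarrow> (cur1 ?one has_real_derivative cur2 GA1 ?one c) (at c within {lo..})"
    "\<And>c. lo \<le> c \<Longrightarrow> c \<noteq> hi \<Longrightarrow> (cur2 GA1 ?one has_real_derivative cur3 GA2 ?one c) (at c within {lo..})"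
    by (rule cur_DERIV[OF one]) (rule that)
  obtain \<sigma> where \<sigma>: "0 < \<sigma>" "\<sigma> < R\<^sup>2"
    "\<And>t. t \<in> {\<sigma>..<R\<^sup>2} \<Longrightarrow> K * arc 0 (even_part (density ?one)) t + 1 \<le> arc 1 GA1 t"
    by (rule action_steep[OF K GA]) (assumption, rule that)
  define s where "s = lo + \<sigma>"
  \<comment> \<open>Both cut-off levels lie strictly above \<open>s\<close>, so the perturbation is
    still flat a little beyond \<open>s\<close>. This gives the vanishing of the third derivative at
    \<open>s\<close> itself.\<close>
  define s1 where "s1 = s + (hi - s) / 3"
  define s2 where "s2 = s + 2 * (hi - s) / 3"
  have s: "lo < s" "s < hi" using \<sigma>(1,2) R_sq by (auto simp: s_def)
  have s12: "s < s1" "lo < s1" "s1 < s2" "s2 < hi"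
  proof -
    show "s < s1" "s1 < s2" "s2 < hi" using s by (simp_all add: s1_def s2_def field_simps)
    then show "lo < s1" using s by simp
  qed
  have ss1: "s < s1" by (rule s12(1))
  obtain \<phi> where \<phi>: "smooth_on UNIV \<phi>" "\<And>w. w \<le> s1 \<Longrightarrow> \<phi> w = 1" "\<And>w. s2 \<le> w \<Longrightarrow> \<phi> w = 0" "\<And>w. 0 \<le> \<phi> w"
    by (rule smooth_cutoff[OF s12(3)]) (rule that)
  interpret well_cutoff U m a \<phi> s1 s2
    by unfold_locales (use s12 \<phi> in auto)
  let ?w = "deriv \<beta>"
  have w: "smooth_on UNIV ?w" by (rule smooth_on_deriv[OF smooth_on_\<beta> open_UNIV])
  obtain GB1 GB2 where GB:
    "\<And>t. t \<in> {0..<R\<^sup>2} \<Longrightarrow> (even_part (density ?w) has_real_derivative GB1 t) (at t within {0..})"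
    "continuous_on {0..<R\<^sup>2} (even_part (density ?w))" "continuous_on {0..<R\<^sup>2} GB1"
    and DB: "\<And>c. lo \<le> c \<Longrightarrow> c \<noteq> hi \<Longrightarrow> (J ?w has_real_derivative cur1 ?w c) (at c within {lo..})"
    "\<And>c. lo \<le> c \<Longrightarrow> c \<noteq> hi \<Longrightarrow> (cur1 ?w has_real_derivative cur2 GB1 ?w c) (at c within {lo..})"
    "\<And>c. lo \<le> c \<Longrightarrow> c \<noteq> hi \<Longrightarrow> (cur2 GB1 ?w has_real_derivative cur3 GB2 ?w c) (at c within {lo..})"
    by (rule cur_DERIV[OF w]) (rule that)
  have GB1_low: "GB1 t = 0" if t: "t \<in> {0..<s1 - lo}" for t
  proof (rule DERIV_locally_const_Ici[OF GB(1), where T="{..<s1 - lo}"])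
    show "t \<in> {0..<R\<^sup>2}" using t s12 R_sq by auto
  qed (use t in \<open>auto intro!: even_part_density_\<beta>_low\<close>)
  have GB1_high: "GB1 t = 0" if t: "t \<in> {s2 - lo<..<R\<^sup>2}" for t
  proof (rule DERIV_locally_const_Ici[OF GB(1), where T="{s2 - lo<..<R\<^sup>2}"])
    show "t \<in> {0..<R\<^sup>2}" "0 \<le> t" using t s12 by auto
  qed (use t in \<open>auto intro!: even_part_density_\<beta>_high\<close>)
  obtain C0 where C0: "0 \<le> C0" "\<And>t. t \<in> {0..<R\<^sup>2} \<Longrightarrow> \<bar>even_part (density ?w) t\<bar> \<le> C0"
    by (rule bounded_if_zero_high[OF GB(2) even_part_density_\<beta>_high]) (assumption, rule that)
  obtain C1 where C1: "0 \<le> C1" "\<And>t. t \<in> {0..<R\<^sup>2} \<Longrightarrow> \<bar>GB1 t\<bar> \<le> C1"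
    by (rule bounded_if_zero_high[OF GB(3) GB1_high]) (assumption, rule that)
  obtain C2 where C2: "0 < C2" "\<And>q. \<bar>deriv \<beta> q\<bar> \<le> C2"
    by (rule periodic_bounded[OF continuous_deriv_\<beta> deriv_\<beta>_periodic]) (rule that)
  \<comment> \<open>\<open>N\<close> exceeds
    \<open>\<bar>K * cur1 ?w c - cur2 GB1 ?w c\<bar>\<close> on \<open>[s, hi)\<close>. With
    \<open>v0 \<le> 1 / N\<close> the perturbation uses up less than the slack 1 left by
    \<open>action_steep\<close>; the other bound on \<open>v0\<close> keeps the Jacobian at least
    1/2.\<close>
  define N where "N = (K * C0 + C1) * pi + 1"
  have N: "0 < N" using K C0(1) C1(1) by (simp add: N_def add_nonneg_pos)
  define v0 where "v0 = min (1 / (2 * C2)) (1 / N)"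
  have v0: "0 < v0" "v0 \<le> 1 / (2 * C2)" "v0 \<le> 1 / N" using C2(1) N by (auto simp: v0_def)
  interpret cs: circle_shift U \<beta> v0
  proof unfold_locales
    fix q
    have "v0 * \<bar>deriv \<beta> q\<bar> \<le> 1 / (2 * C2) * C2" using v0 C2 by (intro mult_mono) auto
    then show "v0 * \<bar>deriv \<beta> q\<bar> \<le> 1 / 2" using C2(1) by simp
  qed (simp_all add: smooth_on_\<beta> \<beta>_periodic v0(1) U)
  have pos: "0 < 1 + v * deriv \<beta> p" if "\<bar>v\<bar> \<le> v0" for v p
    using cs.shift_deriv_ge[OF that, of p] by linarith
  have wc: "continuous_on A ?one" "continuous_on A ?w" for A
    by (auto intro: continuous_deriv_\<beta>)
  have wvc: "continuous_on A (\<lambda>p. 1 + v * deriv \<beta> p)" for v A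
    by (intro continuous_intros continuous_deriv_\<beta>)
  have mem: "c - lo \<in> {0..<s1 - lo}" "c < hi" if "lo \<le> c" "c < s1" for c using that s12 by auto
  have B2_low: "cur2 GB1 ?w c = 0" if "lo \<le> c" "c < s1" for c
    using arc_zero[OF GB1_low mem(1)[OF that]] mem(2)[OF that] by (simp add: cur2_def)
  have "well_curve U K lo hi s v0 cs.W (J ?one) (cur1 ?one) (cur2 GA1 ?one) (cur3 GA2 ?one)
      (J ?w) (cur1 ?w) (cur2 GB1 ?w) (cur3 GB2 ?w)"
  proof
    show "lo < s" "s < hi" "0 < v0" using s v0 by auto
    fix v assume v: "\<bar>v\<bar> \<le> v0"
    show "admissible (cs.W v)" by (rule cs.admissible_W[OF adm v])
    show "min_val (cs.W v) = lo" "max_val (cs.W v) = hi"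
      using cs.min_val_W[OF v] cs.max_val_W[OF v] lohi by auto
  next
    fix k :: nat and e :: real assume "0 < e"
    then obtain d where "d > 0" "\<And>v q. \<bar>v\<bar> \<le> d \<Longrightarrow> \<bar>v\<bar> \<le> v0 \<Longrightarrow> \<bar>(deriv ^^ k) (cs.W v) q - (deriv ^^ k) U q\<bar> < e"
      by (rule cs.W_tendsto) (rule that)
    then show "\<exists>d>0. \<forall>v q. \<bar>v\<bar> \<le> d \<longrightarrow> \<bar>v\<bar> \<le> v0 \<longrightarrow> \<bar>(deriv ^^ k) (cs.W v) q - (deriv ^^ k) U q\<bar> < e"
      by blast
  next
    fix v c assume v: "\<bar>v\<bar> \<le> v0"
    have "continuous_on UNIV (\<lambda>x. sqrt (max 0 (c - x)))" by (intro continuous_intros)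
    from cs.integral_W[OF this v, of a] have "F2 (cs.W v) c = J (\<lambda>p. 1 + v * deriv \<beta> p) c"
      unfolding F2_eq_integral_max J_def .
    then show "F2 (cs.W v) c = J ?one c + v * J ?w c" using J_add[OF wc] by simp
  next
    fix c assume c: "lo \<le> c" "c \<noteq> hi"
    show "(J ?one has_real_derivative cur1 ?one c) (at c within {lo..})" by (rule DA(1)[OF c])
    show "(cur1 ?one has_real_derivative cur2 GA1 ?one c) (at c within {lo..})" by (rule DA(2)[OF c])
    show "(cur2 GA1 ?one has_real_derivative cur3 GA2 ?one c) (at c within {lo..})" by (rule DA(3)[OF c])
    show "(J ?w has_real_derivative cur1 ?w c) (at c within {lo..})" by (rule DB(1)[OF c])
    show "(cur1 ?w has_real_derivative cur2 GB1 ?w c) (at c within {lo..})" by (rule DB(2)[OF c])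
    show "(cur2 GB1 ?w has_real_derivative cur3 GB2 ?w c) (at c within {lo..})" by (rule DB(3)[OF c])
  next
    fix c assume c: "lo \<le> c" "c \<le> s"
    then have c1: "c < s1" using ss1 by simp
    show "cur1 ?w c = pi / 2"
      using arc_0_const[OF even_part_density_\<beta>_low mem(1)[OF c(1) c1]] mem(2)[OF c(1) c1] by (simp add: cur1_def)
    show "cur2 GB1 ?w c = 0" by (rule B2_low[OF c(1) c1])
    show "cur3 GB2 ?w c = 0"
      by (rule DERIV_locally_const_Ici[OF DB(3), where T="{..<s1}"]) (use c c1 s B2_low in auto)
  next
    fix v c assume "\<bar>v\<bar> \<le> v0" "lo \<le> c" "c \<noteq> hi"
    then show "0 < cur1 ?one c + v * cur1 ?w c"
      by (intro cur1_pos[OF one w] pos)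
  next
    fix v c assume v: "\<bar>v\<bar> \<le> v0" and c: "s \<le> c" "c < hi"
    have t: "c - lo \<in> {\<sigma>..<R\<^sup>2}" "c - lo \<in> {0..<R\<^sup>2}" using c s R_sq by (auto simp: s_def)
    have A: "K * cur1 ?one c + 1 \<le> cur2 GA1 ?one c" using \<sigma>(3)[OF t(1)] c by (simp add: cur1_def cur2_def)
    have B: "\<bar>cur1 ?w c\<bar> \<le> C0 * pi / 2" "\<bar>cur2 GB1 ?w c\<bar> \<le> C1 * pi / 2"
      using arc_abs_le[OF GB(2) t(2) C0(2)] arc_abs_le[OF GB(3) t(2) C1(2)] c by (auto simp: cur1_def cur2_def)
    have "\<bar>K * cur1 ?w c - cur2 GB1 ?w c\<bar> \<le> K * \<bar>cur1 ?w c\<bar> + \<bar>cur2 GB1 ?w c\<bar>"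
      using K abs_triangle_ineq4[of "K * cur1 ?w c" "cur2 GB1 ?w c"] by (simp add: abs_mult)
    also have "\<dots> \<le> K * (C0 * pi / 2) + C1 * pi / 2" using B K by (intro add_mono mult_left_mono) auto
    also have "\<dots> < N" 
    proof -
      have "0 \<le> (K * C0 + C1) * pi" using K C0 C1 by simp
      then show ?thesis by (simp add: N_def algebra_simps add_divide_distrib)
    qed
    finally have lt: "\<bar>K * cur1 ?w c - cur2 GB1 ?w c\<bar> < N" .
    have "\<bar>v\<bar> * \<bar>K * cur1 ?w c - cur2 GB1 ?w c\<bar> \<le> 1 / N * \<bar>K * cur1 ?w c - cur2 GB1 ?w c\<bar>"
      using v v0 by (intro mult_right_mono) auto
    also have "\<dots> < 1 / N * N" using lt N by (intro mult_strict_left_mono) auto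
    finally have "\<bar>v * (K * cur1 ?w c - cur2 GB1 ?w c)\<bar> < 1" using N by (simp add: abs_mult)
    then show "K * (cur1 ?one c + v * cur1 ?w c) < cur2 GA1 ?one c + v * cur2 GB1 ?w c"
      using A by (simp add: abs_less_iff algebra_simps)
  next
    fix c assume "hi \<le> c"
    then show "0 < J ?w c" using deriv_\<beta>_integral_sgn[of c "1 / 2"] by (simp add: J_eq_M)
  next
    fix c assume c: "hi < c"
    show "cur1 ?w c \<noteq> 0" using deriv_\<beta>_integral_sgn[of c "- 1 / 2"] c by (auto simp: cur1_def)
    show "cur2 GB1 ?w c \<noteq> 0" using deriv_\<beta>_integral_sgn[of c "- 3 / 2"] c by (auto simp: cur2_def)
  next
    fix v c assume v: "\<bar>v\<bar> \<le> v0" and c: "hi \<le> c"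
    have "0 < J (\<lambda>p. 1 + v * deriv \<beta> p) c"
      by (rule J_pos[OF wvc]) (use c lo_less_hi pos[OF v] in auto)
    then show "0 < J ?one c + v * J ?w c" using J_add[OF wc] by simp
  next
    fix v c assume v: "\<bar>v\<bar> \<le> v0" and c: "hi < c"
    let ?w' = "\<lambda>p. 1 + v * deriv \<beta> p"
    have c1: "cur1 ?one c + v * cur1 ?w c = M (- 1 / 2) ?w' c / 2"
      using c unfolding M_add[OF wc c] by (simp add: cur1_def add_divide_distrib)
    have c2: "cur2 GA1 ?one c + v * cur2 GB1 ?w c = - M (- 3 / 2) ?w' c / 4"
      using c unfolding M_add[OF wc c] by (simp add: cur2_def diff_divide_distrib add_divide_distrib)
    show "cur2 GA1 ?one c + v * cur2 GB1 ?w c < 0"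
      unfolding c2 using M_pos[OF wvc c pos[OF v]] by simp
    have "(c - hi) * M (- 1 / 2 - 1) ?w' c \<le> M (- 1 / 2) ?w' c"
      by (rule M_le[OF wvc c pos[OF v]])
    then show "- (cur2 GA1 ?one c + v * cur2 GB1 ?w c) * (2 * (c - hi)) \<le> cur1 ?one c + v * cur1 ?w c"
      unfolding c1 c2 by (simp add: algebra_simps)
  qed
  then show ?thesis by blast
qed

lemma ex_well_curve:
  assumes "admissible U" "0 < K"
  shows "\<exists>s v0 W A A1 A2 A3 B B1 B2 B3. well_curve U K (min_val U) (max_val U) s v0 W A A1 A2 A3 B B1 B2 B3"
proof -
  obtain m a where w: "well U m a" "U m = min_val U" "U a = max_val U"
    by (rule admissible_imp_well[OF assms(1)]) (rule that)
  then show ?thesis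
    using well.ex_well_curve[OF w(1) assms(2,1)] by (simp add: well.lo_def well.hi_def)
qed

section \<open>Null sets\<close>

lemma summable_inverse_n_ln_sq:
  "summable (\<lambda>i. 1 / (real (Suc i) * (ln (1 + real (Suc i)))\<^sup>2))"
proof -
  \<comment> \<open>Telescoping replaces the integral test: for \<open>n = i + 1\<close> one has
    \<open>1 / (2 * n) \<le> 1 / (n + 1) \<le> ln (n + 1) - ln n\<close>, so the terms are at most
    twice the differences of \<open>1 / ln n\<close>. At \<open>i = 0\<close> the quotient
    \<open>1 / ln 1\<close> is 0 by convention, and the comparison starts at
    \<open>i = 1\<close>.\<close>
  let ?f = "\<lambda>i. 1 / ln (real (Suc i))"
  have "filterlim (\<lambda>i. ln (real (Suc i))) at_top sequentially"
    by (rule filterlim_compose[OF ln_at_top filterlim_compose[OF filterlim_real_sequentially filterlim_Suc]])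
  from tendsto_inverse_0_at_top[OF this] have "?f \<longlonglongrightarrow> 0"
    by (simp only: inverse_eq_divide)
  from sums_summable[OF telescope_sums'[OF this]]
  have "summable (\<lambda>i. 2 * (?f i - ?f (Suc i)))" by (rule summable_mult)
  then show ?thesis
  proof (rule summable_comparison_test'[where N=1])
    fix i :: nat assume i: "1 \<le> i"
    define n where "n = real (Suc i)"
    have n: "2 \<le> n" using i by (simp add: n_def)
    define x y where "x = ln n" and "y = ln (n + 1)"
    have xy: "0 < x" "x \<le> y" using n by (auto simp: x_def y_def)
    have "ln (n / (n + 1)) \<le> n / (n + 1) - 1" using n by (intro ln_le_minus_one) auto
    then have "1 - n / (n + 1) \<le> y - x" using n by (simp add: x_def y_def ln_div)
    moreover have "1 - n / (n + 1) = 1 / (n + 1)" using n by (simp add: field_simps)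
    moreover have "1 / (2 * n) \<le> 1 / (n + 1)" using n by (intro divide_left_mono) auto
    ultimately have d: "1 / (2 * n) \<le> y - x" by linarith
    have "1 / (n * y\<^sup>2) = 2 * (1 / (2 * n) / (y * y))" using n by (simp add: power2_eq_square)
    also have "\<dots> \<le> 2 * ((y - x) / (x * y))"
      using d xy by (intro mult_left_mono frac_le mult_right_mono mult_pos_pos) auto
    also have "\<dots> = 2 * (1 / x - 1 / y)" using xy by (simp add: field_simps)
    finally have "1 / (n * y\<^sup>2) \<le> 2 * (1 / x - 1 / y)" .
    then show "norm (1 / (real (Suc i) * (ln (1 + real (Suc i)))\<^sup>2)) \<le> 2 * (?f i - ?f (Suc i))"
      using n by (simp add: n_def x_def y_def add_ac)
  qed
qed

text \<open>Only the failure for \<open>\<tau> = 2\<close> and the given \<open>\<delta>\<close> is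
  used; the sign of \<open>k2\<close> is moved into the numerator \<open>j\<close>. The bound
  \<open>\<delta> \<le> (ln 2)\<^sup>2\<close> makes the error at most 1, so that each denominator
  admits only finitely many numerators.\<close>

lemma not_typical_approximable:
  assumes "\<not> typical \<alpha>" "0 < \<delta>" "\<delta> \<le> (ln 2)\<^sup>2" "\<bar>\<alpha>\<bar> \<le> real N"
  shows "\<exists>i. \<exists>j\<in>{- int ((N + 1) * Suc i)..int ((N + 1) * Suc i)}.
    \<bar>\<alpha> - of_int j / real (Suc i)\<bar> \<le> \<delta> / real (Suc i) / (real (Suc i) * (ln (1 + real (Suc i)))\<^sup>2)"
proof -
  obtain k1 k2 :: int where k: "k2 \<noteq> 0"
    "\<bar>of_int k1 + \<alpha> * of_int k2\<bar> < \<delta> / (\<bar>of_int k2\<bar> * (ln (1 + \<bar>of_int k2\<bar>)) powr 2)"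
    using assms(1,2) unfolding typical_def by (meson not_le zero_less_numeral)
  define i where "i = nat \<bar>k2\<bar> - 1"
  have i: "real (Suc i) = \<bar>of_int k2\<bar>" "int (Suc i) = \<bar>k2\<bar>" using k(1) by (auto simp: i_def)
  define j where "j = - sgn k2 * k1"
  let ?n = "real (Suc i)"
  have n: "1 \<le> ?n" by simp
  have ln2: "ln 2 \<le> ln (1 + ?n)" using n by simp
  then have L: "(ln 2)\<^sup>2 \<le> (ln (1 + ?n))\<^sup>2" by (intro power_mono) auto
  have ln2p: "0 < ln (2::real)" by simp
  then have Lp: "0 < (ln (1 + ?n))\<^sup>2" "0 < ln (1 + ?n)" using ln2 by (auto simp: zero_less_power)
  have eq: "\<bar>of_int k1 + \<alpha> * of_int k2\<bar> = \<bar>\<alpha> * ?n - of_int j\<bar>"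
    using k(1) unfolding i(1) j_def by (cases "k2 > 0") (auto simp: abs_minus_commute add_ac)
  have "(ln (1 + ?n)) powr 2 = (ln (1 + ?n))\<^sup>2" using Lp by (simp add: powr_numeral)
  then have b: "\<bar>\<alpha> * ?n - of_int j\<bar> < \<delta> / (?n * (ln (1 + ?n))\<^sup>2)"
    using k(2) unfolding eq i(1)[symmetric] by simp
  have "\<alpha> - of_int j / ?n = (\<alpha> * ?n - of_int j) / ?n" by (simp add: field_simps)
  then have "\<bar>\<alpha> - of_int j / ?n\<bar> = \<bar>\<alpha> * ?n - of_int j\<bar> / ?n" by simp
  also have "\<dots> \<le> \<delta> / (?n * (ln (1 + ?n))\<^sup>2) / ?n" using b by (intro divide_right_mono) auto
  finally have 1: "\<bar>\<alpha> - of_int j / ?n\<bar> \<le> \<delta> / ?n / (?n * (ln (1 + ?n))\<^sup>2)" by (simp add: mult_ac)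
  have "1 * (ln (1 + ?n))\<^sup>2 \<le> ?n * (ln (1 + ?n))\<^sup>2" using n by (intro mult_right_mono) auto
  then have "\<delta> \<le> ?n * (ln (1 + ?n))\<^sup>2" using order_trans[OF assms(3) L] by linarith
  then have "\<delta> / (?n * (ln (1 + ?n))\<^sup>2) \<le> 1" using Lp by (simp add: divide_le_eq)
  moreover have "\<bar>\<alpha> * ?n\<bar> \<le> real N * ?n" unfolding abs_mult using assms(4) by (intro mult_mono) auto
  ultimately have "\<bar>of_int j :: real\<bar> \<le> real N * ?n + ?n" using b n by linarith
  then have "\<bar>of_int j :: real\<bar> \<le> of_int (int ((N + 1) * Suc i))" by (simp add: algebra_simps)
  then have "\<bar>j\<bar> \<le> int ((N + 1) * Suc i)" by (metis of_int_abs of_int_le_iff)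
  then show ?thesis using 1 by (intro exI[of _ i] bexI[of _ j]) auto
qed

text \<open>The convergence half of Khinchin's theorem. Since \<open>\<delta>\<close> is arbitrary
  in the definition of typical, the intervals for all denominators together already have small
  measure, and no tail of the series has to be taken.\<close>

lemma negligible_not_typical: "negligible {\<alpha>. \<not> typical \<alpha>}"
proof -
  have "negligible {\<alpha>. \<not> typical \<alpha> \<and> \<bar>\<alpha>\<bar> \<le> real N}" for N
    unfolding negligible_outer_le
  proof (intro allI impI)
    fix e :: real assume e: "0 < e"
    let ?g = "\<lambda>i. 1 / (real (Suc i) * (ln (1 + real (Suc i)))\<^sup>2)"
    \<comment> \<open>For the denominator \<open>n = Suc i\<close> there are at most
      \<open>(2 * (N + 1) + 1) * n\<close> numerators, each with an interval of length
      \<open>2 * \<delta> / n * ?g i\<close>. Summed over \<open>i\<close> this is at most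
      \<open>\<delta> * C\<close>.\<close>
    define C where "C = 2 * (2 * (real N + 1) + 1) * (suminf ?g + 1)"
    have s0: "0 \<le> suminf ?g" by (intro suminf_nonneg summable_inverse_n_ln_sq) auto
    then have C: "0 < C" by (simp add: C_def)
    define \<delta> where "\<delta> = min ((ln 2)\<^sup>2) (e / C)"
    have \<delta>: "0 < \<delta>" "\<delta> \<le> (ln 2)\<^sup>2" "\<delta> * C \<le> e"
    proof -
      show "0 < \<delta>" "\<delta> \<le> (ln 2)\<^sup>2" using e C by (auto simp: \<delta>_def)
      have "\<delta> \<le> e / C" by (simp add: \<delta>_def)
      then show "\<delta> * C \<le> e" using C by (simp add: pos_le_divide_eq)
    qed
    define r where "r i = \<delta> / real (Suc i) * ?g i" for i
    define D where "D i = {- int ((N + 1) * Suc i)..int ((N + 1) * Suc i)}" for i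
    define I where "I i j = {of_int j / real (Suc i) - r i..of_int j / real (Suc i) + r i}" for i and j :: int
    define T where "T i = (\<Union>j\<in>D i. I i j)" for i
    have r0: "0 \<le> r i" for i using \<delta> by (simp add: r_def)
    have mI: "I i j \<in> lmeasurable" "measure lebesgue (I i j) = 2 * r i" for i j
      using r0[of i] by (auto simp: I_def)
    have mT: "T i \<in> lmeasurable" for i
      unfolding T_def by (intro fmeasurable.finite_UN mI) (simp add: D_def)
    have "measure lebesgue (T i) \<le> (\<Sum>j\<in>D i. measure lebesgue (I i j))" for i
      unfolding T_def by (intro measure_UNION_le) (auto simp: D_def I_def)
    moreover have "(\<Sum>j\<in>D i. measure lebesgue (I i j)) \<le> \<delta> * (2 * (2 * (real N + 1) + 1)) * ?g i" for i
    proof -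
      have "real (card (D i)) = 2 * ((real N + 1) * real (Suc i)) + 1"
        by (simp add: D_def algebra_simps)
      also have "\<dots> \<le> (2 * (real N + 1) + 1) * real (Suc i)" by (simp add: algebra_simps)
      finally have "real (card (D i)) * (2 * r i) \<le> (2 * (real N + 1) + 1) * real (Suc i) * (2 * r i)"
        using r0[of i] by (intro mult_right_mono) auto
      also have "\<dots> = \<delta> * (2 * (2 * (real N + 1) + 1)) * ?g i" by (simp add: r_def)
      finally show ?thesis by (simp add: mI)
    qed
    ultimately have T: "measure lebesgue (T i) \<le> \<delta> * (2 * (2 * (real N + 1) + 1)) * ?g i" for i
      by (meson order_trans)
    have fin: "measure lebesgue (\<Union>i\<in>F. T i) \<le> e" if "finite F" for F
    proof -
      have "measure lebesgue (\<Union>i\<in>F. T i) \<le> (\<Sum>i\<in>F. measure lebesgue (T i))"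
        by (intro measure_UNION_le that fmeasurableD mT)
      also have "\<dots> \<le> (\<Sum>i\<in>F. \<delta> * (2 * (2 * (real N + 1) + 1)) * ?g i)" by (intro sum_mono T)
      also have "\<dots> = \<delta> * (2 * (2 * (real N + 1) + 1)) * sum ?g F" by (rule sum_distrib_left[symmetric])
      also have "\<dots> \<le> \<delta> * (2 * (2 * (real N + 1) + 1)) * (suminf ?g + 1)"
      proof (rule mult_left_mono)
        have "sum ?g F \<le> suminf ?g" by (rule sum_le_suminf[OF summable_inverse_n_ln_sq that]) auto
        then show "sum ?g F \<le> suminf ?g + 1" by simp
      qed (use \<delta> in simp)
      also have "\<dots> = \<delta> * C" by (simp add: C_def)
      finally show ?thesis using \<delta> by simp
    qed
    show "\<exists>T. {\<alpha>. \<not> typical \<alpha> \<and> \<bar>\<alpha>\<bar> \<le> real N} \<subseteq> T \<and> T \<in> lmeasurable \<and> measure lebesgue T \<le> e"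
    proof (intro exI[of _ "\<Union>i. T i"] conjI)
      show "(\<Union>i. T i) \<in> lmeasurable" by (rule fmeasurable_UN_bound[OF _ mT]) (use fin in auto)
      show "measure lebesgue (\<Union>i. T i) \<le> e" by (rule measure_UN_bound[OF _ mT]) (use fin in auto)
      show "{\<alpha>. \<not> typical \<alpha> \<and> \<bar>\<alpha>\<bar> \<le> real N} \<subseteq> (\<Union>i. T i)"
      proof
        fix \<alpha> assume "\<alpha> \<in> {\<alpha>. \<not> typical \<alpha> \<and> \<bar>\<alpha>\<bar> \<le> real N}"
        then obtain i j where "j \<in> D i" "\<bar>\<alpha> - of_int j / real (Suc i)\<bar> \<le> r i"
          using not_typical_approximable[OF _ \<delta>(1,2), of \<alpha> N] unfolding D_def r_def by auto
        then have "\<alpha> \<in> I i j" "j \<in> D i" by (auto simp: I_def abs_le_iff)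
        then show "\<alpha> \<in> (\<Union>i. T i)" by (auto simp: T_def)
      qed
    qed
  qed
  then have "negligible (\<Union>N. {\<alpha>. \<not> typical \<alpha> \<and> \<bar>\<alpha>\<bar> \<le> real N})" by (rule negligible_Union_nat)
  moreover have "{\<alpha>. \<not> typical \<alpha>} \<subseteq> (\<Union>N. {\<alpha>. \<not> typical \<alpha> \<and> \<bar>\<alpha>\<bar> \<le> real N})"
    using real_arch_simple by blast
  ultimately show ?thesis by (rule negligible_subset)
qed

section \<open>Exceptional parameters as images of null sets\<close>

lemma negligible_inverse_image:
  assumes "negligible N"
  shows "negligible {y::real. y \<noteq> 0 \<and> inverse y \<in> N}"
proof -
  have "inverse differentiable_on (N - {0})"
    by (auto simp: differentiable_on_def intro!: derivative_intros)
  moreover have "negligible (N - {0})" using assms by (rule negligible_subset) auto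
  ultimately have "negligible (inverse ` (N - {0}))"
    by (intro negligible_differentiable_image_negligible) auto
  moreover have "{y. y \<noteq> 0 \<and> inverse y \<in> N} \<subseteq> inverse ` (N - {0})"
    by (auto intro!: image_eqI[of _ inverse "inverse _"])
  ultimately show ?thesis by (rule negligible_subset)
qed

text \<open>A Lebesgue null set is enlarged to a Borel null set, for which the product formula gives
  \<open>0 * \<infinity> = 0\<close>.\<close>

lemma negligible_Times_left:
  fixes N :: "real set"
  assumes "negligible N"
  shows "negligible (N \<times> (UNIV :: real set))"
proof -
  have "N \<in> null_sets lebesgue" using assms by (simp add: negligible_iff_null_sets)
  then obtain N' where N': "N' \<in> null_sets lborel" "N \<subseteq> N'"
    by (auto simp: null_sets_completion_iff2)
  have "emeasure (lborel \<Otimes>\<^sub>M lborel) (N' \<times> (UNIV :: real set)) = emeasure lborel N' * emeasure lborel (UNIV :: real set)"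
    using N' by (intro lborel.emeasure_pair_measure_Times) auto
  also have "\<dots> = 0" using N' by (simp add: null_setsD1)
  finally have "N' \<times> UNIV \<in> null_sets (lborel \<Otimes>\<^sub>M lborel :: (real \<times> real) measure)"
    using N' by (intro null_setsI) auto
  then have "N' \<times> UNIV \<in> null_sets (lborel :: (real \<times> real) measure)" by (simp only: lborel_prod)
  then have "negligible (N' \<times> (UNIV :: real set))"
    by (simp add: negligible_iff_null_sets null_sets_completionI)
  then show ?thesis by (rule negligible_subset) (use N' in auto)
qed

lemma differentiable_on_snd:
  fixes f :: "real \<Rightarrow> real"
  assumes "f differentiable_on J"
  shows "(\<lambda>z. f (snd z)) differentiable_on (N \<times> J)"
proof (rule differentiable_on_compose[of snd])
  show "snd differentiable_on (N \<times> J)" by (intro bounded_linear_imp_differentiable_on bounded_linear_snd)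
  show "f differentiable_on (snd ` (N \<times> J))" using assms by (rule differentiable_on_subset) auto
qed

lemma differentiable_on_fst': "(\<lambda>z. fst z :: real) differentiable_on A"
  and differentiable_on_snd': "(\<lambda>z. snd z :: real) differentiable_on A"
  by (intro bounded_linear_imp_differentiable_on bounded_linear_fst bounded_linear_snd)+

lemma differentiable_on_Pair:
  fixes f g :: "real \<times> real \<Rightarrow> real"
  shows "f differentiable_on A \<Longrightarrow> g differentiable_on A \<Longrightarrow> (\<lambda>z. (f z, g z)) differentiable_on A"
  unfolding differentiable_on_def differentiable_def by (blast intro: has_derivative_Pair)

lemma differentiable_on_div:
  fixes f g :: "real \<times> real \<Rightarrow> real"
  assumes "f differentiable_on A" "g differentiable_on A" "\<And>z. z \<in> A \<Longrightarrow> g z \<noteq> 0"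
  shows "(\<lambda>z. f z / g z) differentiable_on A"
  using assms unfolding differentiable_on_def by (auto intro!: derivative_intros)

text \<open>As \<open>q \<noteq> 0\<close>, the equation can be solved for \<open>v\<close>, and the
  parameters are contained in the image of \<open>N \<times> UNIV\<close> under a differentiable map
  of \<open>(y, u)\<close>. It serves the quotients at the four critical values.\<close>

lemma negligible_affine_solutions:
  fixes p q r t :: real
  assumes N: "negligible N" and q: "q \<noteq> 0"
  shows "negligible {(u, v). \<exists>y\<in>N. p + v * q = y * (r + u * t)}"
proof -
  let ?f = "\<lambda>z. (snd z, (fst z * (r + snd z * t) - p) / q)"
  have "?f differentiable_on (N \<times> UNIV)"
    by (intro differentiable_on_Pair differentiable_on_div differentiable_on_diff differentiable_on_mult
        differentiable_on_add differentiable_on_fst' differentiable_on_snd' differentiable_on_const) (use q in auto)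
  then have "negligible (?f ` (N \<times> UNIV))"
    by (intro negligible_differentiable_image_negligible negligible_Times_left N) auto
  moreover have "{(u, v). \<exists>y\<in>N. p + v * q = y * (r + u * t)} \<subseteq> ?f ` (N \<times> UNIV)"
  proof clarify
    fix u v y assume y: "y \<in> N" "p + v * q = y * (r + u * t)"
    have "v = (y * (r + u * t) - p) / q" using q unfolding y(2)[symmetric] by simp
    then show "(u, v) \<in> ?f ` (N \<times> UNIV)" using y(1) by (intro image_eqI[of _ _ "(y, u)"]) auto
  qed
  ultimately show ?thesis by (rule negligible_subset)
qed

text \<open>The two equations determine \<open>u\<close> and then \<open>v\<close> from the ratio \<open>y\<close> and the parameter \<open>c\<close>.\<close>

lemma negligible_slope_at_zero:
  fixes A1 A2 P1 P2 Q1 Q2 :: "real \<Rightarrow> real"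
  assumes N: "negligible N"
    and d: "A1 differentiable_on J" "A2 differentiable_on J" "P1 differentiable_on J" "P2 differentiable_on J"
      "Q1 differentiable_on J" "Q2 differentiable_on J"
    and b: "b \<noteq> 0" and Q2: "\<And>c. c \<in> J \<Longrightarrow> Q2 c \<noteq> 0"
  shows "negligible {(u, v). \<exists>c\<in>J. \<exists>y\<in>N. y \<noteq> 0 \<and> A2 c + y * (P2 c + u * Q2 c) = 0 \<and> A1 c + v * b = y * (P1 c + u * Q1 c)}"
proof -
  let ?u = "\<lambda>z. (- A2 (snd z) / fst z - P2 (snd z)) / Q2 (snd z)"
  let ?f = "\<lambda>z. (?u z, (fst z * (P1 (snd z) + ?u z * Q1 (snd z)) - A1 (snd z)) / b)"
  let ?D = "(N - {0}) \<times> J"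
  have u: "?u differentiable_on ?D"
    by (intro differentiable_on_div differentiable_on_diff differentiable_on_minus differentiable_on_snd d differentiable_on_fst')
      (use Q2 in auto)
  have "?f differentiable_on ?D"
    by (intro differentiable_on_Pair u differentiable_on_div[of _ _ "\<lambda>z. b"] differentiable_on_diff differentiable_on_mult
        differentiable_on_add differentiable_on_fst' differentiable_on_snd d differentiable_on_const) (use b in auto)
  moreover have "negligible ?D"
    by (rule negligible_subset[OF negligible_Times_left[OF N]]) auto
  ultimately have "negligible (?f ` ?D)"
    by (intro negligible_differentiable_image_negligible) auto
  moreover have "{(u, v). \<exists>c\<in>J. \<exists>y\<in>N. y \<noteq> 0 \<and> A2 c + y * (P2 c + u * Q2 c) = 0 \<and> A1 c + v * b = y * (P1 c + u * Q1 c)} \<subseteq> ?f ` ?D"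
  proof clarify
    fix u v c y assume y: "c \<in> J" "y \<in> N" "y \<noteq> 0" "A2 c + y * (P2 c + u * Q2 c) = 0" "A1 c + v * b = y * (P1 c + u * Q1 c)"
    have "u = (- A2 c / y - P2 c) / Q2 c"
    proof -
      have "- A2 c = y * (P2 c + u * Q2 c)" using y(4) by linarith
      then show ?thesis using y(3) Q2[OF y(1)] by simp
    qed
    moreover have "v = (y * (P1 c + u * Q1 c) - A1 c) / b" using b unfolding y(5)[symmetric] by simp
    ultimately show "(u, v) \<in> ?f ` ?D" using y by (intro image_eqI[of _ _ "(y, c)"]) auto
  qed
  ultimately show ?thesis by (rule negligible_subset)
qed

text \<open>The derivative of \<open>(u, c) \<mapsto> (u, f (u, c))\<close> annihilates
  \<open>(0, 1)\<close> and is singular on all of \<open>S\<close>. Source and target have equal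
  dimension, so Sard's theorem needs no more than differentiability. The passage to
  \<open>real^2\<close> gives access to the rank of a matrix, in terms of which
  \<open>baby_Sard\<close> is stated.\<close>

lemma negligible_critical_graph:
  fixes f :: "real \<times> real \<Rightarrow> real"
  assumes f: "\<And>z. z \<in> S \<Longrightarrow> (f has_derivative f' z) (at z within S)" and z: "\<And>z. z \<in> S \<Longrightarrow> f' z (0, 1) = 0"
  shows "negligible ((\<lambda>z. (fst z, f z)) ` S)"
proof -
  let ?to = "\<lambda>z::real \<times> real. (vector [fst z, snd z] :: real^2)" and ?fr = "\<lambda>x::real^2. (x $ 1, x $ 2)"
  have fr: "?fr (?to z) = z" for z by simp
  have to_eq: "?to z = fst z *\<^sub>R axis 1 1 + snd z *\<^sub>R axis 2 1" for z
    by (simp add: vec_eq_iff forall_2 axis_def)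
  have lto: "bounded_linear ?to"
    unfolding to_eq by (intro bounded_linear_add bounded_linear_scaleR_left[THEN bounded_linear_compose] bounded_linear_fst bounded_linear_snd)
  have lfr: "bounded_linear ?fr"
    by (intro bounded_linear_Pair bounded_linear_vec_nth)
  let ?g = "\<lambda>x. ?to (fst (?fr x), f (?fr x))"
  let ?g' = "\<lambda>x h. ?to (fst (?fr h), f' (?fr x) (?fr h))"
  have "negligible (?g ` (?to ` S))"
  proof (rule baby_Sard[where f'="?g'"])
    fix x assume "x \<in> ?to ` S"
    then obtain w where w: "w \<in> S" "x = ?to w" by blast
    have frx: "?fr x = w" unfolding w(2) by (rule fr)
    have im: "?fr ` (?to ` S) = S" by (auto simp: image_image)
    have "(f has_derivative f' (?fr x)) (at (?fr x) within ?fr ` (?to ` S))"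
      unfolding im frx by (rule f[OF w(1)])
    then have "((\<lambda>x. f (?fr x)) has_derivative (\<lambda>h. f' (?fr x) (?fr h))) (at x within ?to ` S)"
      by (rule has_derivative_in_compose[OF bounded_linear_imp_has_derivative[OF lfr]])
    moreover have "((\<lambda>x. fst (?fr x)) has_derivative (\<lambda>h. fst (?fr h))) (at x within ?to ` S)"
      by (rule bounded_linear_imp_has_derivative[OF bounded_linear_compose[OF bounded_linear_fst lfr]])
    ultimately have "((\<lambda>x. (fst (?fr x), f (?fr x))) has_derivative (\<lambda>h. (fst (?fr h), f' (?fr x) (?fr h)))) (at x within ?to ` S)"
      by (intro has_derivative_Pair)
    from bounded_linear.has_derivative[OF lto this]
    show D: "(?g has_derivative ?g' x) (at x within ?to ` S)" .
    have lin: "linear (?g' x)" by (rule has_derivative_linear[OF D])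
    have "?g' x (axis 2 1) = ?g' x 0"
    proof -
      have "?fr (axis 2 1) = (0, 1)" "?fr 0 = (0, 0)" by (simp_all add: axis_def)
      moreover have "f' w (0, 0) = 0"
        using linear_0[OF has_derivative_linear[OF f[OF w(1)]]] by (simp add: zero_prod_def)
      ultimately show ?thesis using z[OF w(1)] unfolding frx by simp
    qed
    moreover have "axis 2 1 \<noteq> (0 :: real^2)" by (simp add: axis_eq_0_iff)
    ultimately have "\<not> inj (?g' x)" by (blast dest: injD)
    moreover have "(*v) (matrix (?g' x)) = ?g' x" by (rule ext, rule matrix_works[OF lin[folded linear_matrix_vector_mul_eq]])
    ultimately have "\<not> inj ((*v) (matrix (?g' x)))" by (simp only: not_False_eq_True)
    then show "rank (matrix (?g' x)) < CARD(2)" by (simp only: less_rank_noninjective not_False_eq_True)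
  qed simp
  then have "negligible (?fr ` (?g ` (?to ` S)))"
    by (rule negligible_differentiable_image_negligible[OF _ _ bounded_linear_imp_differentiable_on[OF lfr], rotated]) simp
  moreover have "?fr ` (?g ` (?to ` S)) = (\<lambda>z. (fst z, f z)) ` S"
    by (simp add: image_image)
  ultimately show ?thesis by simp
qed

lemma negligible_degenerate_zero:
  fixes f :: "real \<times> real \<Rightarrow> real" and l s :: real
  assumes f: "f differentiable_on (I \<times> {l..s})" and ls: "l < s"
  shows "negligible {(u, v). u \<in> I \<and> (\<exists>c\<in>{l..s}. v = f (u, c) \<and> ((\<lambda>c. f (u, c)) has_real_derivative 0) (at c within {l..s}))}"
proof -
  let ?S = "{z \<in> I \<times> {l..s}. ((\<lambda>c. f (fst z, c)) has_real_derivative 0) (at (snd z) within {l..s})}"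
  have "\<exists>f'. \<forall>z\<in>I \<times> {l..s}. (f has_derivative f' z) (at z within I \<times> {l..s})"
    using f unfolding differentiable_on_def differentiable_def by metis
  then obtain f' where f': "\<And>z. z \<in> I \<times> {l..s} \<Longrightarrow> (f has_derivative f' z) (at z within I \<times> {l..s})"
    by blast
  have "negligible ((\<lambda>z. (fst z, f z)) ` ?S)"
  proof (rule negligible_critical_graph)
    fix z assume z: "z \<in> ?S"
    then have zm: "z \<in> I \<times> {l..s}" by blast
    show "(f has_derivative f' z) (at z within ?S)"
      by (rule has_derivative_subset[OF f'[OF zm]]) auto
    have zz: "z = (fst z, snd z)" by simp
    have "(Pair (fst z)) ` {l..s} \<subseteq> I \<times> {l..s}" using zm by auto
    then have "(f has_derivative f' z) (at (fst z, snd z) within (Pair (fst z)) ` {l..s})"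
      using has_derivative_subset[OF f'[OF zm]] by simp
    moreover have "(Pair (fst z) has_derivative Pair 0) (at (snd z) within {l..s})"
      by (rule has_derivative_Pair[OF has_derivative_const has_derivative_ident])
    ultimately have "((\<lambda>c. f (fst z, c)) has_derivative (\<lambda>h. f' z (0, h))) (at (snd z) within {l..s})"
      by (rule has_derivative_in_compose[rotated])
    moreover have "(\<lambda>h. f' z (0, h)) = (*) (f' z (0, 1))"
    proof
      fix h
      have "f' z (h *\<^sub>R (0, 1)) = h *\<^sub>R f' z (0, 1)"
        using linear_scale[OF has_derivative_linear[OF f'[OF zm]]] by blast
      then show "f' z (0, h) = f' z (0, 1) * h" by simp
    qed
    ultimately have D: "((\<lambda>c. f (fst z, c)) has_real_derivative f' z (0, 1)) (at (snd z) within {l..s})"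
      by (simp only: has_field_derivative_def)
    \<comment> \<open>The interval has no isolated points, so the derivative within it is unique,
      also at its two ends.\<close>
    have "snd z islimpt {l..s}"
      by (rule connected_imp_perfect) (use zm ls in auto)
    then have "at (snd z) within {l..s} \<noteq> bot" by (simp add: trivial_limit_within)
    from has_field_derivative_unique[OF D _ this] show "f' z (0, 1) = 0" using z by blast
  qed
  then show ?thesis
    by (rule negligible_subset) (auto intro!: image_eqI)
qed

section \<open>The curvature of the perturbed curves\<close>

lemma typical_uminus: "typical (- \<alpha>) \<longleftrightarrow> typical \<alpha>"
proof -
  have *: "typical (- \<alpha>)" if ty: "typical \<alpha>" for \<alpha>
  proof -
    obtain \<tau> \<delta> where t: "\<tau> > 0" "\<delta> > 0" "\<forall>k1 k2 :: int. k2 \<noteq> 0 \<longrightarrow>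
      \<bar>of_int k1 + \<alpha> * of_int k2\<bar> \<ge> \<delta> / (\<bar>of_int k2\<bar> * (ln (1 + \<bar>of_int k2\<bar>)) powr \<tau>)"
      using ty unfolding typical_def by blast
    show ?thesis
      unfolding typical_def
    proof (rule exI[of _ \<tau>], rule conjI[OF t(1)], rule exI[of _ \<delta>], rule conjI[OF t(2)], intro allI impI)
      fix k1 k2 :: int assume "k2 \<noteq> 0"
      then show "\<bar>of_int k1 + - \<alpha> * of_int k2\<bar> \<ge> \<delta> / (\<bar>of_int k2\<bar> * (ln (1 + \<bar>of_int k2\<bar>)) powr \<tau>)"
        using t(3)[rule_format, of "- k2" k1] by simp
    qed
  qed
  show ?thesis using *[of \<alpha>] *[of "- \<alpha>"] by auto
qed

lemma DERIV_nonzero_isolated: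
  fixes f :: "real \<Rightarrow> real"
  assumes "(f has_real_derivative D) (at c within S)" "D \<noteq> 0" "f c = 0"
  shows "\<forall>\<^sub>F x in at c within S. f x \<noteq> 0"
proof -
  have "((\<lambda>x. (f x - f c) / (x - c)) \<longlongrightarrow> D) (at c within S)"
    using assms(1) by (simp add: has_field_derivative_iff)
  from tendsto_imp_eventually_ne[OF this assms(2)] show ?thesis
    by (rule eventually_mono) (auto simp: assms(3))
qed

text \<open>Infinitely many zeros would accumulate at a point of the compact interval. By continuity
  it is a zero itself, but a zero with nonzero derivative is isolated.\<close>

lemma finite_simple_zeros:
  fixes f :: "real \<Rightarrow> real"
  assumes f: "continuous_on {l..s} f"
    and D: "\<And>c. c \<in> {l..s} \<Longrightarrow> f c = 0 \<Longrightarrow> \<exists>D. D \<noteq> 0 \<and> (f has_real_derivative D) (at c within {l..})"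
  shows "finite {c \<in> {l..s}. f c = 0}"
proof (rule ccontr)
  let ?Z = "{c \<in> {l..s}. f c = 0}"
  assume "infinite ?Z"
  then obtain c where c: "c \<in> {l..s}" "c islimpt ?Z"
    using compact_eq_Bolzano_Weierstrass[of "{l..s}"] by auto
  have "closed ?Z" using continuous_closed_preimage_constant[OF f, of 0] by simp
  then have "f c = 0" using c(2) closed_limpt by blast
  then obtain D where "D \<noteq> 0" "(f has_real_derivative D) (at c within {l..})" using D[OF c(1)] by blast
  then have ev: "\<forall>\<^sub>F x in at c within {l..}. f x \<noteq> 0" using DERIV_nonzero_isolated \<open>f c = 0\<close> by blast
  have "at c within ?Z \<le> at c within {l..}" by (rule at_le) auto
  then have "\<forall>\<^sub>F x in at c within ?Z. f x \<noteq> 0" using ev by (rule filter_leD)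
  moreover have "\<forall>\<^sub>F x in at c within ?Z. f x = 0" by (auto simp: eventually_at_filter)
  ultimately have "\<forall>\<^sub>F x in at c within ?Z. False" by eventually_elim simp
  then show False using c(2) by (simp add: trivial_limit_within eventually_False)
qed

text \<open>At a zero of \<open>f\<close> the product rule needs only continuity of
  \<open>g\<close>. The powers in the denominator of the curvature then do not have to be
  differentiated.\<close>

lemma DERIV_mult_at_zero:
  fixes f g :: "real \<Rightarrow> real"
  assumes "(f has_real_derivative D) (at c within S)" "f c = 0" "continuous (at c within S) g"
  shows "((\<lambda>x. f x * g x) has_real_derivative D * g c) (at c within S)"
proof -
  have "((\<lambda>x. (f x - f c) / (x - c) * g x) \<longlongrightarrow> D * g c) (at c within S)"
    using assms by (intro tendsto_mult) (simp_all add: has_field_derivative_iff continuous_within)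
  then show ?thesis by (simp add: has_field_derivative_iff assms(2))
qed

section \<open>Zeros of the curvature numerator\<close>

context well_curve
begin

lemma DERIV_above:
  assumes "hi < c"
  shows "(A has_real_derivative A1 c) (at c)" "(A1 has_real_derivative A2 c) (at c)" "(A2 has_real_derivative A3 c) (at c)"
    "(B has_real_derivative B1 c) (at c)" "(B1 has_real_derivative B2 c) (at c)" "(B2 has_real_derivative B3 c) (at c)"
proof -
  have "at c within {lo..} = at c" using assms s by (intro at_within_interior) simp
  then show "(A has_real_derivative A1 c) (at c)" "(A1 has_real_derivative A2 c) (at c)" "(A2 has_real_derivative A3 c) (at c)"
    "(B has_real_derivative B1 c) (at c)" "(B1 has_real_derivative B2 c) (at c)" "(B2 has_real_derivative B3 c) (at c)"
    using DA[of c] DB[of c] assms s by auto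
qed

lemma DX:
  assumes "lo \<le> c" "c \<noteq> hi"
  shows "((\<lambda>c. A c + v * B c) has_real_derivative A1 c + v * B1 c) (at c within {lo..})"
    "((\<lambda>c. A1 c + v * B1 c) has_real_derivative A2 c + v * B2 c) (at c within {lo..})"
    "((\<lambda>c. A2 c + v * B2 c) has_real_derivative A3 c + v * B3 c) (at c within {lo..})"
  by (rule DERIV_add DERIV_cmult DA DB assms)+

end

text \<open>The first curve belongs to \<open>U2\<close> and the second to \<open>- U1\<close> with
  reversed argument, so \<open>gap\<close> says that the maximum of \<open>U2\<close> is below the
  minimum of \<open>U1\<close>. For \<open>c \<le> hi\<close> the level \<open>- c\<close> exceeds
  the top \<open>hi'\<close> by at least \<open>- hi - hi'\<close>; the last bound of
  \<open>above\<close> then limits the second derivative of the second action to \<open>K\<close>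
  times the first.\<close>

locale curve_pair =
  X: well_curve U K lo hi s v0 W A A1 A2 A3 B B1 B2 B3 +
  Y: well_curve U' K lo' hi' s' v0' W' A' A1' A2' A3' B' B1' B2' B3'
  for U K lo hi s v0 W A A1 A2 A3 B B1 B2 B3 U' lo' hi' s' v0' W' A' A1' A2' A3' B' B1' B2' B3' +
  assumes gap: "hi + hi' < 0" and K: "K * (2 * (- hi - hi')) = 1"
begin

definition "X1 v c = A1 c + v * B1 c"
definition "X2 v c = A2 c + v * B2 c"
definition "X3 v c = A3 c + v * B3 c"
definition "Y1 u c = A1' (- c) + u * B1' (- c)"
definition "Y2 u c = A2' (- c) + u * B2' (- c)"
definition "Y3 u c = A3' (- c) + u * B3' (- c)"

text \<open>With \<open>F2' = X1\<close>, \<open>F2'' = X2\<close>, \<open>F1' = - Y1\<close> and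
  \<open>F1'' = Y2\<close> this is minus the numerator of the curvature.\<close>

definition "N u v c = X2 v c * Y1 u c + Y2 u c * X1 v c"

lemma Y_above: "\<bar>u\<bar> \<le> v0' \<Longrightarrow> c \<le> hi \<Longrightarrow> 0 < Y1 u c" "\<bar>u\<bar> \<le> v0' \<Longrightarrow> c \<le> hi \<Longrightarrow> Y2 u c < 0"
  using Y.pos1[of u "- c"] Y.above(5)[of u "- c"] Y.s gap by (auto simp: Y1_def Y2_def)

lemma Y2_ge: 
  assumes u: "\<bar>u\<bar> \<le> v0'" and c: "c \<le> hi"
  shows "- Y2 u c \<le> K * Y1 u c"
proof -
  have "0 < 2 * (- hi - hi')" using gap by simp
  then have Kp: "0 < K" using K by (metis zero_less_mult_pos2 zero_less_one)
  have "- Y2 u c * (2 * (- hi - hi')) \<le> - Y2 u c * (2 * (- c - hi'))"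
    using Y_above(2)[OF assms] c by (intro mult_left_mono) auto
  also have "\<dots> \<le> Y1 u c" using Y.above(6)[OF u, of "- c"] c gap by (simp add: Y1_def Y2_def)
  finally have "K * (- Y2 u c * (2 * (- hi - hi'))) \<le> K * Y1 u c" using Kp by (intro mult_left_mono) auto
  then have "- Y2 u c * (K * (2 * (- hi - hi'))) \<le> K * Y1 u c" by (simp only: mult.left_commute[of K "- Y2 u c"])
  then show ?thesis by (simp only: K mult_1_right)
qed

text \<open>Near its top the first action has \<open>X2 > K * X1\<close>, while the second one
  satisfies \<open>- Y2 \<le> K * Y1\<close>, so the positive term of \<open>N\<close> wins. All
  zeros on this branch therefore lie in \<open>{lo..s}\<close>, which is compact and on which the
  perturbation is flat.\<close>

lemma N_pos_near_top:
  assumes "\<bar>u\<bar> \<le> v0'" "\<bar>v\<bar> \<le> v0" "s \<le> c" "c < hi"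
  shows "0 < N u v c"
proof -
  have X1: "0 < X1 v c" using X.pos1[OF assms(2), of c] X.s assms by (simp add: X1_def)
  have Y1: "0 < Y1 u c" using Y_above[OF assms(1)] assms by simp
  have "K * X1 v c * Y1 u c < X2 v c * Y1 u c"
    using X.steep[OF assms(2-4)] Y1 by (intro mult_strict_right_mono) (auto simp: X1_def X2_def)
  moreover have "- Y2 u c * X1 v c \<le> K * Y1 u c * X1 v c"
    using Y2_ge[OF assms(1)] X1 assms by (intro mult_right_mono) auto
  ultimately show ?thesis by (simp add: N_def mult_ac)
qed

lemma DERIV_neg_arg:
  assumes "(f has_real_derivative D) (at (- c))"
  shows "((\<lambda>c. f (- c)) has_real_derivative - D) (at c within T)"
proof -
  have "(uminus has_real_derivative - 1) (at c within T)" by (auto intro!: derivative_eq_intros)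
  from DERIV_chain2[OF assms this] show ?thesis by simp
qed

lemma DY:
  assumes "c < - hi'"
  shows "(Y1 u has_real_derivative - Y2 u c) (at c within T)" "(Y2 u has_real_derivative - Y3 u c) (at c within T)"
proof -
  have c: "hi' < - c" using assms by simp
  show "(Y1 u has_real_derivative - Y2 u c) (at c within T)"
    unfolding Y1_def[abs_def] Y2_def
    by (rule DERIV_cong[OF DERIV_add[OF DERIV_neg_arg DERIV_cmult[OF DERIV_neg_arg]]], rule Y.DERIV_above(2)[OF c], rule Y.DERIV_above(5)[OF c]) simp
  show "(Y2 u has_real_derivative - Y3 u c) (at c within T)"
    unfolding Y2_def[abs_def] Y3_def
    by (rule DERIV_cong[OF DERIV_add[OF DERIV_neg_arg DERIV_cmult[OF DERIV_neg_arg]]], rule Y.DERIV_above(3)[OF c], rule Y.DERIV_above(6)[OF c]) simp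
qed

lemma DN:
  assumes "lo \<le> c" "c < hi"
  shows "(N u v has_real_derivative X3 v c * Y1 u c - Y3 u c * X1 v c) (at c within {lo..})"
proof -
  have c: "c \<noteq> hi" "c < - hi'" using assms gap by auto
  have "(X1 v has_real_derivative X2 v c) (at c within {lo..})" "(X2 v has_real_derivative X3 v c) (at c within {lo..})"
    unfolding X1_def[abs_def] X2_def[abs_def] X3_def using X.DX[OF assms(1) c(1)] by auto
  from DERIV_add[OF DERIV_mult[OF this(2) DY(1)[OF c(2)]] DERIV_mult[OF DY(2)[OF c(2)] this(1)]]
  show ?thesis unfolding N_def[abs_def] by (rule DERIV_cong) (simp add: algebra_simps)
qed

text \<open>The quotient \<open>X1 / Y1\<close> is minus the slope, so \<open>S\<close> collects its
  forbidden values; the last alternative says that the derivative of \<open>N u v\<close> vanishes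
  together with \<open>N u v\<close>. Only the branch below \<open>hi\<close> is recorded, the other
  one follows by exchanging the potentials.\<close>

definition bad :: "real set \<Rightarrow> (real \<times> real) set" where
  "bad S = {(u, v). \<bar>u\<bar> \<le> v0' \<and> \<bar>v\<bar> \<le> v0 \<and> (\<exists>c. lo \<le> c \<and> c < hi \<and> N u v c = 0 \<and>
     (X1 v c / Y1 u c \<in> S \<or> X3 v c * Y1 u c - Y3 u c * X1 v c = 0))}"

lemma negligible_bad:
  assumes S: "negligible S"
  shows "negligible (bad S)"
proof -
  let ?J = "{lo..s}" and ?I = "{- v0'..v0'}"
  have cJ: "lo \<le> c" "c < hi" "c \<noteq> hi" "c < - hi'" "c \<le> hi" "hi' < - c" if "c \<in> ?J" for c using that X.s gap by auto
  have dA: "A1 differentiable_on ?J" "A2 differentiable_on ?J"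
  proof -
    have *: "f differentiable_on ?J" if "\<And>c. c \<in> ?J \<Longrightarrow> (f has_real_derivative g c) (at c within {lo..})" for f g
      unfolding differentiable_on_def real_differentiable_def
      using DERIV_subset[OF that] by (meson Icc_subset_Ici_iff order_refl)
    show "A1 differentiable_on ?J" by (rule *[where g=A2]) (rule X.DA(2)[OF cJ(1,3)])
    show "A2 differentiable_on ?J" by (rule *[where g=A3]) (rule X.DA(3)[OF cJ(1,3)])
  qed
  have dY: "(\<lambda>c. f (- c)) differentiable_on ?J" if "\<And>c. c \<in> ?J \<Longrightarrow> (f has_real_derivative g c) (at (- c))" for f g
    unfolding differentiable_on_def real_differentiable_def using DERIV_neg_arg[OF that] by blast
  have dP: "(\<lambda>c. A1' (- c)) differentiable_on ?J" "(\<lambda>c. A2' (- c)) differentiable_on ?J"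
    "(\<lambda>c. B1' (- c)) differentiable_on ?J" "(\<lambda>c. B2' (- c)) differentiable_on ?J"
    by (rule dY, rule Y.DERIV_above(2) Y.DERIV_above(3) Y.DERIV_above(5) Y.DERIV_above(6), rule cJ(6), assumption)+
  have n1: "negligible {(u, v). \<exists>c\<in>?J. \<exists>y\<in>S. y \<noteq> 0 \<and> A2 c + y * (A2' (- c) + u * B2' (- c)) = 0 \<and>
      A1 c + v * (pi / 2) = y * (A1' (- c) + u * B1' (- c))}"
    by (rule negligible_slope_at_zero[OF S dA dP(1,2,3,4)]) (use Y.above(3) cJ(6) in auto)
  \<comment> \<open>The value of \<open>v\<close> for which \<open>N u v c = 0\<close>: by flatness
    \<open>X1 v c = A1 c + v * (pi / 2)\<close> and \<open>X2 v c = A2 c\<close> on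
    \<open>?J\<close>, so the equation is affine in \<open>v\<close>.\<close>
  let ?f = "\<lambda>z. (- A2 (snd z) * (A1' (- snd z) + fst z * B1' (- snd z)) / (A2' (- snd z) + fst z * B2' (- snd z)) - A1 (snd z)) / (pi / 2)"
  note sn = differentiable_on_snd[OF dA(1), of ?I] differentiable_on_snd[OF dA(2), of ?I]
    differentiable_on_snd[OF dP(1), of ?I] differentiable_on_snd[OF dP(2), of ?I]
    differentiable_on_snd[OF dP(3), of ?I] differentiable_on_snd[OF dP(4), of ?I]
  have "?f differentiable_on (?I \<times> ?J)"
  proof (intro differentiable_on_div differentiable_on_diff differentiable_on_mult differentiable_on_minus
      differentiable_on_add differentiable_on_fst' differentiable_on_const sn)
    fix z assume "z \<in> ?I \<times> ?J"
    then have "Y2 (fst z) (snd z) < 0" using cJ(5)[of "snd z"] by (intro Y_above) auto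
    then show "A2' (- snd z) + fst z * B2' (- snd z) \<noteq> 0" by (simp add: Y2_def)
  qed auto
  from negligible_degenerate_zero[OF this X.s(1)]
  have n2: "negligible {(u, v). u \<in> ?I \<and> (\<exists>c\<in>?J. v = ?f (u, c) \<and> ((\<lambda>c. ?f (u, c)) has_real_derivative 0) (at c within ?J))}" .
  show ?thesis
  proof (rule negligible_subset[OF negligible_Un[OF n1 n2]], rule subsetI, rule UnCI)
    fix z assume "z \<in> bad S" and not2: "z \<notin> {(u, v). u \<in> ?I \<and> (\<exists>c\<in>?J. v = ?f (u, c) \<and> ((\<lambda>c. ?f (u, c)) has_real_derivative 0) (at c within ?J))}"
    moreover obtain u v where zuv: "z = (u, v)" by (cases z)
    ultimately have "(u, v) \<in> bad S" by simp
    then obtain c where uv: "\<bar>u\<bar> \<le> v0'" "\<bar>v\<bar> \<le> v0" and c: "lo \<le> c" "c < hi" "N u v c = 0"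
      and or: "X1 v c / Y1 u c \<in> S \<or> X3 v c * Y1 u c - Y3 u c * X1 v c = 0" unfolding bad_def by auto
    have "c \<le> s" using N_pos_near_top[OF uv, of c] c by force
    then have cs: "c \<in> ?J" using c by simp
    have X1: "0 < X1 v c" using X.pos1[OF uv(2) c(1)] c by (simp add: X1_def)
    note Y = Y_above[OF uv(1) cJ(5)[OF cs]]
    have flatx: "X1 v x = A1 x + v * (pi / 2)" "X2 v x = A2 x" if "x \<in> ?J" for x
      using that X.flat by (auto simp: X1_def X2_def)
    \<comment> \<open>The difference between \<open>v\<close> and the value that solves the equation
      is \<open>N u v\<close> divided by a nonvanishing factor. A zero of \<open>N u v\<close> at
      which its derivative vanishes is thus a critical point of \<open>?f\<close> in
      \<open>c\<close>, with value \<open>v\<close>.\<close>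
    have feq: "v - N u v x / (Y2 u x * (pi / 2)) = ?f (u, x)" if x: "x \<in> ?J" for x
    proof -
      have y: "Y2 u x < 0" by (rule Y_above(2)[OF uv(1) cJ(5)[OF x]])
      have "N u v x = A2 x * Y1 u x + Y2 u x * (A1 x + v * (pi / 2))" by (simp add: N_def flatx[OF x])
      then have "v - N u v x / (Y2 u x * (pi / 2)) = (- A2 x * Y1 u x / Y2 u x - A1 x) / (pi / 2)"
        using y by (simp add: divide_simps) (simp add: algebra_simps)
      then show ?thesis by (simp add: Y1_def Y2_def)
    qed
    have "\<exists>c\<in>?J. \<exists>y\<in>S. y \<noteq> 0 \<and> A2 c + y * (A2' (- c) + u * B2' (- c)) = 0 \<and>
      A1 c + v * (pi / 2) = y * (A1' (- c) + u * B1' (- c))"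
    proof (cases "X1 v c / Y1 u c \<in> S")
      case True
      let ?y = "X1 v c / Y1 u c"
      have "A2 c * Y1 u c + Y2 u c * X1 v c = 0" using c(3) by (simp add: N_def flatx[OF cs])
      then have "A2 c + ?y * Y2 u c = 0" using Y by (simp add: field_simps)
      moreover have "A1 c + v * (pi / 2) = ?y * Y1 u c" using Y flatx[OF cs] by simp
      moreover have "?y \<noteq> 0" using X1 Y by simp
      ultimately show ?thesis using True cs unfolding Y1_def Y2_def by blast
    next
      case False
      then have z: "X3 v c * Y1 u c - Y3 u c * X1 v c = 0" using or by blast
      have "(N u v has_real_derivative 0) (at c within ?J)"
        using DERIV_subset[OF DN[OF c(1,2), of u v], of ?J] unfolding z by auto
      moreover have dY2: "((\<lambda>x. Y2 u x * (pi / 2)) has_real_derivative - Y3 u c * (pi / 2)) (at c within ?J)"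
        by (rule DERIV_cmult_right[OF DY(2)[OF cJ(4)[OF cs]]])
      moreover have "Y2 u c * (pi / 2) \<noteq> 0" using Y by simp
      ultimately have "((\<lambda>x. N u v x / (Y2 u x * (pi / 2))) has_real_derivative
          (0 * (Y2 u c * (pi / 2)) - N u v c * (- Y3 u c * (pi / 2))) / ((Y2 u c * (pi / 2)) * (Y2 u c * (pi / 2)))) (at c within ?J)"
        by (rule DERIV_divide)
      then have "((\<lambda>x. N u v x / (Y2 u x * (pi / 2))) has_real_derivative 0) (at c within ?J)"
        by (rule DERIV_cong) (simp add: c(3))
      from DERIV_diff[OF DERIV_const this, of v]
      have "((\<lambda>x. v - N u v x / (Y2 u x * (pi / 2))) has_real_derivative 0) (at c within ?J)" by simp
      then have "((\<lambda>x. ?f (u, x)) has_real_derivative 0) (at c within ?J)"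
        by (rule has_field_derivative_transform_within[OF _ zero_less_one cs]) (simp only: feq)
      moreover have "v = ?f (u, c)" using feq[OF cs] c(3) by simp
      moreover have "u \<in> ?I" using uv by auto
      ultimately have "(u, v) \<in> {(u, v). u \<in> ?I \<and> (\<exists>c\<in>?J. v = ?f (u, c) \<and> ((\<lambda>c. ?f (u, c)) has_real_derivative 0) (at c within ?J))}"
        using cs by blast
      then show ?thesis using not2 unfolding zuv by contradiction
    qed
    then show "z \<in> {(u, v). \<exists>c\<in>?J. \<exists>y\<in>S. y \<noteq> 0 \<and> A2 c + y * (A2' (- c) + u * B2' (- c)) = 0 \<and>
      A1 c + v * (pi / 2) = y * (A1' (- c) + u * B1' (- c))}" unfolding zuv by blast
  qed
qed

lemma good_zeros:
  assumes good: "(u, v) \<notin> bad S" and uv: "\<bar>u\<bar> \<le> v0'" "\<bar>v\<bar> \<le> v0"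
  shows "finite {c \<in> {lo..<hi}. N u v c = 0}"
    and "\<And>c. c \<in> {lo..<hi} \<Longrightarrow> N u v c = 0 \<Longrightarrow> X3 v c * Y1 u c - Y3 u c * X1 v c \<noteq> 0 \<and> X1 v c / Y1 u c \<notin> S"
proof -
  show z: "X3 v c * Y1 u c - Y3 u c * X1 v c \<noteq> 0 \<and> X1 v c / Y1 u c \<notin> S" if "c \<in> {lo..<hi}" "N u v c = 0" for c
    using good uv that unfolding bad_def by auto
  have "finite {c \<in> {lo..s}. N u v c = 0}"
  proof (rule finite_simple_zeros)
    show "continuous_on {lo..s} (N u v)"
      unfolding continuous_on_eq_continuous_within
    proof
      fix c assume "c \<in> {lo..s}"
      then have "lo \<le> c" "c < hi" using X.s by auto
      from DERIV_continuous[OF DN[OF this]] show "continuous (at c within {lo..s}) (N u v)"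
        by (rule continuous_within_subset) auto
    qed
    fix c assume c: "c \<in> {lo..s}" "N u v c = 0"
    then have "lo \<le> c" "c < hi" using X.s by auto
    from DN[OF this] z[of c] c X.s show "\<exists>D. D \<noteq> 0 \<and> (N u v has_real_derivative D) (at c within {lo..})"
      by (intro exI[of _ "X3 v c * Y1 u c - Y3 u c * X1 v c"]) auto
  qed
  moreover have "{c \<in> {lo..<hi}. N u v c = 0} \<subseteq> {c \<in> {lo..s}. N u v c = 0}"
  proof
    fix c assume c: "c \<in> {c \<in> {lo..<hi}. N u v c = 0}"
    then have "c \<le> s" using N_pos_near_top[OF uv, of c] by (cases "c \<le> s") auto
    then show "c \<in> {c \<in> {lo..s}. N u v c = 0}" using c by simp
  qed
  ultimately show "finite {c \<in> {lo..<hi}. N u v c = 0}" by (rule finite_subset[rotated])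
qed

end

section \<open>Density\<close>

lemma deriv_within_eq:
  assumes "(f has_real_derivative D) (at c within {l..h})" "c \<in> {l..h}" "l < h"
  shows "deriv_within {l..h} f c = D"
  unfolding deriv_within_def using assms
  by (intro vector_derivative_within_closed_interval) (auto simp: has_real_derivative_iff_has_vector_derivative)

text \<open>Induction over the generation of the topology reduces this to a single ball. A ball
  around another centre \<open>U0\<close> leaves a positive margin at \<open>U\<close>, because the
  continuous periodic distance of the \<open>k\<close>-th derivatives attains its maximum.\<close>

lemma openin_whitney_perturbation:
  fixes v0 :: real
  assumes T: "openin whitney_topology T" "U \<in> T" and U: "U \<in> smooth_periodic"
    and F: "\<And>v. \<bar>v\<bar> \<le> v0 \<Longrightarrow> F v \<in> smooth_periodic"
    and close: "\<And>k e. 0 < e \<Longrightarrow> \<exists>d>0. \<forall>v q. \<bar>v\<bar> \<le> d \<longrightarrow> \<bar>v\<bar> \<le> v0 \<longrightarrow> \<bar>(deriv ^^ k) (F v) q - (deriv ^^ k) U q\<bar> < e"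
  shows "\<exists>d>0. \<forall>v. \<bar>v\<bar> \<le> d \<longrightarrow> \<bar>v\<bar> \<le> v0 \<longrightarrow> F v \<in> T"
proof -
  have "generate_topology_on {C_ball k U e | k U e. U \<in> smooth_periodic \<and> 0 < e} T"
    using T(1) unfolding whitney_topology_def by (simp add: openin_topology_generated_by_iff)
  then show ?thesis using T(2)
  proof induction
    case Empty
    then show ?case by simp
  next
    case (Int a b)
    then obtain d1 d2 where d: "d1 > 0" "d2 > 0" "\<forall>v. \<bar>v\<bar> \<le> d1 \<longrightarrow> \<bar>v\<bar> \<le> v0 \<longrightarrow> F v \<in> a"
      "\<forall>v. \<bar>v\<bar> \<le> d2 \<longrightarrow> \<bar>v\<bar> \<le> v0 \<longrightarrow> F v \<in> b" by blast
    then show ?case by (intro exI[of _ "min d1 d2"]) auto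
  next
    case (UN L)
    then show ?case by blast
  next
    case (Basis s)
    then obtain k U0 e where s: "s = C_ball k U0 e" "U0 \<in> smooth_periodic" "0 < e" by blast
    have sm: "smooth_on UNIV U" "smooth_on UNIV U0" "\<And>q. U (q + 1) = U q" "\<And>q. U0 (q + 1) = U0 q"
      using U s(2) by (auto simp: smooth_periodic_iff)
    let ?g = "\<lambda>q. \<bar>(deriv ^^ k) U q - (deriv ^^ k) U0 q\<bar>"
    have "continuous_on UNIV ((deriv ^^ k) U)" "continuous_on UNIV ((deriv ^^ k) U0)"
      using smooth_on_continuous[OF smooth_on_funpow_deriv[OF open_UNIV]] sm by blast+
    then have "continuous_on {0..1} ?g"
      by (intro continuous_on_rabs continuous_on_diff) (auto intro: continuous_on_subset)
    then obtain x where x: "x \<in> {0..1}" "\<And>y. y \<in> {0..1} \<Longrightarrow> ?g y \<le> ?g x"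
      using continuous_attains_sup[of "{0..1::real}" ?g] by fastforce
    have per: "?g (q + 1) = ?g q" for q
      using periodic_funpow_deriv[OF sm(1,3), of k q] periodic_funpow_deriv[OF sm(2,4), of k q] by simp
    have gx: "?g q \<le> ?g x" for q
      using x(2)[of "frac q"] frac_lt_1[of q] periodic_frac[of ?g, OF per, of q] by simp
    have lt: "?g x < e" using Basis(2) unfolding s(1) C_ball_def by blast
    obtain d where d: "d > 0" "\<forall>v q. \<bar>v\<bar> \<le> d \<longrightarrow> \<bar>v\<bar> \<le> v0 \<longrightarrow> \<bar>(deriv ^^ k) (F v) q - (deriv ^^ k) U q\<bar> < e - ?g x"
      using close[of "e - ?g x" k] lt by auto
    have "F v \<in> s" if v: "\<bar>v\<bar> \<le> d" "\<bar>v\<bar> \<le> v0" for v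
    proof -
      have "\<bar>(deriv ^^ k) (F v) q - (deriv ^^ k) U0 q\<bar> < e" for q
        using d(2)[rule_format, OF v, of q] gx[of q] by linarith
      then show ?thesis unfolding s(1) C_ball_def using F[OF v(2)] by blast
    qed
    then show ?case using d(1) by blast
  qed
qed

lemma (in well_curve) W_smooth_periodic: "\<bar>v\<bar> \<le> v0 \<Longrightarrow> W v \<in> smooth_periodic"
  using W(1) by (simp add: admissible_def)

lemma (in well_curve) W_bounds: "\<bar>v\<bar> \<le> v0 \<Longrightarrow> W v q \<le> hi"
  using extremal_values_attained(1)[OF W_smooth_periodic] W(3) by metis

lemma max_val_uminus:
  assumes "V \<in> smooth_periodic"
  shows "max_val (\<lambda>q. - V q) = - min_val V" "min_val (\<lambda>q. - V q) = - max_val V"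
proof -
  have V': "(\<lambda>q. - V q) \<in> smooth_periodic" using assms by (auto simp: smooth_periodic_iff smooth_on_minus)
  obtain x where x: "V x = min_val V" "\<And>q. V x \<le> V q" using extremal_values_attained(2)[OF assms] by blast
  obtain y where y: "- V y = max_val (\<lambda>q. - V q)" "\<And>q. - V q \<le> - V y" using extremal_values_attained(1)[OF V'] by blast
  obtain x' where x': "V x' = max_val V" "\<And>q. V q \<le> V x'" using extremal_values_attained(1)[OF assms] by blast
  obtain y' where y': "- V y' = min_val (\<lambda>q. - V q)" "\<And>q. - V y' \<le> - V q" using extremal_values_attained(2)[OF V'] by blast
  show "max_val (\<lambda>q. - V q) = - min_val V" using x(1) x(2)[of y] y(1) y(2)[of x] by linarith
  show "min_val (\<lambda>q. - V q) = - max_val V" using x'(1) x'(2)[of y'] y'(1) y'(2)[of x'] by linarith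
qed

lemma F1_uminus: "F1 (\<lambda>q. - V q) c = F2 V (- c)"
proof -
  have 1: "{q \<in> {0..1}. c \<le> - V q} = {q \<in> {0..1}. V q \<le> - c}" by auto
  have "- V q - c = - c - V q" for q by simp
  then have 2: "(\<lambda>q. sqrt (- V q - c)) = (\<lambda>q. sqrt (- c - V q))" by (simp only:)
  show ?thesis unfolding F1_def F2_def 1 2 ..
qed

section \<open>Nondegeneracy of the perturbed metrics\<close>

context curve_pair
begin

text \<open>The conditions on the gap and on \<open>K\<close> are symmetric in the two potentials.
  The exchange, together with \<open>c \<mapsto> - c\<close>, maps the branch above
  \<open>- hi'\<close> to the one below \<open>hi\<close>, so what is proved for the latter holds
  for the former.\<close>

lemma swapped: "curve_pair U' K lo' hi' s' v0' W' A' A1' A2' A3' B' B1' B2' B3' U lo hi s v0 W A A1 A2 A3 B B1 B2 B3"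
proof -
  have "K * (2 * (- hi' - hi)) = 1" using K by (simp add: algebra_simps)
  then show ?thesis
    using gap by (intro curve_pair.intro curve_pair_axioms.intro X.well_curve_axioms Y.well_curve_axioms) simp_all
qed

sublocale S: curve_pair U' K lo' hi' s' v0' W' A' A1' A2' A3' B' B1' B2' B3' U lo hi s v0 W A A1 A2 A3 B B1 B2 B3
  by (rule swapped)

lemma swap_eqs: "S.X1 u (- c) = Y1 u c" "S.X2 u (- c) = Y2 u c" "S.X3 u (- c) = Y3 u c"
  "S.Y1 v (- c) = X1 v c" "S.Y2 v (- c) = X2 v c" "S.Y3 v (- c) = X3 v c" "S.N v u (- c) = N u v c"
  by (simp_all add: S.X1_def S.X2_def S.X3_def S.Y1_def S.Y2_def S.Y3_def S.N_def N_def X1_def X2_def X3_def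
      Y1_def Y2_def Y3_def)

abbreviation "I \<equiv> {lo..- lo'}"

lemma order: "lo < hi" "hi < - hi'" "- hi' < - lo'"
  using X.s Y.s gap by auto

lemma DX_I: "c \<in> I \<Longrightarrow> c \<noteq> hi \<Longrightarrow> ((\<lambda>c. A c + v * B c) has_real_derivative X1 v c) (at c within I)"
  "c \<in> I \<Longrightarrow> c \<noteq> hi \<Longrightarrow> (X1 v has_real_derivative X2 v c) (at c within I)"
  "c \<in> I \<Longrightarrow> c \<noteq> hi \<Longrightarrow> (X2 v has_real_derivative X3 v c) (at c within I)"
  unfolding X1_def[abs_def] X2_def[abs_def] X3_def
  by (rule DERIV_subset[OF X.DX(1)] DERIV_subset[OF X.DX(2)] DERIV_subset[OF X.DX(3)]; simp)+

lemma DERIV_reflect_I: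
  assumes "(f has_real_derivative D) (at (- c) within {lo'..})"
  shows "((\<lambda>c. f (- c)) has_real_derivative - D) (at c within I)"
proof -
  have "uminus ` I \<subseteq> {lo'..}" by auto
  from DERIV_subset[OF assms this]
  have "(f has_real_derivative D) (at (- c) within uminus ` I)" .
  moreover have "(uminus has_real_derivative - 1) (at c within I)" by (auto intro!: derivative_eq_intros)
  ultimately have "(f \<circ> uminus has_real_derivative D * - 1) (at c within I)" by (rule DERIV_image_chain)
  then show ?thesis by (simp add: o_def)
qed

lemma DY_I: "c \<in> I \<Longrightarrow> c \<noteq> - hi' \<Longrightarrow> ((\<lambda>c. A' (- c) + u * B' (- c)) has_real_derivative - Y1 u c) (at c within I)"
  "c \<in> I \<Longrightarrow> c \<noteq> - hi' \<Longrightarrow> (Y1 u has_real_derivative - Y2 u c) (at c within I)"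
  "c \<in> I \<Longrightarrow> c \<noteq> - hi' \<Longrightarrow> (Y2 u has_real_derivative - Y3 u c) (at c within I)"
proof -
  assume c: "c \<in> I" "c \<noteq> - hi'"
  then have c': "lo' \<le> - c" "- c \<noteq> hi'" by auto
  show "((\<lambda>c. A' (- c) + u * B' (- c)) has_real_derivative - Y1 u c) (at c within I)"
    unfolding Y1_def by (rule DERIV_reflect_I[OF Y.DX(1)[OF c']])
  show "(Y1 u has_real_derivative - Y2 u c) (at c within I)"
    unfolding Y1_def[abs_def] Y2_def by (rule DERIV_reflect_I[OF Y.DX(2)[OF c']])
  show "(Y2 u has_real_derivative - Y3 u c) (at c within I)"
    unfolding Y2_def[abs_def] Y3_def by (rule DERIV_reflect_I[OF Y.DX(3)[OF c']])
qed

lemma DERIV_N_I: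
  assumes "c \<in> I" "c \<noteq> hi" "c \<noteq> - hi'"
  shows "(N u v has_real_derivative X3 v c * Y1 u c - Y3 u c * X1 v c) (at c within I)"
  unfolding N_def[abs_def]
  by (rule DERIV_cong[OF DERIV_add[OF DERIV_mult[OF DX_I(3)[OF assms(1,2)] DY_I(2)[OF assms(1,3)]]
        DERIV_mult[OF DY_I(3)[OF assms(1,3)] DX_I(2)[OF assms(1,2)]]]]) (simp add: algebra_simps)

lemma positive:
  assumes uv: "\<bar>u\<bar> \<le> v0'" "\<bar>v\<bar> \<le> v0" and c: "c \<in> I" "c \<noteq> hi" "c \<noteq> - hi'"
  shows "0 < X1 v c" "0 < Y1 u c"
  using X.pos1[OF uv(2), of c] Y.pos1[OF uv(1), of "- c"] c by (auto simp: X1_def Y1_def)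

definition "V1 u q = - W' u q"
definition "V2 v = W v"

context
  fixes u v :: real
  assumes uv: "\<bar>u\<bar> \<le> v0'" "\<bar>v\<bar> \<le> v0"
begin

lemma V_vals: "max_val (V1 u) = - lo'" "min_val (V1 u) = - hi'" "max_val (V2 v) = hi" "min_val (V2 v) = lo"
  using max_val_uminus[OF Y.W_smooth_periodic[OF uv(1)]] Y.W(2,3)[OF uv(1)] X.W(2,3)[OF uv(2)]
  by (simp_all add: V1_def[abs_def] V2_def)

lemma param_eq: "param_interval (V1 u) (V2 v) = I"
  by (simp add: param_interval_def V_vals)

lemma F2_V2: "F2 (V2 v) = (\<lambda>c. A c + v * B c)"
  using X.F2_W[OF uv(2)] by (simp add: V2_def fun_eq_iff)

lemma F1_V1: "F1 (V1 u) = (\<lambda>c. A' (- c) + u * B' (- c))"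
  using Y.F2_W[OF uv(1)] by (simp add: V1_def[abs_def] fun_eq_iff F1_uminus)

lemma V_in_Omega: "((V1 u), (V2 v)) \<in> Omega"
proof -
  have "(V2 v) q2 < (V1 u) q1" for q1 q2
    using X.W_bounds[OF uv(2), of q2] Y.W_bounds[OF uv(1), of q1] gap by (simp add: V1_def V2_def)
  then show ?thesis
    using X.W(1)[OF uv(2)] admissible_uminus[OF Y.W(1)[OF uv(1)]] by (simp add: Omega_def V1_def[abs_def] V2_def)
qed

lemma D1: "c \<in> I \<Longrightarrow> c \<noteq> hi \<Longrightarrow> deriv_within I (F2 (V2 v)) c = X1 v c"
  "c \<in> I \<Longrightarrow> c \<noteq> - hi' \<Longrightarrow> deriv_within I (F1 (V1 u)) c = - Y1 u c"
  unfolding F2_V2 F1_V1 using order by (intro deriv_within_eq DX_I(1) DY_I(1); simp)+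

text \<open>The first derivative is known only away from the critical value \<open>x\<close>. Near a
  point \<open>c \<noteq> x\<close> this is enough, as differentiation is local.\<close>

lemma deriv_within_deriv_within:
  assumes c: "c \<in> I" "c \<noteq> x" and g: "\<And>y. y \<in> I \<Longrightarrow> y \<noteq> x \<Longrightarrow> f y = g y"
    and D: "(g has_real_derivative D) (at c within I)"
  shows "deriv_within I f c = D"
proof (rule deriv_within_eq[OF _ c(1)])
  show "(f has_real_derivative D) (at c within I)"
  proof (rule has_field_derivative_transform_within[OF D _ c(1)])
    show "0 < \<bar>c - x\<bar>" using c by simp
    fix y assume "y \<in> I" "dist y c < \<bar>c - x\<bar>"
    then show "g y = f y" using g[of y] by (auto simp: dist_real_def abs_minus_commute)
  qed
  show "lo < - lo'" using order by simp
qed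

lemma D2: "c \<in> I \<Longrightarrow> c \<noteq> hi \<Longrightarrow> deriv_within I (deriv_within I (F2 (V2 v))) c = X2 v c"
  "c \<in> I \<Longrightarrow> c \<noteq> - hi' \<Longrightarrow> deriv_within I (deriv_within I (F1 (V1 u))) c = Y2 u c"
proof -
  show "c \<in> I \<Longrightarrow> c \<noteq> hi \<Longrightarrow> deriv_within I (deriv_within I (F2 (V2 v))) c = X2 v c"
    by (rule deriv_within_deriv_within[OF _ _ D1(1) DX_I(2)])
  assume c: "c \<in> I" "c \<noteq> - hi'"
  have "((\<lambda>c. - Y1 u c) has_real_derivative Y2 u c) (at c within I)"
    using DERIV_minus[OF DY_I(2)[OF c]] by simp
  with c show "deriv_within I (deriv_within I (F1 (V1 u))) c = Y2 u c"
    by (intro deriv_within_deriv_within[OF _ _ D1(2)])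
qed

lemma slope_eq: "c \<in> I \<Longrightarrow> c \<noteq> hi \<Longrightarrow> c \<noteq> - hi' \<Longrightarrow> slope (V1 u) (V2 v) c = - (X1 v c / Y1 u c)"
  by (simp add: slope_def param_eq Let_def D1)

lemma curvature_eq:
  assumes "c \<in> I" "c \<noteq> hi" "c \<noteq> - hi'"
  shows "curvature (V1 u) (V2 v) c = N u v c * - (1 / ((Y1 u c)\<^sup>2 + (X1 v c)\<^sup>2) powr (3 / 2))"
proof -
  have "curvature (V1 u) (V2 v) c = (X2 v c * - Y1 u c - Y2 u c * X1 v c) / ((Y1 u c)\<^sup>2 + (X1 v c)\<^sup>2) powr (3 / 2)"
    by (simp only: curvature_def param_eq Let_def D1(1)[OF assms(1,2)] D1(2)[OF assms(1,3)]
        D2(1)[OF assms(1,2)] D2(2)[OF assms(1,3)] power2_minus)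
  also have "X2 v c * - Y1 u c - Y2 u c * X1 v c = - N u v c" by (simp add: N_def)
  finally show ?thesis by simp
qed

lemma curvature_zero_iff:
  assumes "c \<in> I" "c \<noteq> hi" "c \<noteq> - hi'"
  shows "curvature (V1 u) (V2 v) c = 0 \<longleftrightarrow> N u v c = 0"
  unfolding curvature_eq[OF assms] using positive[OF uv assms] by simp

lemma first_order_zero_curvature:
  assumes c: "c \<in> I" "c \<noteq> hi" "c \<noteq> - hi'" and z: "N u v c = 0" and nz: "X3 v c * Y1 u c - Y3 u c * X1 v c \<noteq> 0"
  shows "first_order_zero I (curvature (V1 u) (V2 v)) c"
proof -
  let ?g = "\<lambda>c. - (1 / ((Y1 u c)\<^sup>2 + (X1 v c)\<^sup>2) powr (3 / 2))"
  have p: "0 < (Y1 u c)\<^sup>2 + (X1 v c)\<^sup>2" using positive[OF uv c] by (simp add: add_pos_pos)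
  have "continuous (at c within I) (X1 v)" "continuous (at c within I) (Y1 u)"
    using DERIV_continuous[OF DX_I(2)[OF c(1,2)]] DERIV_continuous[OF DY_I(2)[OF c(1,3)]] by auto
  then have "continuous (at c within I) ?g"
    using p by (intro continuous_intros) auto
  from DERIV_mult_at_zero[OF DERIV_N_I[OF c] z this]
  have "((\<lambda>x. N u v x * ?g x) has_real_derivative (X3 v c * Y1 u c - Y3 u c * X1 v c) * ?g c) (at c within I)" .
  then have "(curvature (V1 u) (V2 v) has_real_derivative (X3 v c * Y1 u c - Y3 u c * X1 v c) * ?g c) (at c within I)"
  proof (rule has_field_derivative_transform_within[OF _ _ c(1)])
    show "0 < min \<bar>c - hi\<bar> \<bar>c + hi'\<bar>" using c by auto
    fix x assume "x \<in> I" "dist x c < min \<bar>c - hi\<bar> \<bar>c + hi'\<bar>"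
    then show "N u v x * ?g x = curvature (V1 u) (V2 v) x"
      by (intro curvature_eq[symmetric]) (auto simp: dist_real_def abs_minus_commute)
  qed
  moreover have "(X3 v c * Y1 u c - Y3 u c * X1 v c) * ?g c \<noteq> 0" using nz positive[OF uv c] by simp
  ultimately show ?thesis
    unfolding first_order_zero_def using curvature_zero_iff[OF c] z by blast
qed

text \<open>The exchange of the potentials inverts the slope, hence the reciprocal in the second bad
  set. The quotients in \<open>ends\<close> belong to \<open>c\<^sub>4\<close>,
  \<open>c\<^sub>1\<close>, \<open>c\<^sub>3\<close>, \<open>c\<^sub>2\<close>, in this
  order.\<close>

lemma nondegenerate_if_good:
  assumes good: "(u, v) \<notin> bad {y. \<not> typical y}" "(v, u) \<notin> S.bad {y. y \<noteq> 0 \<and> \<not> typical (inverse y)}"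
    and ends: "typical (X1 v lo / Y1 u lo)" "typical (X1 v (- lo') / Y1 u (- lo'))"
      "typical ((A hi + v * B hi) / (A' (- hi) + u * B' (- hi)))"
      "typical ((A (- hi') + v * B (- hi')) / (A' hi' + u * B' hi'))"
  shows "nondegenerate_metric (V1 u) (V2 v)"
proof -
  note gz = good_zeros[OF good(1) uv] and gz' = S.good_zeros[OF good(2) uv(2,1)]
  let ?Z = "{c \<in> {lo..<hi} \<union> {- hi'<..- lo'}. curvature (V1 u) (V2 v) c = 0}"
  have mem: "c \<in> I" "c \<noteq> hi" "c \<noteq> - hi'" if "c \<in> {lo..<hi} \<union> {- hi'<..- lo'}" for c
    using that order by auto
  have simple: "X3 v c * Y1 u c - Y3 u c * X1 v c \<noteq> 0" "typical (X1 v c / Y1 u c)"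
    if c: "c \<in> {lo..<hi} \<union> {- hi'<..- lo'}" and z: "N u v c = 0" for c
  proof -
    have "X3 v c * Y1 u c - Y3 u c * X1 v c \<noteq> 0 \<and> typical (X1 v c / Y1 u c)"
    proof (cases "c < hi")
      case True
      then have "c \<in> {lo..<hi}" using c order by auto
      from gz(2)[OF this z] show ?thesis by simp
    next
      case False
      then have "- c \<in> {lo'..<hi'}" using c order by auto
      from gz'(2)[OF this] z have *: "Y3 u c * X1 v c - X3 v c * Y1 u c \<noteq> 0"
        "Y1 u c / X1 v c \<notin> {y. y \<noteq> 0 \<and> \<not> typical (inverse y)}" by (simp_all add: swap_eqs)
      then show ?thesis using positive[OF uv mem[OF c]] by auto
    qed
    then show "X3 v c * Y1 u c - Y3 u c * X1 v c \<noteq> 0" "typical (X1 v c / Y1 u c)" by blast+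
  qed
  have "?Z \<subseteq> {c \<in> {lo..<hi}. N u v c = 0} \<union> uminus ` {c \<in> {lo'..<hi'}. S.N v u c = 0}"
  proof
    fix c assume c: "c \<in> ?Z"
    then have z: "N u v c = 0" using curvature_zero_iff[OF mem] by blast
    show "c \<in> {c \<in> {lo..<hi}. N u v c = 0} \<union> uminus ` {c \<in> {lo'..<hi'}. S.N v u c = 0}"
    proof (cases "c < hi")
      case True
      then show ?thesis using c z order by auto
    next
      case False
      then have "- c \<in> {c \<in> {lo'..<hi'}. S.N v u c = 0}" using c z order by (auto simp: swap_eqs)
      then have "- (- c) \<in> uminus ` {c \<in> {lo'..<hi'}. S.N v u c = 0}" by (rule imageI)
      then show ?thesis by simp
    qed
  qed
  then have fin: "finite ?Z" by (rule finite_subset) (use gz(1) gz'(1) in blast)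
  have fo: "\<forall>c\<in>?Z. first_order_zero I (curvature (V1 u) (V2 v)) c"
  proof
    fix c assume c: "c \<in> ?Z"
    then have m: "c \<in> {lo..<hi} \<union> {- hi'<..- lo'}" by blast
    then have z: "N u v c = 0" using curvature_zero_iff[OF mem[OF m]] c by blast
    show "first_order_zero I (curvature (V1 u) (V2 v)) c"
      by (rule first_order_zero_curvature[OF mem[OF m] z simple(1)[OF m z]])
  qed
  have ty: "\<forall>c\<in>I - {- hi', hi}. curvature (V1 u) (V2 v) c = 0 \<longrightarrow> typical (slope (V1 u) (V2 v) c)"
  proof (intro ballI impI)
    fix c assume c: "c \<in> I - {- hi', hi}" and k: "curvature (V1 u) (V2 v) c = 0"
    then have m: "c \<in> I" "c \<noteq> hi" "c \<noteq> - hi'" by auto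
    have z: "N u v c = 0" using curvature_zero_iff[OF m] k by blast
    have "c \<in> {lo..<hi} \<union> {- hi'<..- lo'}"
    proof (rule ccontr)
      assume "c \<notin> {lo..<hi} \<union> {- hi'<..- lo'}"
      \<comment> \<open>Here each action is taken above the top of its own well, where it is
        concave, so both terms of \<open>N\<close> are negative.\<close>
      then have c': "hi < c" "c < - hi'" using m by auto
      have "X2 v c < 0" "Y2 u c < 0"
        using X.above(5)[OF uv(2) c'(1)] Y.above(5)[OF uv(1), of "- c"] c' by (auto simp: X2_def Y2_def)
      then have "X2 v c * Y1 u c < 0" "Y2 u c * X1 v c < 0"
        using positive[OF uv m] by (auto simp: mult_less_0_iff)
      then show False using z by (simp add: N_def)
    qed
    then show "typical (slope (V1 u) (V2 v) c)"
      unfolding slope_eq[OF m] typical_uminus by (rule simple(2)[OF _ z])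
  qed
  have l: "lo \<in> I" "lo \<noteq> hi" "lo \<noteq> - hi'" "- lo' \<in> I" "- lo' \<noteq> hi" "- lo' \<noteq> - hi'" using order by auto
  have "typical (slope (V1 u) (V2 v) (- lo'))" "typical (slope (V1 u) (V2 v) lo)"
    unfolding slope_eq[OF l(1-3)] slope_eq[OF l(4-6)] typical_uminus using ends by auto
  moreover have "typical (F2 (V2 v) (- hi') / F1 (V1 u) (- hi'))" "typical (F2 (V2 v) hi / F1 (V1 u) hi)"
    unfolding F2_V2 F1_V1 using ends by simp_all
  ultimately show ?thesis
    unfolding nondegenerate_metric_def param_eq Let_def V_vals using V_in_Omega fin fo ty by simp
qed

end

lemma ex_good:
  assumes r: "0 < r" "r \<le> v0" "r \<le> v0'"
  obtains u v where "\<bar>u\<bar> \<le> r" "\<bar>v\<bar> \<le> r" "nondegenerate_metric (V1 u) (V2 v)"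
proof -
  let ?N = "{y. \<not> typical y}" and ?N' = "{y. y \<noteq> 0 \<and> \<not> typical (inverse y)}"
  have N': "negligible ?N'" using negligible_inverse_image[OF negligible_not_typical] by simp
  have "prod.swap differentiable_on S.bad ?N'"
    unfolding prod.swap_def by (intro differentiable_on_Pair differentiable_on_fst' differentiable_on_snd')
  then have n2: "negligible (prod.swap ` S.bad ?N')"
    by (intro negligible_differentiable_image_negligible S.negligible_bad N') auto
  let ?E = "\<lambda>p q r t. {(u, v). \<exists>y\<in>?N. p + v * q = y * (r + u * t)}"
  let ?E1 = "?E (A1 lo) (B1 lo) (A1' (- lo)) (B1' (- lo))" and ?E2 = "?E (A1 (- lo')) (B1 (- lo')) (A1' lo') (B1' lo')"
    and ?E3 = "?E (A hi) (B hi) (A' (- hi)) (B' (- hi))" and ?E4 = "?E (A (- hi')) (B (- hi')) (A' hi') (B' hi')"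
  \<comment> \<open>These are the coefficients of \<open>v\<close> in the four numerators. At
    \<open>lo\<close> the value is \<open>pi / 2\<close> by flatness; the other three levels are at
    or above the top \<open>hi\<close>, where the variation of the action and its first derivative
    do not vanish.\<close>
  have "B1 lo \<noteq> 0" "B1 (- lo') \<noteq> 0" "B hi \<noteq> 0" "B (- hi') \<noteq> 0"
    using X.flat(1)[of lo] X.s X.above(2)[of "- lo'"] X.above(1)[of hi] X.above(1)[of "- hi'"] order by auto
  note E = this[THEN negligible_affine_solutions[OF negligible_not_typical]]
  let ?B = "bad ?N \<union> (prod.swap ` S.bad ?N' \<union> (?E1 \<union> (?E2 \<union> (?E3 \<union> ?E4))))"
  have nB: "negligible ?B"
    by (intro negligible_Un negligible_bad[OF negligible_not_typical] n2 E)
  have "open ({0<..<r} \<times> {0<..<r})" by (intro open_Times open_greaterThanLessThan)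
  moreover have "{0<..<r} \<times> {0<..<r} \<noteq> {}" using dense[OF r(1)] by auto
  ultimately have "\<not> negligible ({0<..<r} \<times> {0<..<r})" by (rule open_not_negligible)
  then have "\<not> {0<..<r} \<times> {0<..<r} \<subseteq> ?B" using negligible_subset[OF nB] by blast
  then obtain u v where box: "u \<in> {0<..<r}" "v \<in> {0<..<r}" and nb: "(u, v) \<notin> ?B" by blast
  have le: "\<bar>u\<bar> \<le> r" "\<bar>v\<bar> \<le> r" "\<bar>u\<bar> \<le> v0'" "\<bar>v\<bar> \<le> v0" using box r by auto
  have ty: "typical (x / y)" if "(u, v) \<notin> ?E p q g t" "x = p + v * q" "y = g + u * t" "0 < y" for p q g t x y
  proof (rule ccontr)
    assume "\<not> typical (x / y)"
    moreover have "p + v * q = x / y * (g + u * t)" using that by simp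
    ultimately have "(u, v) \<in> ?E p q g t" by blast
    then show False using that(1) by contradiction
  qed
  have l: "lo \<in> I" "lo \<noteq> hi" "lo \<noteq> - hi'" "- lo' \<in> I" "- lo' \<noteq> hi" "- lo' \<noteq> - hi'" using order by auto
  have "nondegenerate_metric (V1 u) (V2 v)"
  proof (rule nondegenerate_if_good[OF le(3,4)])
    show "(u, v) \<notin> bad ?N" using nb by blast
    show "(v, u) \<notin> S.bad ?N'" using nb by force
    show "typical (X1 v lo / Y1 u lo)"
      by (rule ty[of "A1 lo" "B1 lo" "A1' (- lo)" "B1' (- lo)"])
        (use nb positive(2)[OF le(3,4) l(1-3)] in \<open>auto simp: X1_def Y1_def\<close>)
    show "typical (X1 v (- lo') / Y1 u (- lo'))"
      by (rule ty[of "A1 (- lo')" "B1 (- lo')" "A1' lo'" "B1' lo'"])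
        (use nb positive(2)[OF le(3,4) l(4-6)] in \<open>auto simp: X1_def Y1_def\<close>)
    show "typical ((A hi + v * B hi) / (A' (- hi) + u * B' (- hi)))"
      by (rule ty[of "A hi" "B hi" "A' (- hi)" "B' (- hi)"])
        (use nb Y.above(4)[OF le(3), of "- hi"] order in auto)
    show "typical ((A (- hi') + v * B (- hi')) / (A' hi' + u * B' hi'))"
      by (rule ty[of "A (- hi')" "B (- hi')" "A' hi'" "B' hi'"])
        (use nb Y.above(4)[OF le(3), of hi'] order in auto)
  qed
  with le(1,2) show ?thesis by (rule that)
qed

end

theorem theorem1p3p2:
  shows "subtopology (prod_topology whitney_topology whitney_topology) Omega
           closure_of {(U1, U2) \<in> Omega. nondegenerate_metric U1 U2} = Omega"
proof -
  let ?P = "prod_topology whitney_topology whitney_topology" and ?G = "{(U1, U2) \<in> Omega. nondegenerate_metric U1 U2}"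
  have top: "topspace (subtopology ?P Omega) = Omega"
    using Omega_subset_topspace by (simp add: topspace_subtopology Int_absorb1)
  have "p \<in> subtopology ?P Omega closure_of ?G" if p: "p \<in> Omega" for p
    unfolding in_closure_of top
  proof (intro conjI p allI impI)
    fix T assume T: "p \<in> T \<and> openin (subtopology ?P Omega) T"
    obtain U1 U2 where pU: "p = (U1, U2)" by (cases p)
    have adm: "admissible U1" "admissible U2" and gt: "\<And>q1 q2. U2 q2 < U1 q1"
      using p by (auto simp: pU Omega_def)
    have sp: "U1 \<in> smooth_periodic" "U2 \<in> smooth_periodic" using adm by (auto simp: admissible_def)
    obtain T' where T': "openin ?P T'" "T = T' \<inter> Omega" using T by (auto simp: openin_subtopology)
    have "(U1, U2) \<in> T'" using T T' pU by blast
    then obtain T1 T2 where T12: "openin whitney_topology T1" "openin whitney_topology T2" "U1 \<in> T1" "U2 \<in> T2" "T1 \<times> T2 \<subseteq> T'"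
      using iffD1[OF openin_prod_topology_alt T'(1), rule_format, OF \<open>(U1, U2) \<in> T'\<close>] by blast
    have less: "max_val U2 < min_val U1"
      using extremal_values_attained(1)[OF sp(2)] extremal_values_attained(2)[OF sp(1)] gt by metis
    define K where "K = 1 / (2 * (min_val U1 - max_val U2))"
    have K: "0 < K" using less by (simp add: K_def)
    obtain s v0 W A A1 A2 A3 B B1 B2 B3 where
      X: "well_curve U2 K (min_val U2) (max_val U2) s v0 W A A1 A2 A3 B B1 B2 B3"
      using ex_well_curve[OF adm(2) K] by blast
    obtain s' v0' W' A' A1' A2' A3' B' B1' B2' B3' where
      Y: "well_curve (\<lambda>q. - U1 q) K (- max_val U1) (- min_val U1) s' v0' W' A' A1' A2' A3' B' B1' B2' B3'"
      using ex_well_curve[OF admissible_uminus[OF adm(1)] K] unfolding max_val_uminus[OF sp(1)] by blast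
    interpret curve_pair U2 K "min_val U2" "max_val U2" s v0 W A A1 A2 A3 B B1 B2 B3
      "\<lambda>q. - U1 q" "- max_val U1" "- min_val U1" s' v0' W' A' A1' A2' A3' B' B1' B2' B3'
    proof (intro curve_pair.intro curve_pair_axioms.intro X Y)
      show "max_val U2 + - min_val U1 < 0" using less by simp
      show "K * (2 * (- max_val U2 - - min_val U1)) = 1" using less by (simp add: K_def)
    qed
    obtain d2 where d2: "d2 > 0" "\<And>v. \<bar>v\<bar> \<le> d2 \<Longrightarrow> \<bar>v\<bar> \<le> v0 \<Longrightarrow> W v \<in> T2"
      using openin_whitney_perturbation[OF T12(2,4) sp(2) X.W_smooth_periodic X.W_close] by blast
    have Wm: "(\<lambda>q. - W' u q) \<in> smooth_periodic" if "\<bar>u\<bar> \<le> v0'" for u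
      using admissible_uminus[OF Y.W(1)[OF that]] by (simp add: admissible_def)
    have Wc: "\<exists>d>0. \<forall>u q. \<bar>u\<bar> \<le> d \<longrightarrow> \<bar>u\<bar> \<le> v0' \<longrightarrow> \<bar>(deriv ^^ k) (\<lambda>q. - W' u q) q - (deriv ^^ k) U1 q\<bar> < e"
      if e: "0 < e" for k e
    proof -
      obtain d where d: "d > 0" "\<forall>u q. \<bar>u\<bar> \<le> d \<longrightarrow> \<bar>u\<bar> \<le> v0' \<longrightarrow> \<bar>(deriv ^^ k) (W' u) q - (deriv ^^ k) (\<lambda>q. - U1 q) q\<bar> < e"
        using Y.W_close[OF e, of k] by blast
      have "\<bar>(deriv ^^ k) (\<lambda>q. - W' u q) q - (deriv ^^ k) U1 q\<bar> < e" if u: "\<bar>u\<bar> \<le> d" "\<bar>u\<bar> \<le> v0'" for u q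
      proof -
        have sm: "smooth_on UNIV (W' u)" "smooth_on UNIV U1"
          using Y.W_smooth_periodic[OF u(2)] sp(1) by (auto simp: smooth_periodic_iff)
        show ?thesis using d(2)[rule_format, OF u, of q]
          unfolding funpow_deriv_uminus[OF sm(1)] funpow_deriv_uminus[OF sm(2)] by linarith
      qed
      then show ?thesis using d(1) by blast
    qed
    obtain d1 where d1: "d1 > 0" "\<And>u. \<bar>u\<bar> \<le> d1 \<Longrightarrow> \<bar>u\<bar> \<le> v0' \<Longrightarrow> (\<lambda>q. - W' u q) \<in> T1"
      using openin_whitney_perturbation[OF T12(1,3) sp(1) Wm Wc] by blast
    define r where "r = min (min d1 d2) (min v0 v0')"
    have r: "0 < r" "r \<le> v0" "r \<le> v0'" "r \<le> d1" "r \<le> d2"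
      using d1(1) d2(1) X.v0 Y.v0 by (auto simp: r_def)
    obtain u v where uv: "\<bar>u\<bar> \<le> r" "\<bar>v\<bar> \<le> r" "nondegenerate_metric (V1 u) (V2 v)"
      by (rule ex_good[OF r(1-3)]) (rule that)
    have "(V1 u, V2 v) \<in> Omega" by (rule V_in_Omega) (use uv r in linarith)+
    moreover have "V1 u \<in> T1" using d1(2)[of u] uv r by (simp add: V1_def[abs_def])
    moreover have "V2 v \<in> T2" using d2(2)[of v] uv r by (simp add: V2_def)
    ultimately have "(V1 u, V2 v) \<in> ?G \<and> (V1 u, V2 v) \<in> T" using uv(3) T12(5) T'(2) by blast
    then show "\<exists>y. y \<in> ?G \<and> y \<in> T" by blast
  qed
  then have "Omega \<subseteq> subtopology ?P Omega closure_of ?G" by blast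
  moreover have "subtopology ?P Omega closure_of ?G \<subseteq> Omega"
    using closure_of_subset_topspace[of "subtopology ?P Omega" ?G] unfolding top .
  ultimately show ?thesis by (rule subset_antisym[rotated])
qed

end
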